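(* Let $\Sigma$ be a closed Riemann surface of genus $g\ge 2$ with canonical bundle $K$ and a fixed square root $K^{1/2}$, and let $E=K^{\frac{n-1}{2}}\oplus K^{\frac{n-3}{2}}\oplus\cdots\oplus K^{-\frac{n-3}{2}}\oplus K^{-\frac{n-1}{2}}$. Let $\phi$ be either $\phi=\tilde e_1+q_ne_{n-1}$ with $q_n\in H^0(\Sigma,K^n)$ (and $n\ge 2$), or $\phi=\tilde e_1+q_{n-1}e_{n-2}$ with $q_{n-1}\in H^0(\Sigma,K^{n-1})$ (and $n\ge 3$). Then the harmonic metric (the Hermitian metric $h$ solving $F_{A_h}+[\phi,\phi^{*_h}]=0$) splits as $$h=h_1\oplus h_2\oplus\cdots\oplus h_2^{-1}\oplus h_1^{-1}$$ on the direct sum of line bundles $K^{\frac{n-1}{2}}\oplus K^{\frac{n-3}{2}}\oplus\cdots\oplus K^{-\frac{n-3}{2}}\oplus K^{-\frac{n-1}{2}}$, where $h_j$ is a Hermitian metric on $K^{\frac{n+1-2j}{2}}$ and $h_j^{-1}$ denotes the induced metric on the dual bundle $K^{-\frac{n+1-2j}{2}}$.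
   Context: Number the summands of $E$ by $i=1,\dots,n$, the $i$-th one being $K^{(n+1-2i)/2}$. A bundle map $E\to E\otimes K$ is written as an $n\times n$ matrix whose $(a,b)$ entry is a section of $K^{b-a+1}$. $\tilde e_1$ has $(i+1,i)$ entries equal to $1$ for $1\le i\le n-1$ and zeros elsewhere; $q_ne_{n-1}$ has single nonzero entry $q_n$ in position $(1,n)$; $q_{n-1}e_{n-2}$ has nonzero entries $q_{n-1}$ in positions $(1,n-1)$ and $(2,n)$. The pair $(E,\phi)$ is a stable $SL(n,\mathbb C)$-Higgs bundle (in the $SL(n,\mathbb R)$ Hitchin component), and by Hitchin and Simpson there is a unique Hermitian metric $h$ on $E$ (inducing the trivial metric on the trivial bundle $\det E$) with $F_{A_h}+[\phi,\phi^{*_h}]=0$, where $A_h$ is the Chern connection, $F_{A_h}$ its curvature and $\phi^{*_h}$ the $h$-adjoint. *)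

theory Defs
  imports
    "HOL-Analysis.Analysis"
    "HOL-Library.Function_Algebras"
    "Jordan_Normal_Form.Schur_Decomposition"
begin

section \<open>Closed Riemann surfaces\<close>

type_synonym 'a chart = "'a set \<times> ('a \<Rightarrow> complex)"

definition chart_inv :: "'a chart \<Rightarrow> complex \<Rightarrow> 'a" where
  "chart_inv c = inv_into (fst c) (snd c)"

text \<open>The atlas is any holomorphic atlas of the complex structure; it is not assumed to be
  maximal.\<close>

definition closed_riemann_surface :: "('a::t2_space) chart set \<Rightarrow> bool" where
  "closed_riemann_surface A \<longleftrightarrow>
     compact (UNIV :: 'a set) \<and> connected (UNIV :: 'a set) \<and>
     (\<Union>c\<in>A. fst c) = UNIV \<and>
     (\<forall>c\<in>A. open (fst c) \<and> open (snd c ` fst c) \<and>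
        homeomorphism (fst c) (snd c ` fst c) (snd c) (chart_inv c)) \<and>
     (\<forall>c\<in>A. \<forall>d\<in>A. (snd d \<circ> chart_inv c) holomorphic_on (snd c ` (fst c \<inter> fst d)))"

text \<open>Functions on (part of) a chart domain, read in the coordinate of the chart.\<close>

definition holomorphic_in_chart :: "'a chart \<Rightarrow> ('a \<Rightarrow> complex) \<Rightarrow> 'a set \<Rightarrow> bool" where
  "holomorphic_in_chart c f S \<longleftrightarrow> (f \<circ> chart_inv c) holomorphic_on (snd c ` S)"

text \<open>\<open>C_k k f S\<close>: \<open>f\<close> is \<open>k\<close> times continuously (real) differentiable on the open set \<open>S\<close>;
  the directions \<open>1\<close> and \<open>\<i>\<close> give the partial derivatives in \<open>x\<close> and \<open>y\<close>.\<close>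

fun C_k :: "nat \<Rightarrow> (complex \<Rightarrow> complex) \<Rightarrow> complex set \<Rightarrow> bool" where
  "C_k 0 f S \<longleftrightarrow> continuous_on S f"
| "C_k (Suc k) f S \<longleftrightarrow> (\<forall>w\<in>S. f differentiable (at w)) \<and>
     C_k k (\<lambda>w. frechet_derivative f (at w) 1) S \<and>
     C_k k (\<lambda>w. frechet_derivative f (at w) \<i>) S"

definition smooth_in_chart :: "'a chart \<Rightarrow> ('a \<Rightarrow> complex) \<Rightarrow> bool" where
  "smooth_in_chart c f \<longleftrightarrow> (\<forall>k. C_k k (f \<circ> chart_inv c) (snd c ` fst c))"

text \<open>Wirtinger derivatives.\<close>

definition d_z :: "(complex \<Rightarrow> complex) \<Rightarrow> complex \<Rightarrow> complex" where
  "d_z f w = (frechet_derivative f (at w) 1 - \<i> * frechet_derivative f (at w) \<i>) / 2"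

definition d_zbar :: "(complex \<Rightarrow> complex) \<Rightarrow> complex \<Rightarrow> complex" where
  "d_zbar f w = (frechet_derivative f (at w) 1 + \<i> * frechet_derivative f (at w) \<i>) / 2"


section \<open>The canonical bundle, its powers, and a square root\<close>

text \<open>With \<open>z\<^sub>c\<close> the coordinate of the chart \<open>c\<close>, the form \<open>dz\<^sub>c\<close> is a frame of \<open>K\<close> over the
  domain of \<open>c\<close>, and \<open>dz\<^sub>d = K_trans c d \<cdot> dz\<^sub>c\<close> on overlaps.\<close>

definition K_trans :: "'a chart \<Rightarrow> 'a chart \<Rightarrow> 'a \<Rightarrow> complex" where
  "K_trans c d p = deriv (snd d \<circ> chart_inv c) (snd c p)"

text \<open>\<open>H0_K A k\<close> is the space of holomorphic sections of the \<open>k\<close>-th power of \<open>K\<close>.  A section is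
  the family \<open>q\<close> of its coefficients, being \<open>q c \<cdot> dz\<^sub>c\<^sup>k\<close> over the domain of \<open>c\<close>.  The coefficients
  are set to \<open>0\<close> where they are meaningless, so that each section has just one representation.\<close>

definition H0_K :: "'a chart set \<Rightarrow> nat \<Rightarrow> ('a chart \<Rightarrow> 'a \<Rightarrow> complex) set" where
  "H0_K A k = {q.
     (\<forall>c p. c \<notin> A \<or> p \<notin> fst c \<longrightarrow> q c p = 0) \<and>
     (\<forall>c\<in>A. holomorphic_in_chart c (q c) (fst c)) \<and>
     (\<forall>c\<in>A. \<forall>d\<in>A. \<forall>p \<in> fst c \<inter> fst d. q c p = q d p * K_trans c d p ^ k)}"

text \<open>The genus, as the dimension of the space of holomorphic differentials.\<close>

definition genus :: "'a chart set \<Rightarrow> nat" where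
  "genus A = vector_space.dim (\<lambda>(a::complex) q c p. a * q c p) (H0_K A 1)"

text \<open>A square root of \<open>K\<close>, given by transition functions \<open>\<xi>\<close> squaring to those of \<open>K\<close>: over the
  domain of \<open>c\<close> there is a frame \<open>s\<^sub>c\<close> with \<open>s\<^sub>c\<^sup>2 = dz\<^sub>c\<close>, and \<open>s\<^sub>d = \<xi> c d \<cdot> s\<^sub>c\<close> on overlaps.
  Every square root of \<open>K\<close> has this form once the charts are small enough (e.g. for simply
  connected chart domains), and the atlas is arbitrary.\<close>

definition square_root_K :: "'a chart set \<Rightarrow> ('a chart \<Rightarrow> 'a chart \<Rightarrow> 'a \<Rightarrow> complex) \<Rightarrow> bool" where
  "square_root_K A \<xi> \<longleftrightarrow>
     (\<forall>c\<in>A. \<forall>d\<in>A. holomorphic_in_chart c (\<xi> c d) (fst c \<inter> fst d) \<and>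
        (\<forall>p \<in> fst c \<inter> fst d. (\<xi> c d p)\<^sup>2 = K_trans c d p)) \<and>
     (\<forall>c\<in>A. \<forall>d\<in>A. \<forall>e\<in>A. \<forall>p \<in> fst c \<inter> fst d \<inter> fst e. \<xi> c e p = \<xi> c d p * \<xi> d e p)"


section \<open>The bundle \<open>E\<close> and its Hermitian metrics\<close>

text \<open>The summands of \<open>E\<close> are numbered from \<open>0\<close> to \<open>n - 1\<close> as matrix indices are; the one with
  number \<open>a\<close> is the power of the square root of \<open>K\<close> with exponent \<open>weight n a\<close>, and the
  corresponding powers of \<open>s\<^sub>c\<close> form the frame of \<open>E\<close> over the domain of \<open>c\<close>.\<close>

definition weight :: "nat \<Rightarrow> nat \<Rightarrow> int" where
  "weight n a = int n - 1 - 2 * int a"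

text \<open>A Hermitian metric on the line bundle with frames \<open>s\<^sub>c\<close> to the power \<open>m\<close>, given by the squared
  norms \<open>\<eta> c\<close> of these frames.  The dual metric on the dual bundle is given by the reciprocals.\<close>

definition line_metric ::
  "'a chart set \<Rightarrow> ('a chart \<Rightarrow> 'a chart \<Rightarrow> 'a \<Rightarrow> complex) \<Rightarrow> int \<Rightarrow> ('a chart \<Rightarrow> 'a \<Rightarrow> real) \<Rightarrow> bool" where
  "line_metric A \<xi> m \<eta> \<longleftrightarrow>
     (\<forall>c\<in>A. (\<forall>p\<in>fst c. \<eta> c p > 0) \<and> smooth_in_chart c (\<lambda>p. complex_of_real (\<eta> c p))) \<and>
     (\<forall>c\<in>A. \<forall>d\<in>A. \<forall>p \<in> fst c \<inter> fst d. \<eta> d p = (cmod (\<xi> c d p powi m))\<^sup>2 * \<eta> c p)"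

definition dual_metric :: "('a chart \<Rightarrow> 'a \<Rightarrow> real) \<Rightarrow> 'a chart \<Rightarrow> 'a \<Rightarrow> real" where
  "dual_metric \<eta> c p = inverse (\<eta> c p)"

definition pos_def_hermitian :: "nat \<Rightarrow> complex mat \<Rightarrow> bool" where
  "pos_def_hermitian n M \<longleftrightarrow> M \<in> carrier_mat n n \<and> mat_adjoint M = M \<and>
     (\<forall>v \<in> carrier_vec n. v \<noteq> 0\<^sub>v n \<longrightarrow> Re ((M *\<^sub>v v) \<bullet>c v) > 0)"

text \<open>A Hermitian metric \<open>h\<close> on \<open>E\<close>, given by its matrices: \<open>h(v,w) = (H c p *\<^sub>v v) \<bullet>c w\<close> for
  coordinate vectors \<open>v\<close>, \<open>w\<close> in the frame over the domain of \<open>c\<close>.  The entry \<open>(a,b)\<close> thus pairs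
  the frame vector \<open>b\<close> with the frame vector \<open>a\<close>, conjugate linearly in the latter.\<close>

definition hermitian_metric ::
  "'a chart set \<Rightarrow> ('a chart \<Rightarrow> 'a chart \<Rightarrow> 'a \<Rightarrow> complex) \<Rightarrow> nat \<Rightarrow> ('a chart \<Rightarrow> 'a \<Rightarrow> complex mat) \<Rightarrow> bool" where
  "hermitian_metric A \<xi> n H \<longleftrightarrow>
     (\<forall>c\<in>A. \<forall>p\<in>fst c. pos_def_hermitian n (H c p)) \<and>
     (\<forall>c\<in>A. \<forall>a<n. \<forall>b<n. smooth_in_chart c (\<lambda>p. H c p $$ (a, b))) \<and>
     (\<forall>c\<in>A. \<forall>d\<in>A. \<forall>p \<in> fst c \<inter> fst d. \<forall>a<n. \<forall>b<n.
        H d p $$ (a, b) =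
          cnj (\<xi> c d p powi weight n a) * (\<xi> c d p powi weight n b) * H c p $$ (a, b))"

text \<open>The weights add up to \<open>0\<close>, so the frames of \<open>E\<close> induce one and the same global frame of
  \<open>det E\<close>, whose squared norm in the metric induced by \<open>H\<close> is \<open>det (H c p)\<close>.\<close>

definition induces_trivial_det_metric :: "'a chart set \<Rightarrow> ('a chart \<Rightarrow> 'a \<Rightarrow> complex mat) \<Rightarrow> bool" where
  "induces_trivial_det_metric A H \<longleftrightarrow> (\<forall>c\<in>A. \<forall>p\<in>fst c. Determinant.det (H c p) = 1)"

definition diagonal_metric :: "nat \<Rightarrow> (nat \<Rightarrow> 'a chart \<Rightarrow> 'a \<Rightarrow> real) \<Rightarrow> 'a chart \<Rightarrow> 'a \<Rightarrow> complex mat" where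
  "diagonal_metric n \<eta> c p =
     Matrix.mat n n (\<lambda>(a, b). if a = b then complex_of_real (\<eta> a c p) else 0)"


section \<open>Hitchin's equation\<close>

definition mat_inv :: "complex mat \<Rightarrow> complex mat" where
  "mat_inv M = (1 / Determinant.det M) \<cdot>\<^sub>m adj_mat M"

text \<open>In a holomorphic frame the Chern connection is \<open>d + \<theta>\<close>, where \<open>\<theta> = H\<^sup>-\<^sup>1 \<partial>H\<close> has type
  \<open>(1,0)\<close>, and its curvature is \<open>d\<theta> + \<theta> \<and> \<theta>\<close>, which is the \<open>(0,1)\<close>-derivative of \<open>\<theta>\<close>.
  Here \<open>H\<close> is the matrix of the metric as a function of the coordinate \<open>z\<close>.
  \<open>chern_form\<close> is the coefficient of \<open>\<theta>\<close> at \<open>dz\<close>, and \<open>chern_curvature\<close> is the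
  coefficient of the curvature at \<open>dz \<and> dz\<^sup>*\<close>, where \<open>dz\<^sup>*\<close> is the conjugate of \<open>dz\<close>; the sign
  comes from \<open>dz\<^sup>* \<and> dz = - dz \<and> dz\<^sup>*\<close>.\<close>

definition chern_form :: "nat \<Rightarrow> (complex \<Rightarrow> complex mat) \<Rightarrow> complex \<Rightarrow> complex mat" where
  "chern_form n H w = mat_inv (H w) * Matrix.mat n n (\<lambda>(a, b). d_z (\<lambda>u. H u $$ (a, b)) w)"

definition chern_curvature :: "nat \<Rightarrow> (complex \<Rightarrow> complex mat) \<Rightarrow> complex \<Rightarrow> complex mat" where
  "chern_curvature n H w = - Matrix.mat n n (\<lambda>(a, b). d_zbar (\<lambda>u. chern_form n H u $$ (a, b)) w)"

text \<open>The adjoint of \<open>P\<close> with respect to the Hermitian form with matrix \<open>H\<close>.\<close>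

definition metric_adjoint :: "complex mat \<Rightarrow> complex mat \<Rightarrow> complex mat" where
  "metric_adjoint H P = mat_inv H * mat_adjoint P * H"

text \<open>A Higgs field is \<open>\<Phi> c \<cdot> dz\<^sub>c\<close> in the frame over the domain of \<open>c\<close>.  Its adjoint is
  \<open>metric_adjoint (H c) (\<Phi> c) \<cdot> dz\<^sub>c\<^sup>*\<close>, so the bracket of the two one-forms is the commutator of
  the coefficients times \<open>dz\<^sub>c \<and> dz\<^sub>c\<^sup>*\<close>.\<close>

definition hitchin_equation ::
  "'a chart set \<Rightarrow> nat \<Rightarrow> ('a chart \<Rightarrow> 'a \<Rightarrow> complex mat) \<Rightarrow> ('a chart \<Rightarrow> 'a \<Rightarrow> complex mat) \<Rightarrow> bool" where
  "hitchin_equation A n \<Phi> H \<longleftrightarrow>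
     (\<forall>c\<in>A. \<forall>p\<in>fst c.
        chern_curvature n (H c \<circ> chart_inv c) (snd c p) +
        (\<Phi> c p * metric_adjoint (H c p) (\<Phi> c p) - metric_adjoint (H c p) (\<Phi> c p) * \<Phi> c p)
        = 0\<^sub>m n n)"

definition harmonic_metric ::
  "'a chart set \<Rightarrow> ('a chart \<Rightarrow> 'a chart \<Rightarrow> 'a \<Rightarrow> complex) \<Rightarrow> nat \<Rightarrow>
   ('a chart \<Rightarrow> 'a \<Rightarrow> complex mat) \<Rightarrow> ('a chart \<Rightarrow> 'a \<Rightarrow> complex mat) \<Rightarrow> bool" where
  "harmonic_metric A \<xi> n \<Phi> H \<longleftrightarrow>
     hermitian_metric A \<xi> n H \<and> induces_trivial_det_metric A H \<and> hitchin_equation A n \<Phi> H"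


section \<open>The Higgs fields\<close>

text \<open>The entry \<open>(a,b)\<close> of a Higgs field is a section of \<open>K\<close> to the power \<open>b - a + 1\<close>, and since
  \<open>s\<^sub>c\<^sup>2 = dz\<^sub>c\<close>, its coefficient in the frame of \<open>E\<close> and \<open>dz\<^sub>c\<close> is that with respect to the
  corresponding power of \<open>dz\<^sub>c\<close>.\<close>

definition e1_tilde :: "nat \<Rightarrow> complex mat" where
  "e1_tilde n = Matrix.mat n n (\<lambda>(a, b). if a = b + 1 then 1 else 0)"

definition e_top :: "nat \<Rightarrow> complex mat" where \<comment> \<open>\<open>e\<^sub>n\<^sub>-\<^sub>1\<close>\<close>
  "e_top n = Matrix.mat n n (\<lambda>(a, b). if a = 0 \<and> b = n - 1 then 1 else 0)"

definition e_subtop :: "nat \<Rightarrow> complex mat" where \<comment> \<open>\<open>e\<^sub>n\<^sub>-\<^sub>2\<close>\<close>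
  "e_subtop n = Matrix.mat n n (\<lambda>(a, b). if (a = 0 \<and> b = n - 2) \<or> (a = 1 \<and> b = n - 1) then 1 else 0)"

definition higgs_top :: "nat \<Rightarrow> ('a chart \<Rightarrow> 'a \<Rightarrow> complex) \<Rightarrow> 'a chart \<Rightarrow> 'a \<Rightarrow> complex mat" where
  "higgs_top n q c p = e1_tilde n + q c p \<cdot>\<^sub>m e_top n"

definition higgs_subtop :: "nat \<Rightarrow> ('a chart \<Rightarrow> 'a \<Rightarrow> complex) \<Rightarrow> 'a chart \<Rightarrow> 'a \<Rightarrow> complex mat" where
  "higgs_subtop n q c p = e1_tilde n + q c p \<cdot>\<^sub>m e_subtop n"

end

theory Submission
  imports Defs "HOL-Complex_Analysis.Conformal_Mappings"
begin

text \<open>For two solutions \<open>H\<close>, \<open>K\<close> of Hitchin's equation put \<open>s = H\<^sup>-\<^sup>1 K\<close>.  The Laplacian of \<open>tr s\<close> is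
  a sum of squared norms of the \<open>(0,1)\<close>-derivative of \<open>s\<close> and of \<open>[s, \<Phi>]\<close>, so \<open>tr s\<close> is constant by
  the strong maximum principle and \<open>s\<close> commutes with \<open>\<Phi>\<close>.  Since the genus is at least two, \<open>q\<close> has
  a zero; there \<open>\<Phi>\<close> is a single nilpotent Jordan block, and \<open>det s = 1\<close> forces \<open>tr s = n\<close>.  As also
  \<open>tr s\<^sup>-\<^sup>1 = n\<close>, the sum of the two traces is minimal and \<open>H = K\<close>.

  This uniqueness is applied to two images of \<open>H\<close>.  A diagonal gauge transformation by powers of a
  root of unity multiplies \<open>\<Phi>\<close> by a unit scalar, so it fixes \<open>H\<close>, which kills the off-diagonal entries
  (except for one pair in the second case).  The dual metric, carried back to \<open>E\<close> by the symmetry of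
  \<open>\<Phi>\<close> in the antidiagonal, also equals \<open>H\<close>; this gives the remaining entries.\<close>

section \<open>Square complex matrices\<close>

text \<open>Uniqueness of the harmonic metric is usually drawn from stability: \<open>s\<close> is a
  holomorphic endomorphism commuting with the Higgs field, hence a scalar. Here one point replaces
  stability: the commutant of a single nilpotent block consists of the polynomials in it, so
  \<open>s\<close> has only one eigenvalue at a zero of \<open>q\<close>. Away from that point only
  the trace is controlled, which is why the roles of the two metrics are exchanged at the end. The
  genus enters through the zero alone; on a torus a nowhere vanishing \<open>q\<close> exists.

  The order \<open>m\<close> of the root of unity is the degree of the differential. With this
  choice all nonzero entries \<open>(a,b)\<close> of the Higgs field have \<open>b - a\<close>
  congruent to \<open>-1\<close> modulo \<open>m\<close>, so the gauge transformation rescales them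
  by one common factor. An entry of the metric survives only if \<open>b - a\<close> is divisible by
  \<open>m\<close>. For \<open>m = n\<close> this leaves the diagonal, but for
  \<open>m = n - 1\<close> also the two corners, and these are the reason why duality has to be used
  before the metric is known to be diagonal.\<close>

definition mtrace :: "complex mat \<Rightarrow> complex" where
  "mtrace M = (\<Sum>i<dim_row M. M $$ (i, i))"

lemma mat_adjoint_dim [simp]:
  "dim_row (mat_adjoint M) = dim_col M" "dim_col (mat_adjoint M) = dim_row M"
  by (simp_all add: mat_adjoint_def)

lemma mat_adjoint_carrier [simp]:
  "mat_adjoint M \<in> carrier_mat n m \<longleftrightarrow> M \<in> carrier_mat m n"
  unfolding carrier_mat_def mem_Collect_eq mat_adjoint_dim by blast

lemma mat_adjoint_index [simp]:
  fixes M :: "complex mat"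
  assumes "i < dim_col M" "j < dim_row M"
  shows "mat_adjoint M $$ (i, j) = cnj (M $$ (j, i))"
  using assms by (auto simp: mat_adjoint_def mat_of_rows_def conjugate_complex_def)

lemma mult_mat_index:
  fixes A B :: "complex mat"
  assumes "A \<in> carrier_mat m n" "B \<in> carrier_mat n l" "i < m" "j < l"
  shows "(A * B) $$ (i, j) = (\<Sum>k<n. A $$ (i, k) * B $$ (k, j))"
  using assms by (auto simp: scalar_prod_def atLeast0LessThan intro!: sum.cong)

lemma mat_adjoint_mult:
  fixes A B :: "complex mat"
  assumes "A \<in> carrier_mat m n" "B \<in> carrier_mat n l"
  shows "mat_adjoint (A * B) = mat_adjoint B * mat_adjoint A"
proof (rule eq_matI)
  fix i j assume "i < dim_row (mat_adjoint B * mat_adjoint A)" "j < dim_col (mat_adjoint B * mat_adjoint A)"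
  then have ij: "i < l" "j < m"
    using assms by auto
  have "mat_adjoint (A * B) $$ (i, j) = cnj ((A * B) $$ (j, i))"
    by (rule mat_adjoint_index) (use assms ij in auto)
  also have "\<dots> = (\<Sum>k<n. cnj (A $$ (j, k)) * cnj (B $$ (k, i)))"
    by (subst mult_mat_index[OF assms]) (use ij in auto)
  also have "\<dots> = (mat_adjoint B * mat_adjoint A) $$ (i, j)"
    by (subst mult_mat_index[of _ l n _ m])
       (use assms ij in \<open>auto intro!: sum.cong simp: mult.commute\<close>)
  finally show "mat_adjoint (A * B) $$ (i, j) = (mat_adjoint B * mat_adjoint A) $$ (i, j)" .
qed (use assms in auto)

lemma mat_adjoint_adjoint [simp]: "mat_adjoint (mat_adjoint A) = (A :: complex mat)"
  by (rule eq_matI) auto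

lemma mat_adjoint_diff:
  fixes A B :: "complex mat"
  assumes "A \<in> carrier_mat m n" "B \<in> carrier_mat m n"
  shows "mat_adjoint (A - B) = mat_adjoint A - mat_adjoint B"
  by (rule eq_matI) (use assms in auto)

lemma mat_adjoint_zero: "mat_adjoint (0\<^sub>m m n :: complex mat) = 0\<^sub>m n m"
  by (rule eq_matI) auto

lemma mat_adjoint_one: "mat_adjoint (1\<^sub>m n :: complex mat) = 1\<^sub>m n"
  by (rule eq_matI) auto

lemma mtrace_add:
  "A \<in> carrier_mat n n \<Longrightarrow> B \<in> carrier_mat n n \<Longrightarrow> mtrace (A + B) = mtrace A + mtrace B"
  by (auto simp: mtrace_def sum.distrib)

lemma mtrace_diff:
  "A \<in> carrier_mat n n \<Longrightarrow> B \<in> carrier_mat n n \<Longrightarrow> mtrace (A - B) = mtrace A - mtrace B"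
  by (auto simp: mtrace_def sum_subtractf)

lemma mtrace_one: "mtrace (1\<^sub>m n) = of_nat n"
  by (simp add: mtrace_def)

lemma mtrace_mult:
  assumes "A \<in> carrier_mat m n" "B \<in> carrier_mat n m"
  shows "mtrace (A * B) = (\<Sum>i<m. \<Sum>j<n. A $$ (i, j) * B $$ (j, i))"
  using assms by (auto simp: mtrace_def mult_mat_index[OF assms] simp del: index_mult_mat(1))

lemma mtrace_comm:
  assumes "A \<in> carrier_mat m n" "B \<in> carrier_mat n m"
  shows "mtrace (A * B) = mtrace (B * A)"
  unfolding mtrace_mult[OF assms] mtrace_mult[OF assms(2,1)]
  by (subst sum.swap) (simp add: mult.commute)

text \<open>The laws for products have side conditions about inner dimensions that their conclusions
  do not mention; with one size \<open>n\<close> for all factors they can serve as rewrite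
  rules.\<close>

lemmas sq_carrier = mult_carrier_mat[of _ n n _ n for n] minus_carrier_mat[of _ n n for n]
lemmas sq_assoc = assoc_mult_mat[of _ n n _ n _ n for n]
lemmas sq_distribs =
  minus_mult_distrib_mat[of _ n n _ _ n for n] mult_minus_distrib_mat[of _ n n _ n for n]
  add_mult_distrib_mat[of _ n n _ _ n for n] mult_add_distrib_mat[of _ n n _ n for n]

section \<open>Inverses of matrices of determinant one\<close>

lemma left_cancel_mat:
  fixes G H X :: "complex mat"
  assumes "G * H = 1\<^sub>m n" "G \<in> carrier_mat n n" "H \<in> carrier_mat n n" "X \<in> carrier_mat n n"
  shows "G * (H * X) = X"
  using assms by (metis assoc_mult_mat left_mult_one_mat)

lemma mat_inv_unique:
  fixes G H X :: "complex mat"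
  assumes "G * H = 1\<^sub>m n" "H * X = 1\<^sub>m n"
    and "G \<in> carrier_mat n n" "H \<in> carrier_mat n n" "X \<in> carrier_mat n n"
  shows "G = X"
  using assms by (metis assoc_mult_mat left_mult_one_mat right_mult_one_mat)

lemma
  assumes "H \<in> carrier_mat n n" "Determinant.det H = 1"
  shows mat_inv_carrier: "mat_inv H \<in> carrier_mat n n"
    and mat_inv_left: "mat_inv H * H = 1\<^sub>m n"
    and mat_inv_right: "H * mat_inv H = 1\<^sub>m n"
proof -
  have "mat_inv H = adj_mat H"
    using assms(2) by (auto simp: mat_inv_def)
  then show "mat_inv H \<in> carrier_mat n n" "mat_inv H * H = 1\<^sub>m n" "H * mat_inv H = 1\<^sub>m n"
    using adj_mat[OF assms(1)] assms by auto
qed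

lemma mat_inv_eqI:
  assumes "H \<in> carrier_mat n n" "Determinant.det H = 1" "G \<in> carrier_mat n n" "G * H = 1\<^sub>m n"
  shows "mat_inv H = G"
  using mat_inv_unique[OF assms(4) mat_inv_right[OF assms(1,2)]] assms mat_inv_carrier[OF assms(1,2)]
  by simp

lemma mat_adjoint_inverse:
  fixes K J :: "complex mat"
  assumes "K \<in> carrier_mat n n" "J \<in> carrier_mat n n" "J * K = 1\<^sub>m n" "K * J = 1\<^sub>m n"
    and "mat_adjoint K = K"
  shows "mat_adjoint J = J"
proof -
  have "mat_adjoint J * K = 1\<^sub>m n"
    using mat_adjoint_mult[OF assms(1,2)] assms(4,5) mat_adjoint_one by simp
  then show ?thesis
    using mat_inv_unique[of "mat_adjoint J" K n J] assms by simp
qed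

section \<open>Positive definite matrices\<close>

text \<open>The induction completes the square in the last variable.\<close>

lemma cholesky:
  fixes H :: "nat \<Rightarrow> nat \<Rightarrow> complex"
  assumes herm: "\<And>i j. i < n \<Longrightarrow> j < n \<Longrightarrow> H j i = cnj (H i j)"
    and pos: "\<And>v. \<exists>i<n. v i \<noteq> 0 \<Longrightarrow> Re (\<Sum>i<n. \<Sum>j<n. cnj (v i) * H i j * v j) > 0"
  shows "\<exists>x. \<forall>i<n. \<forall>j<n. H i j = (\<Sum>k<n. x k i * cnj (x k j))"
  using assms
proof (induction n arbitrary: H)
  case 0
  then show ?case by simp
next
  case (Suc n)
  define d where "d = Re (H n n)"
  have "Re (\<Sum>i<Suc n. \<Sum>j<Suc n. cnj (if i = n then 1 else 0) * H i j * (if j = n then 1 else 0)) > 0"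
    by (rule Suc.prems(2)) (auto intro: exI[of _ n])
  then have d: "d > 0"
    by (simp add: d_def)
  have "H n n = cnj (H n n)"
    by (rule Suc.prems(1)) auto
  then have Hnn: "H n n = of_real d"
    unfolding d_def by (metis Reals_cnj_iff complex_is_Real_iff complex_of_real_def complex.collapse)
  \<comment> \<open>The Schur complement of the pivot \<open>d\<close>: what remains after the rank
    one part of the last column is split off. The formula gives \<open>0\<close> when an index is
    \<open>n\<close>.\<close>
  define H' where "H' = (\<lambda>i j. H i j - H i n * H n j / of_real d)"
  have "\<exists>x. \<forall>i<n. \<forall>j<n. H' i j = (\<Sum>k<n. x k i * cnj (x k j))"
  proof (rule Suc.IH)
    fix i j assume ij: "i < n" "j < n"
    have "H j i = cnj (H i j)" "H j n = cnj (H n j)" "H n i = cnj (H i n)"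
      by (rule Suc.prems(1); use ij in simp)+
    then show "H' j i = cnj (H' i j)"
      by (simp add: H'_def)
  next
    fix v :: "nat \<Rightarrow> complex" assume v: "\<exists>i<n. v i \<noteq> 0"
    define a where "a = (\<Sum>j<n. H n j * v j)"
    \<comment> \<open>With the other coordinates fixed, the form is smallest at this last
      coordinate; there the cross terms leave exactly the form of \<open>H'\<close> at
      \<open>v\<close>.\<close>
    define w where "w = (\<lambda>i. if i < n then v i else - a / of_real d)"
    have ca: "(\<Sum>i<n. cnj (v i) * H i n) = cnj a"
      unfolding a_def cnj_sum
    proof (rule sum.cong)
      fix i assume "i \<in> {..<n}"
      then have "H i n = cnj (H n i)" by (intro Suc.prems(1)) auto
      then show "cnj (v i) * H i n = cnj (H n i * v i)" by simp
    qed simp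
    have "(\<Sum>i<Suc n. \<Sum>j<Suc n. cnj (w i) * H i j * w j) =
        (\<Sum>i<n. \<Sum>j<n. cnj (v i) * H i j * v j) + (\<Sum>i<n. cnj (v i) * H i n) * w n
        + cnj (w n) * a + cnj (w n) * H n n * w n"
    proof -
      have wv: "w i = v i" if "i < n" for i
        using that by (simp add: w_def)
      show ?thesis
        by (simp add: wv sum.distrib a_def sum_distrib_left sum_distrib_right mult.assoc)
    qed
    also have "\<dots> = (\<Sum>i<n. \<Sum>j<n. cnj (v i) * H i j * v j) - cnj a * a / of_real d"
      using d by (simp add: ca Hnn w_def field_simps)
    also have "\<dots> = (\<Sum>i<n. \<Sum>j<n. cnj (v i) * H' i j * v j)"
    proof -
      have "cnj a * a = (\<Sum>i<n. \<Sum>j<n. cnj (v i) * H i n * (H n j * v j))"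
        unfolding ca[symmetric] unfolding a_def by (simp add: sum_product)
      then show ?thesis
        by (simp add: H'_def algebra_simps sum_subtractf sum_divide_distrib)
    qed
    finally have eq: "(\<Sum>i<Suc n. \<Sum>j<Suc n. cnj (w i) * H i j * w j) =
      (\<Sum>i<n. \<Sum>j<n. cnj (v i) * H' i j * v j)" .
    have "\<exists>i<Suc n. w i \<noteq> 0"
      using v by (auto simp: w_def intro: less_SucI)
    from Suc.prems(2)[OF this] show "Re (\<Sum>i<n. \<Sum>j<n. cnj (v i) * H' i j * v j) > 0"
      unfolding eq .
  qed
  then obtain x where x: "\<And>i j. i < n \<Longrightarrow> j < n \<Longrightarrow> H' i j = (\<Sum>k<n. x k i * cnj (x k j))"
    by blast
  \<comment> \<open>The factors of \<open>H'\<close> are continued by \<open>0\<close> at the index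
    \<open>n\<close>, and the rank one part that was split off becomes the last factor, the pivot
    being shared as two copies of \<open>sqrt d\<close>.\<close>
  define y where "y = (\<lambda>k i. if k < n then (if i < n then x k i else 0) else H i n / of_real (sqrt d))"
  have sd: "complex_of_real (sqrt d) * complex_of_real (sqrt d) = of_real d"
    using d by (simp flip: of_real_mult)
  have "H i j = (\<Sum>k<Suc n. y k i * cnj (y k j))" if "i < Suc n" "j < Suc n" for i j
  proof -
    have "H n j = cnj (H j n)"
      by (rule Suc.prems(1)) (use that in auto)
    then have last: "y n i * cnj (y n j) = H i n * H n j / of_real d"
      using sd by (simp add: y_def)
    show ?thesis
    proof (cases "i < n \<and> j < n")
      case True
      then show ?thesis
        using x[of i j] last by (simp add: y_def H'_def diff_eq_eq)
    next
      case False
      then have "i = n \<or> j = n" using that by auto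
      then have "H i n * H n j / of_real d = H i j"
        using d by (auto simp: Hnn)
      moreover have "(\<Sum>k<n. y k i * cnj (y k j)) = 0"
        using False by (auto simp: y_def intro!: sum.neutral)
      ultimately show ?thesis using last by simp
    qed
  qed
  then show ?case by blast
qed

lemma pos_def_hermitianD:
  assumes "pos_def_hermitian n M"
  shows "M \<in> carrier_mat n n" "mat_adjoint M = M"
    and "\<And>v. v \<in> carrier_vec n \<Longrightarrow> v \<noteq> 0\<^sub>v n \<Longrightarrow> Re ((M *\<^sub>v v) \<bullet>c v) > 0"
  using assms by (auto simp: pos_def_hermitian_def)

lemma pos_def_hermitian_cnj:
  assumes "pos_def_hermitian n M" "i < n" "j < n"
  shows "M $$ (j, i) = cnj (M $$ (i, j))"
  using mat_adjoint_index[of j M i]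
    pos_def_hermitianD(1,2)[OF assms(1)] assms by auto

lemma quadratic_form_index:
  fixes M :: "complex mat"
  assumes "M \<in> carrier_mat n n" "v \<in> carrier_vec n"
  shows "(M *\<^sub>v v) \<bullet>c v = (\<Sum>i<n. \<Sum>j<n. cnj (vec_index v i) * M $$ (i, j) * vec_index v j)"
  using assms
  by (auto simp: scalar_prod_def conjugate_complex_def atLeast0LessThan sum_distrib_left mult_ac
      intro!: sum.cong)

lemma pos_def_hermitian_diag:
  assumes "pos_def_hermitian n M" "i < n"
  shows "Re (M $$ (i, i)) > 0" "M $$ (i, i) = of_real (Re (M $$ (i, i)))"
proof -
  let ?v = "unit_vec n i :: complex vec"
  have "(M *\<^sub>v ?v) \<bullet>c ?v = (\<Sum>k<n. \<Sum>j<n. cnj (vec_index ?v k) * M $$ (k, j) * vec_index ?v j)"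
    by (rule quadratic_form_index) (use pos_def_hermitianD[OF assms(1)] in auto)
  also have "\<dots> = (\<Sum>k<n. if k = i then (\<Sum>j<n. if j = i then M $$ (k, j) else 0) else 0)"
    using assms(2) by (intro sum.cong refl) (auto simp: if_distrib cong: if_cong intro!: sum.cong)
  also have "\<dots> = M $$ (i, i)"
    using assms(2) by (subst sum.delta; simp)+
  finally have "(M *\<^sub>v ?v) \<bullet>c ?v = M $$ (i, i)" .
  moreover have "?v \<noteq> 0\<^sub>v n"
    using assms(2) by (metis index_unit_vec(2) index_zero_vec(1) zero_neq_one)
  ultimately show "Re (M $$ (i, i)) > 0"
    using pos_def_hermitianD(3)[OF assms(1), of ?v] by simp
  show "M $$ (i, i) = of_real (Re (M $$ (i, i)))"
    using pos_def_hermitian_cnj[OF assms(1,2,2)]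
    by (metis Reals_cnj_iff of_real_Re)
qed

lemma pos_def_hermitian_factor:
  assumes "pos_def_hermitian n H"
  shows "\<exists>X \<in> carrier_mat n n. H = X * mat_adjoint X"
proof -
  note H = pos_def_hermitianD[OF assms]
  have "\<exists>x. \<forall>i<n. \<forall>j<n. H $$ (i, j) = (\<Sum>k<n. x k i * cnj (x k j))"
  proof (rule cholesky)
    fix i j assume "i < n" "j < n"
    then show "H $$ (j, i) = cnj (H $$ (i, j))"
      by (rule pos_def_hermitian_cnj[OF assms])
  next
    fix v :: "nat \<Rightarrow> complex" assume "\<exists>i<n. v i \<noteq> 0"
    then have "Matrix.vec n v \<noteq> 0\<^sub>v n"
      by (metis index_vec index_zero_vec(1))
    then have "Re ((H *\<^sub>v Matrix.vec n v) \<bullet>c Matrix.vec n v) > 0"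
      by (intro H) auto
    then show "Re (\<Sum>i<n. \<Sum>j<n. cnj (v i) * H $$ (i, j) * v j) > 0"
      by (subst (asm) quadratic_form_index[OF H(1)]) auto
  qed
  then obtain x where x: "\<And>i j. i < n \<Longrightarrow> j < n \<Longrightarrow> H $$ (i, j) = (\<Sum>k<n. x k i * cnj (x k j))"
    by blast
  define X where "X = Matrix.mat n n (\<lambda>(i, k). x k i)"
  have X: "X \<in> carrier_mat n n"
    by (simp add: X_def)
  have "H = X * mat_adjoint X"
  proof (rule eq_matI)
    fix i j assume "i < dim_row (X * mat_adjoint X)" "j < dim_col (X * mat_adjoint X)"
    then have ij: "i < n" "j < n" using X by auto
    show "H $$ (i, j) = (X * mat_adjoint X) $$ (i, j)"
      by (subst mult_mat_index[of _ n n _ n])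
         (use X ij in \<open>simp_all add: x X_def\<close>)
  qed (use H X in auto)
  then show ?thesis using X by blast
qed

text \<open>\<open>J * mat_adjoint B * H\<close> is the adjoint of \<open>B\<close> as a map from
  the space with the form \<open>K\<close> to the space with the form \<open>H\<close>, so the trace
  is the squared Hilbert-Schmidt norm of \<open>B\<close> for these two forms.\<close>

lemma
  assumes H: "pos_def_hermitian n H" and K: "pos_def_hermitian n K"
    and J: "J \<in> carrier_mat n n" "J * K = 1\<^sub>m n" "K * J = 1\<^sub>m n"
    and G: "G \<in> carrier_mat n n" "H * G = 1\<^sub>m n"
    and B: "B \<in> carrier_mat n n"
  shows mtrace_norm_nonneg: "Re (mtrace (B * J * mat_adjoint B * H)) \<ge> 0"
    and mtrace_norm_eq_0: "Re (mtrace (B * J * mat_adjoint B * H)) = 0 \<Longrightarrow> B = 0\<^sub>m n n"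
proof -
  note KD = pos_def_hermitianD[OF K] and HD = pos_def_hermitianD[OF H]
  obtain X where X: "X \<in> carrier_mat n n" "H = X * mat_adjoint X"
    using pos_def_hermitian_factor[OF H] by blast
  have Jadj: "mat_adjoint J = J"
    using mat_adjoint_inverse[OF KD(1) J KD(2)] .
  \<comment> \<open>Once \<open>H\<close> is factored and \<open>X\<close> is moved to the front by
    cyclicity, the trace becomes that of \<open>mat_adjoint Y * K * Y\<close>, whose diagonal
    entries are the squared \<open>K\<close>-norms of the columns of \<open>Y\<close>.\<close>
  define Y where "Y = J * (mat_adjoint B * X)"
  have Y: "Y \<in> carrier_mat n n"
    unfolding Y_def using J B X by (simp add: sq_carrier[of _ n])
  have KY: "K * Y = mat_adjoint B * X"
    unfolding Y_def by (rule left_cancel_mat[OF J(3)]) (use KD J B X in auto)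
  have Yadj: "mat_adjoint Y = mat_adjoint X * (B * J)"
    unfolding Y_def using J B X Jadj
    by (simp add: mat_adjoint_mult[of _ n n _ n] sq_assoc[of _ n])
  have "mtrace (B * J * mat_adjoint B * H) = mtrace ((B * J * mat_adjoint B * X) * mat_adjoint X)"
    unfolding X(2) using X(1) B J by (simp add: sq_assoc[of _ n] sq_carrier[of _ n])
  also have "\<dots> = mtrace (mat_adjoint X * (B * J * mat_adjoint B * X))"
    by (rule mtrace_comm[of _ n n]) (use X(1) B J in \<open>simp_all add: sq_carrier[of _ n]\<close>)
  also have "mat_adjoint X * (B * J * mat_adjoint B * X) = mat_adjoint Y * (K * Y)"
    unfolding Yadj KY using X(1) B J by (simp add: sq_assoc[of _ n] sq_carrier[of _ n])
  also have "mtrace \<dots> = (\<Sum>k<n. (mat_adjoint Y * (K * Y)) $$ (k, k))"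
    using Y by (simp add: mtrace_def)
  also have "\<dots> = (\<Sum>k<n. (K *\<^sub>v Matrix.col Y k) \<bullet>c Matrix.col Y k)"
  proof (rule sum.cong)
    fix k assume "k \<in> {..<n}"
    then have k: "k < n" by simp
    have "(mat_adjoint Y * (K * Y)) $$ (k, k) = (\<Sum>i<n. cnj (Y $$ (i, k)) * (K * Y) $$ (i, k))"
      by (subst mult_mat_index[of _ n n _ n]) (use Y KD k in auto)
    also have "\<dots> = (\<Sum>i<n. \<Sum>j<n. cnj (vec_index (Matrix.col Y k) i) * K $$ (i, j) * vec_index (Matrix.col Y k) j)"
      using Y k by (auto simp: mult_mat_index[OF KD(1) Y] sum_distrib_left mult_ac simp del: index_mult_mat intro!: sum.cong)
    also have "\<dots> = (K *\<^sub>v Matrix.col Y k) \<bullet>c Matrix.col Y k"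
      by (rule quadratic_form_index[symmetric]) (use KD Y k in auto)
    finally show "(mat_adjoint Y * (K * Y)) $$ (k, k) = (K *\<^sub>v Matrix.col Y k) \<bullet>c Matrix.col Y k" .
  qed simp
  finally have eq: "Re (mtrace (B * J * mat_adjoint B * H)) =
      (\<Sum>k<n. Re ((K *\<^sub>v Matrix.col Y k) \<bullet>c Matrix.col Y k))"
    by simp
  have summand: "Re ((K *\<^sub>v Matrix.col Y k) \<bullet>c Matrix.col Y k) \<ge> 0"
      "Re ((K *\<^sub>v Matrix.col Y k) \<bullet>c Matrix.col Y k) = 0 \<Longrightarrow> Matrix.col Y k = 0\<^sub>v n" if "k < n" for k
  proof -
    have c: "Matrix.col Y k \<in> carrier_vec n" using Y that by auto
    show "Re ((K *\<^sub>v Matrix.col Y k) \<bullet>c Matrix.col Y k) = 0 \<Longrightarrow> Matrix.col Y k = 0\<^sub>v n"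
      using KD(3)[OF c] by force
    show "Re ((K *\<^sub>v Matrix.col Y k) \<bullet>c Matrix.col Y k) \<ge> 0"
    proof (cases "Matrix.col Y k = 0\<^sub>v n")
      case True
      have "(K *\<^sub>v 0\<^sub>v n) \<bullet>c (0\<^sub>v n :: complex vec) = 0"
        by (subst quadratic_form_index[OF KD(1)]) auto
      then show ?thesis by (simp add: True)
    qed (use KD(3)[OF c] in force)
  qed
  show "Re (mtrace (B * J * mat_adjoint B * H)) \<ge> 0"
    unfolding eq by (intro sum_nonneg) (use summand in auto)
  assume "Re (mtrace (B * J * mat_adjoint B * H)) = 0"
  then have "\<forall>k<n. Matrix.col Y k = 0\<^sub>v n"
    unfolding eq using summand by (subst (asm) sum_nonneg_eq_0_iff) auto
  then have "Y = 0\<^sub>m n n"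
    using Y by (intro eq_matI) (auto, metis carrier_matD index_col index_zero_vec(1))
  then have "mat_adjoint B * X = 0\<^sub>m n n"
    using KY KD by simp
  \<comment> \<open>The factor \<open>X\<close> has not been shown to be invertible; it is completed
    to \<open>H\<close>, which \<open>G\<close> inverts.\<close>
  then have "mat_adjoint B * X * mat_adjoint X * G = 0\<^sub>m n n"
    using X G by simp
  moreover have "mat_adjoint B * X * mat_adjoint X * G = mat_adjoint B * (H * G)"
    unfolding X(2) using X(1) G B by (simp add: sq_assoc[of _ n] sq_carrier[of _ n])
  ultimately have "mat_adjoint B * (H * G) = 0\<^sub>m n n"
    by simp
  then have "mat_adjoint B = 0\<^sub>m n n"
    using G B by simp
  then have "mat_adjoint (mat_adjoint B) = 0\<^sub>m n n"
    by (simp add: mat_adjoint_zero)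
  then show "B = 0\<^sub>m n n"
    using B by simp
qed

section \<open>Wirtinger calculus\<close>

text \<open>The values \<open>e = - \<i>\<close> and \<open>e = \<i>\<close> give the two Wirtinger derivatives.\<close>

definition wirtinger :: "complex \<Rightarrow> (complex \<Rightarrow> complex) \<Rightarrow> complex \<Rightarrow> complex" where
  "wirtinger e f w = (frechet_derivative f (at w) 1 + e * frechet_derivative f (at w) \<i>) / 2"

lemma d_z_wirtinger: "d_z = wirtinger (- \<i>)"
  by (intro ext) (simp add: d_z_def wirtinger_def)

lemma d_zbar_wirtinger: "d_zbar = wirtinger \<i>"
  by (intro ext) (simp add: d_zbar_def wirtinger_def)

lemma wirtinger_eq:
  "(f has_derivative D) (at w) \<Longrightarrow> wirtinger e f w = (D 1 + e * D \<i>) / 2"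
  by (simp add: wirtinger_def frechet_derivative_at[symmetric])

lemma differentiable_has_derivative:
  "f differentiable (at w) \<Longrightarrow> (f has_derivative frechet_derivative f (at w)) (at w)"
  by (simp add: frechet_derivative_works)

lemma wirtinger_const: "wirtinger e (\<lambda>u. c) w = 0"
  by (subst wirtinger_eq[OF has_derivative_const]) simp

lemma wirtinger_mult:
  assumes "f differentiable (at w)" "g differentiable (at w)"
  shows "wirtinger e (\<lambda>u. f u * g u) w = wirtinger e f w * g w + f w * wirtinger e g w"
  by (subst wirtinger_eq[OF has_derivative_mult[OF assms[THEN differentiable_has_derivative]]])
     (simp add: wirtinger_def algebra_simps add_divide_distrib)

lemma wirtinger_diff:
  assumes "f differentiable (at w)" "g differentiable (at w)"
  shows "wirtinger e (\<lambda>u. f u - g u) w = wirtinger e f w - wirtinger e g w"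
  by (subst wirtinger_eq[OF has_derivative_diff[OF assms[THEN differentiable_has_derivative]]])
     (simp add: wirtinger_def algebra_simps diff_divide_distrib)

lemma wirtinger_sum:
  assumes "\<And>i. i \<in> I \<Longrightarrow> f i differentiable (at w)"
  shows "wirtinger e (\<lambda>u. \<Sum>i\<in>I. f i u) w = (\<Sum>i\<in>I. wirtinger e (f i) w)"
proof -
  have "((\<lambda>u. \<Sum>i\<in>I. f i u) has_derivative (\<lambda>h. \<Sum>i\<in>I. frechet_derivative (f i) (at w) h)) (at w)"
    by (intro has_derivative_sum differentiable_has_derivative assms)
  from wirtinger_eq[OF this] show ?thesis
    by (simp add: wirtinger_def sum_distrib_left sum.distrib flip: sum_divide_distrib)
qed

lemma has_derivative_cnj_compose:
  "(f has_derivative D) (at w) \<Longrightarrow> ((\<lambda>u. cnj (f u)) has_derivative (\<lambda>h. cnj (D h))) (at w)"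
  by (rule bounded_linear.has_derivative[OF bounded_linear_cnj])

lemma wirtinger_cnj:
  assumes "f differentiable (at w)"
  shows "wirtinger (cnj e) (\<lambda>u. cnj (f u)) w = cnj (wirtinger e f w)"
  by (subst wirtinger_eq[OF has_derivative_cnj_compose[OF differentiable_has_derivative[OF assms]]])
     (simp add: wirtinger_def)

text \<open>On an open set both functions have the same derivatives at \<open>w\<close>. As
  \<open>frechet_derivative\<close> is a choice among all derivatives, this also settles points
  where there is none.\<close>

lemma
  assumes "open S" "w \<in> S" "\<And>u. u \<in> S \<Longrightarrow> f u = g u"
  shows frechet_derivative_cong_open: "frechet_derivative f (at w) = frechet_derivative g (at w)"
    and differentiable_cong_open: "f differentiable (at w) \<longleftrightarrow> g differentiable (at w)"
proof -
  have "(f has_derivative D) (at w) \<longleftrightarrow> (g has_derivative D) (at w)" for D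
    using has_derivative_transform_within_open[of f D w UNIV S g]
      has_derivative_transform_within_open[of g D w UNIV S f] assms by auto
  then show "frechet_derivative f (at w) = frechet_derivative g (at w)"
    "f differentiable (at w) \<longleftrightarrow> g differentiable (at w)"
    by (simp_all add: frechet_derivative_def differentiable_def)
qed

lemma wirtinger_cong_open:
  assumes "open S" "w \<in> S" "\<And>u. u \<in> S \<Longrightarrow> f u = g u"
  shows "wirtinger e f w = wirtinger e g w"
  by (simp add: wirtinger_def frechet_derivative_cong_open[OF assms])

lemma C_k_cong_open:
  assumes "open S" "\<And>u. u \<in> S \<Longrightarrow> f u = g u"
  shows "C_k k f S \<longleftrightarrow> C_k k g S"
  using assms(2)
proof (induction k arbitrary: f g)
  case 0
  then show ?case by (simp cong: continuous_on_cong)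
next
  case (Suc k)
  have eq: "frechet_derivative f (at u) = frechet_derivative g (at u)"
    "f differentiable (at u) \<longleftrightarrow> g differentiable (at u)" if "u \<in> S" for u
    using frechet_derivative_cong_open[OF assms(1) that Suc.prems]
      differentiable_cong_open[OF assms(1) that Suc.prems] by auto
  show ?case
    using Suc.IH[of "\<lambda>w. frechet_derivative f (at w) 1" "\<lambda>w. frechet_derivative g (at w) 1"]
      Suc.IH[of "\<lambda>w. frechet_derivative f (at w) \<i>" "\<lambda>w. frechet_derivative g (at w) \<i>"]
    by (simp add: eq)
qed

section \<open>Matrix-valued functions\<close>

definition mat_wirtinger :: "complex \<Rightarrow> nat \<Rightarrow> (complex \<Rightarrow> complex mat) \<Rightarrow> complex \<Rightarrow> complex mat" where
  "mat_wirtinger e n M w = Matrix.mat n n (\<lambda>(a, b). wirtinger e (\<lambda>u. M u $$ (a, b)) w)"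

definition mat_differentiable :: "nat \<Rightarrow> (complex \<Rightarrow> complex mat) \<Rightarrow> complex \<Rightarrow> bool" where
  "mat_differentiable n M w \<longleftrightarrow> (\<forall>a<n. \<forall>b<n. (\<lambda>u. M u $$ (a, b)) differentiable (at w))"

lemma mat_wirtinger_carrier [simp]: "mat_wirtinger e n M w \<in> carrier_mat n n"
  by (simp add: mat_wirtinger_def)

lemma mat_wirtinger_dim [simp]:
  "dim_row (mat_wirtinger e n M w) = n" "dim_col (mat_wirtinger e n M w) = n"
  by (simp_all add: mat_wirtinger_def)

lemma mat_wirtinger_index [simp]:
  "a < n \<Longrightarrow> b < n \<Longrightarrow> mat_wirtinger e n M w $$ (a, b) = wirtinger e (\<lambda>u. M u $$ (a, b)) w"
  by (simp add: mat_wirtinger_def)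

lemma mat_differentiableD:
  "mat_differentiable n M w \<Longrightarrow> a < n \<Longrightarrow> b < n \<Longrightarrow> (\<lambda>u. M u $$ (a, b)) differentiable (at w)"
  by (simp add: mat_differentiable_def)

lemma mat_wirtinger_cong_open:
  assumes "open S" "w \<in> S" "\<And>u. u \<in> S \<Longrightarrow> A u = B u"
  shows "mat_wirtinger e n A w = mat_wirtinger e n B w"
    and "mat_differentiable n A w \<longleftrightarrow> mat_differentiable n B w"
proof -
  have "wirtinger e (\<lambda>u. A u $$ (a, b)) w = wirtinger e (\<lambda>u. B u $$ (a, b)) w" for a b
    by (rule wirtinger_cong_open[OF assms(1,2)]) (simp add: assms(3))
  then show "mat_wirtinger e n A w = mat_wirtinger e n B w"
    by (simp add: mat_wirtinger_def)
  have "(\<lambda>u. A u $$ (a, b)) differentiable (at w) \<longleftrightarrow> (\<lambda>u. B u $$ (a, b)) differentiable (at w)" for a b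
    by (rule differentiable_cong_open[OF assms(1,2)]) (simp add: assms(3))
  then show "mat_differentiable n A w \<longleftrightarrow> mat_differentiable n B w"
    by (simp add: mat_differentiable_def)
qed

lemma mat_wirtinger_const: "mat_wirtinger e n (\<lambda>u. M) w = 0\<^sub>m n n"
  by (rule eq_matI) (simp_all add: mat_wirtinger_def wirtinger_const)

context
  fixes S :: "complex set" and w :: complex and A B :: "complex \<Rightarrow> complex mat" and n :: nat
  assumes S: "open S" "w \<in> S"
    and carr: "\<And>u. u \<in> S \<Longrightarrow> A u \<in> carrier_mat n n" "\<And>u. u \<in> S \<Longrightarrow> B u \<in> carrier_mat n n"
    and diff: "mat_differentiable n A w" "mat_differentiable n B w"
begin

lemma mat_differentiable_mult: "mat_differentiable n (\<lambda>u. A u * B u) w"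
  unfolding mat_differentiable_def
proof (intro allI impI)
  fix a b assume ab: "a < n" "b < n"
  have "(\<lambda>u. \<Sum>k<n. A u $$ (a, k) * B u $$ (k, b)) differentiable (at w)"
    by (intro differentiable_sum differentiable_mult mat_differentiableD[OF diff(1)]
        mat_differentiableD[OF diff(2)] ballI) (use ab in auto)
  then show "(\<lambda>u. (A u * B u) $$ (a, b)) differentiable (at w)"
    by (subst differentiable_cong_open[OF S]) (use mult_mat_index[OF carr] ab in auto)
qed

lemma mat_wirtinger_mult:
  "mat_wirtinger e n (\<lambda>u. A u * B u) w = mat_wirtinger e n A w * B w + A w * mat_wirtinger e n B w"
proof (rule eq_matI)
  note c = carr[OF S(2)]
  fix a b
  assume "a < dim_row (mat_wirtinger e n A w * B w + A w * mat_wirtinger e n B w)"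
    and "b < dim_col (mat_wirtinger e n A w * B w + A w * mat_wirtinger e n B w)"
  then have ab: "a < n" "b < n" using c by (auto simp: mat_wirtinger_def)
  note d = mat_differentiableD[OF diff(1)] mat_differentiableD[OF diff(2)]
  have "mat_wirtinger e n (\<lambda>u. A u * B u) w $$ (a, b) =
      wirtinger e (\<lambda>u. \<Sum>k<n. A u $$ (a, k) * B u $$ (k, b)) w"
    unfolding mat_wirtinger_index[OF ab]
    by (rule wirtinger_cong_open[OF S]) (use mult_mat_index[OF carr] ab in auto)
  also have "\<dots> = (\<Sum>k<n. wirtinger e (\<lambda>u. A u $$ (a, k) * B u $$ (k, b)) w)"
    by (rule wirtinger_sum) (use ab d in \<open>auto intro!: differentiable_mult\<close>)
  also have "\<dots> = (\<Sum>k<n. mat_wirtinger e n A w $$ (a, k) * B w $$ (k, b)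
      + A w $$ (a, k) * mat_wirtinger e n B w $$ (k, b))"
    by (rule sum.cong) (use ab d in \<open>auto simp: wirtinger_mult\<close>)
  also have "\<dots> = (mat_wirtinger e n A w * B w) $$ (a, b) + (A w * mat_wirtinger e n B w) $$ (a, b)"
    by (subst (1 2) mult_mat_index[of _ n n _ n]) (use c ab in \<open>auto simp: sum.distrib\<close>)
  also have "\<dots> = (mat_wirtinger e n A w * B w + A w * mat_wirtinger e n B w) $$ (a, b)"
    by (rule index_add_mat(1)[symmetric]) (use c ab in auto)
  finally show "mat_wirtinger e n (\<lambda>u. A u * B u) w $$ (a, b) =
    (mat_wirtinger e n A w * B w + A w * mat_wirtinger e n B w) $$ (a, b)" .
qed (use carr[OF S(2)] in auto)

lemma mat_differentiable_diff: "mat_differentiable n (\<lambda>u. A u - B u) w"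
  unfolding mat_differentiable_def
proof (intro allI impI)
  fix a b assume ab: "a < n" "b < n"
  have "(\<lambda>u. A u $$ (a, b) - B u $$ (a, b)) differentiable (at w)"
    by (intro differentiable_diff mat_differentiableD[OF diff(1)] mat_differentiableD[OF diff(2)] ab)
  then show "(\<lambda>u. (A u - B u) $$ (a, b)) differentiable (at w)"
    by (subst differentiable_cong_open[OF S])
       (use carr(2)[THEN carrier_matD(1)] carr(2)[THEN carrier_matD(2)] ab in auto)
qed

lemma mat_wirtinger_diff:
  "mat_wirtinger e n (\<lambda>u. A u - B u) w = mat_wirtinger e n A w - mat_wirtinger e n B w"
proof (rule eq_matI)
  fix a b
  assume "a < dim_row (mat_wirtinger e n A w - mat_wirtinger e n B w)"
    and "b < dim_col (mat_wirtinger e n A w - mat_wirtinger e n B w)"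
  then have ab: "a < n" "b < n" by (auto simp: mat_wirtinger_def)
  have "mat_wirtinger e n (\<lambda>u. A u - B u) w $$ (a, b) =
      wirtinger e (\<lambda>u. A u $$ (a, b) - B u $$ (a, b)) w"
    unfolding mat_wirtinger_index[OF ab]
    by (rule wirtinger_cong_open[OF S])
       (use carr(2)[THEN carrier_matD(1)] carr(2)[THEN carrier_matD(2)] ab in auto)
  also have "\<dots> = wirtinger e (\<lambda>u. A u $$ (a, b)) w - wirtinger e (\<lambda>u. B u $$ (a, b)) w"
    by (intro wirtinger_diff mat_differentiableD[OF diff(1)] mat_differentiableD[OF diff(2)] ab)
  finally show "mat_wirtinger e n (\<lambda>u. A u - B u) w $$ (a, b) =
      (mat_wirtinger e n A w - mat_wirtinger e n B w) $$ (a, b)"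
    using ab by (simp add: mat_wirtinger_def)
qed (simp_all add: mat_wirtinger_def)

end

context
  fixes S :: "complex set" and w :: complex and A :: "complex \<Rightarrow> complex mat" and n :: nat
  assumes S: "open S" "w \<in> S"
    and carr: "\<And>u. u \<in> S \<Longrightarrow> A u \<in> carrier_mat n n"
    and diff: "mat_differentiable n A w"
begin

lemma differentiable_mtrace: "(\<lambda>u. mtrace (A u)) differentiable (at w)"
proof -
  have "(\<lambda>u. \<Sum>k<n. A u $$ (k, k)) differentiable (at w)"
    by (intro differentiable_sum mat_differentiableD[OF diff] ballI) auto
  then show ?thesis
    by (subst differentiable_cong_open[OF S]) (use carr in \<open>auto simp: mtrace_def\<close>)
qed

lemma wirtinger_mtrace: "wirtinger e (\<lambda>u. mtrace (A u)) w = mtrace (mat_wirtinger e n A w)"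
proof -
  have "wirtinger e (\<lambda>u. mtrace (A u)) w = wirtinger e (\<lambda>u. \<Sum>k<n. A u $$ (k, k)) w"
    by (rule wirtinger_cong_open[OF S]) (use carr in \<open>auto simp: mtrace_def\<close>)
  also have "\<dots> = (\<Sum>k<n. wirtinger e (\<lambda>u. A u $$ (k, k)) w)"
    by (rule wirtinger_sum) (use mat_differentiableD[OF diff] in auto)
  finally show ?thesis by (simp add: mtrace_def mat_wirtinger_def)
qed

lemma differentiable_det: "(\<lambda>u. Determinant.det (A u)) differentiable (at w)"
proof -
  have prod: "(\<lambda>u. \<Prod>i\<in>I. f i u) differentiable (at w)"
    if "finite I" "\<And>i. i \<in> I \<Longrightarrow> f i differentiable (at w)" for I :: "nat set" and f :: "nat \<Rightarrow> complex \<Rightarrow> complex"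
    using that by (induction I rule: finite_induct) (auto intro!: differentiable_mult)
  have "(\<lambda>u. \<Sum>p\<in>{p. p permutes {0..<n}}. signof p * (\<Prod>i=0..<n. A u $$ (i, p i))) differentiable (at w)"
  proof (intro differentiable_sum ballI differentiable_mult differentiable_const prod finite_permutations)
    fix p i assume "p \<in> {p. p permutes {0..<n}}" "i \<in> {0..<n}"
    then have "i < n" "p i < n" using permutes_in_image[of p "{0..<n}" i] by auto
    then show "(\<lambda>u. A u $$ (i, p i)) differentiable (at w)"
      by (rule mat_differentiableD[OF diff])
  qed auto
  then show ?thesis
    by (subst differentiable_cong_open[OF S]) (use carr in \<open>auto simp: Determinant.det_def\<close>)
qed

end

text \<open>For determinant one the inverse is the adjugate, whose entries are signed minors and
  thus polynomials in the entries of \<open>A u\<close>.\<close>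

lemma mat_differentiable_inv:
  assumes S: "open S" "w \<in> S"
    and carr: "\<And>u. u \<in> S \<Longrightarrow> A u \<in> carrier_mat n n"
    and det: "\<And>u. u \<in> S \<Longrightarrow> Determinant.det (A u) = 1"
    and diff: "mat_differentiable n A w"
  shows "mat_differentiable n (\<lambda>u. mat_inv (A u)) w"
  unfolding mat_differentiable_def
proof (intro allI impI)
  fix a b assume ab: "a < n" "b < n"
  have "(\<lambda>u. Determinant.det (mat_delete (A u) b a)) differentiable (at w)"
  proof (rule differentiable_det[OF S])
    show "mat_delete (A u) b a \<in> carrier_mat (n - 1) (n - 1)" if "u \<in> S" for u
      by (rule mat_delete_carrier[OF carr[OF that]])
    show "mat_differentiable (n - 1) (\<lambda>u. mat_delete (A u) b a) w"
      unfolding mat_differentiable_def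
    proof (intro allI impI)
      fix i j assume ij: "i < n - 1" "j < n - 1"
      have "(\<lambda>u. A u $$ (if i < b then i else Suc i, if j < a then j else Suc j)) differentiable (at w)"
        by (rule mat_differentiableD[OF diff]) (use ij in auto)
      then show "(\<lambda>u. mat_delete (A u) b a $$ (i, j)) differentiable (at w)"
        by (subst differentiable_cong_open[OF S])
           (use ij carr[THEN carrier_matD(1)] carr[THEN carrier_matD(2)] in \<open>auto simp: mat_delete_def\<close>)
    qed
  qed
  then have "(\<lambda>u. (-1) ^ (b + a) * Determinant.det (mat_delete (A u) b a)) differentiable (at w)"
    by (intro differentiable_mult differentiable_const)
  then show "(\<lambda>u. mat_inv (A u) $$ (a, b)) differentiable (at w)"
  proof (subst differentiable_cong_open[OF S])
    fix u assume "u \<in> S"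
    then show "mat_inv (A u) $$ (a, b) = (-1) ^ (b + a) * Determinant.det (mat_delete (A u) b a)"
      using carr[of u] det[of u] ab by (simp add: mat_inv_def adj_mat_def cofactor_def)
  qed
qed

lemma mat_eq_uminusI:
  fixes A B :: "'b :: group_add mat"
  assumes "A \<in> carrier_mat m n" "B \<in> carrier_mat m n" "A + B = 0\<^sub>m m n"
  shows "A = - B"
proof (rule eq_matI)
  fix i j assume ij: "i < dim_row (- B)" "j < dim_col (- B)"
  then have "(A + B) $$ (i, j) = 0" using assms by auto
  then show "A $$ (i, j) = (- B) $$ (i, j)"
    using ij assms(1,2) by (auto simp: eq_neg_iff_add_eq_0)
qed (use assms in auto)

text \<open>The identity \<open>mat_inv (A u) * A u = 1\<^sub>m n\<close> is differentiated and
  multiplied by the inverse from the right.\<close>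

lemma mat_wirtinger_inv:
  assumes S: "open S" "w \<in> S"
    and carr: "\<And>u. u \<in> S \<Longrightarrow> A u \<in> carrier_mat n n"
    and det: "\<And>u. u \<in> S \<Longrightarrow> Determinant.det (A u) = 1"
    and diff: "mat_differentiable n A w"
  shows "mat_wirtinger e n (\<lambda>u. mat_inv (A u)) w =
    - (mat_inv (A w) * mat_wirtinger e n A w * mat_inv (A w))"
proof -
  define G where "G = mat_inv (A w)"
  define D where "D = mat_wirtinger e n (\<lambda>u. mat_inv (A u)) w"
  define P where "P = mat_wirtinger e n A w"
  note inv = mat_inv_carrier[OF carr det] mat_inv_left[OF carr det] mat_inv_right[OF carr det]
  have G: "G \<in> carrier_mat n n" "A w * G = 1\<^sub>m n"
    using inv S by (auto simp: G_def)
  have DP: "D \<in> carrier_mat n n" "P \<in> carrier_mat n n"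
    by (simp_all add: D_def P_def)
  note Aw = carr[OF S(2)]
  have "0\<^sub>m n n = mat_wirtinger e n (\<lambda>u. mat_inv (A u) * A u) w"
    using mat_wirtinger_cong_open(1)[OF S, of "\<lambda>u. mat_inv (A u) * A u" "\<lambda>u. 1\<^sub>m n" e n] inv
    by (simp add: mat_wirtinger_const)
  also have "\<dots> = D * A w + G * P"
    unfolding D_def G_def P_def
    by (rule mat_wirtinger_mult[OF S]) (use inv carr diff mat_differentiable_inv[OF assms] in auto)
  finally have "D * A w + G * P = 0\<^sub>m n n" ..
  then have "(D * A w + G * P) * G = 0\<^sub>m n n"
    using G by simp
  moreover have "(D * A w + G * P) * G = D + G * P * G"
    using G DP Aw by (simp add: sq_distribs[of _ n] sq_carrier[of _ n] sq_assoc[of _ n])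
  ultimately have "D + G * P * G = 0\<^sub>m n n"
    by simp
  then have "D = - (G * P * G)"
    using DP G by (intro mat_eq_uminusI[of _ n n]) (auto intro!: mult_carrier_mat[of _ n n])
  then show ?thesis by (simp add: D_def G_def P_def)
qed

text \<open>Conjugation exchanges the two Wirtinger derivatives. For a metric this expresses the
  zbar-derivative by the z-derivative, which turns the first order part of the Laplacian into a
  norm.\<close>

lemma mat_wirtinger_adjoint:
  assumes S: "open S" "w \<in> S"
    and carr: "\<And>u. u \<in> S \<Longrightarrow> A u \<in> carrier_mat n n"
    and herm: "\<And>u. u \<in> S \<Longrightarrow> mat_adjoint (A u) = A u"
    and diff: "mat_differentiable n A w"
  shows "mat_wirtinger (cnj e) n A w = mat_adjoint (mat_wirtinger e n A w)"
proof (rule eq_matI)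
  fix a b assume "a < dim_row (mat_adjoint (mat_wirtinger e n A w))" "b < dim_col (mat_adjoint (mat_wirtinger e n A w))"
  then have ab: "a < n" "b < n" by (auto simp: mat_wirtinger_def)
  have "wirtinger (cnj e) (\<lambda>u. A u $$ (a, b)) w = wirtinger (cnj e) (\<lambda>u. cnj (A u $$ (b, a))) w"
  proof (rule wirtinger_cong_open[OF S])
    fix u assume "u \<in> S"
    then show "A u $$ (a, b) = cnj (A u $$ (b, a))"
      using mat_adjoint_index[of a "A u" b] carr[of u] herm[of u] ab by auto
  qed
  also have "\<dots> = cnj (wirtinger e (\<lambda>u. A u $$ (b, a)) w)"
    by (rule wirtinger_cnj) (use mat_differentiableD[OF diff] ab in auto)
  finally show "mat_wirtinger (cnj e) n A w $$ (a, b) = mat_adjoint (mat_wirtinger e n A w) $$ (a, b)"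
    using ab by (simp add: mat_wirtinger_def)
qed (simp_all add: mat_wirtinger_def)

section \<open>The strong maximum principle\<close>

text \<open>If \<open>m\<close> were positive, \<open>f'\<close> would be positive just to the right
  of its zero at \<open>0\<close>, and \<open>f\<close> would increase there. The second derivative
  is taken at the single point \<open>0\<close>, which matches the regularity demanded in
  \<open>z_derivative\<close>.\<close>

lemma local_max_second_derivative:
  fixes f f' :: "real \<Rightarrow> real"
  assumes d: "d > 0" and f: "\<And>t. \<bar>t\<bar> < d \<Longrightarrow> (f has_real_derivative f' t) (at t)"
    and f': "(f' has_real_derivative m) (at 0)"
    and le: "\<And>t. \<bar>t\<bar> < d \<Longrightarrow> f t \<le> f 0"
  shows "m \<le> 0"
proof (rule ccontr)
  assume "\<not> m \<le> 0"
  then obtain e where e: "e > 0" "\<And>h. 0 < h \<Longrightarrow> h < e \<Longrightarrow> f' 0 < f' (0 + h)"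
    using DERIV_pos_inc_right[OF f'] by force
  have "f' 0 = 0"
    by (rule DERIV_local_max[OF f d]) (use d le in auto)
  define s where "s = min d e / 2"
  have s: "0 < s" "s < d" "s < e" using d e(1) by (auto simp: s_def)
  have "f 0 < f s"
  proof (rule DERIV_pos_imp_increasing_open[OF s(1)])
    fix t assume "0 < t" "t < s"
    then show "\<exists>y. (f has_real_derivative y) (at t) \<and> y > 0"
      using f[of t] e(2)[of t] \<open>f' 0 = 0\<close> s by force
  next
    show "continuous_on {0..s} f"
      by (rule DERIV_continuous_on, rule has_field_derivative_at_within[OF f]) (use s in auto)
  qed
  then show False using le[of s] s by force
qed

text \<open>A real function \<open>u\<close> has differential \<open>2 Re (g dz)\<close> where \<open>g\<close> is its derivative with respect
  to \<open>z\<close>; the condition on \<open>g\<close> then says that the Laplacian of \<open>u\<close>, which is four times the real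
  part of the derivative of \<open>g\<close> with respect to the conjugate of \<open>z\<close>, is nonnegative.\<close>

definition z_derivative :: "(complex \<Rightarrow> real) \<Rightarrow> (complex \<Rightarrow> complex) \<Rightarrow> complex set \<Rightarrow> bool" where
  "z_derivative u g S \<longleftrightarrow>
     (\<forall>z\<in>S. (u has_derivative (\<lambda>h. 2 * Re (g z * h))) (at z) \<and> g differentiable (at z))"

definition subharmonic :: "(complex \<Rightarrow> real) \<Rightarrow> complex set \<Rightarrow> bool" where
  "subharmonic u S \<longleftrightarrow> (\<exists>g. z_derivative u g S \<and> (\<forall>z\<in>S. Re (wirtinger \<i> g z) \<ge> 0))"

text \<open>Along the line through \<open>z\<close> in the direction \<open>e\<close> the second
  derivative of \<open>u\<close> is \<open>2 * Re (D e * e)\<close>. The directions \<open>1\<close>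
  and \<open>\<i>\<close> add up to four times the real part in question.\<close>

lemma local_max_wirtinger:
  assumes S: "open S" "z \<in> S" and u: "z_derivative u g S"
    and max: "\<And>y. y \<in> S \<Longrightarrow> u y \<le> u z"
  shows "Re (wirtinger \<i> g z) \<le> 0"
proof -
  define D where "D = frechet_derivative g (at z)"
  have D: "(g has_derivative D) (at z)"
    unfolding D_def by (rule differentiable_has_derivative) (use u S in \<open>auto simp: z_derivative_def\<close>)
  obtain r where r: "r > 0" "ball z r \<subseteq> S"
    using S openE by blast
  have dir: "Re (D e * e) \<le> 0" if e: "cmod e = 1" for e
  proof -
    have line: "((\<lambda>t. z + of_real t * e) has_derivative (\<lambda>t. of_real t * e)) (at t)" for t :: real
      by (auto intro!: derivative_eq_intros)
    have inS: "z + of_real t * e \<in> S" if "\<bar>t\<bar> < r" for t :: real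
      using r that e by (intro subsetD[OF r(2)]) (simp add: dist_norm norm_mult)
    have "2 * Re (D e * e) \<le> 0"
    proof (rule local_max_second_derivative[OF r(1)])
      fix t :: real assume t: "\<bar>t\<bar> < r"
      have "(u has_derivative (\<lambda>h. 2 * Re (g (z + of_real t * e) * h))) (at (z + of_real t * e))"
        using u inS[OF t] by (auto simp: z_derivative_def)
      from has_derivative_compose[OF line this]
      show "((\<lambda>t. u (z + of_real t * e)) has_real_derivative 2 * Re (g (z + of_real t * e) * e)) (at t)"
        unfolding has_field_derivative_def by (rule has_derivative_eq_rhs) (auto simp: algebra_simps)
      show "u (z + of_real t * e) \<le> u (z + of_real 0 * e)"
        using max[OF inS[OF t]] by simp
    next
      have D0: "(g has_derivative D) (at (z + of_real 0 * e))"
        using D by simp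
      have "linear D" using D by (rule has_derivative_linear)
      then have "D (of_real t * e) = of_real t * D e" for t
        using linear_scale[of D t e] by (simp add: scaleR_conv_of_real)
      then show "((\<lambda>t. 2 * Re (g (z + of_real t * e) * e)) has_real_derivative 2 * Re (D e * e)) (at 0)"
        unfolding has_field_derivative_def
        by (intro has_derivative_eq_rhs[OF has_derivative_mult_right[OF bounded_linear.has_derivative[OF bounded_linear_Re
            has_derivative_mult_left[OF has_derivative_compose[OF line D0]]]]])
           (auto simp: algebra_simps)
    qed
    then show ?thesis by simp
  qed
  have "Re (wirtinger \<i> g z) = Re ((D 1 + \<i> * D \<i>) / 2)"
    by (rule arg_cong[OF wirtinger_eq[OF D]])
  then show ?thesis
    using dir[of 1] dir[of \<i>] by simp
qed

text \<open>The barrier is the product of \<open>1 / (z - w)\<close> and its conjugate. The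
  z-derivative acts on the first factor and gives \<open>g\<close>; the zbar-derivative then acts on
  the second and leaves a positive number.\<close>

lemma wirtinger_barrier:
  fixes w :: complex
  defines "g \<equiv> \<lambda>z. - (1 / ((z - w)\<^sup>2 * cnj (z - w)))"
  assumes "w \<notin> S"
  shows "z_derivative (\<lambda>z. 1 / (cmod (z - w))\<^sup>2) g S"
    and "z \<in> S \<Longrightarrow> wirtinger \<i> g z = of_real (1 / cmod (z - w) ^ 4)"
proof -
  \<comment> \<open>The first summand is complex linear in \<open>h\<close> and disappears under the
    zbar-derivative; the second is conjugate linear and is all that remains.\<close>
  have g: "(g has_derivative (\<lambda>h. 2 * h / ((z - w) ^ 3 * cnj (z - w)) + cnj h / ((z - w)\<^sup>2 * (cnj (z - w))\<^sup>2))) (at z)"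
    if "z \<noteq> w" for z
  proof -
    have nz: "z - w \<noteq> 0" using that by simp
    have "((\<lambda>z. 1 / (z - w)\<^sup>2) has_field_derivative - 2 / (z - w) ^ 3) (at z)"
      using nz by (auto intro!: derivative_eq_intros simp: divide_simps eval_nat_numeral)
    then have 1: "((\<lambda>z. 1 / (z - w)\<^sup>2) has_derivative (\<lambda>h. - 2 / (z - w) ^ 3 * h)) (at z)"
      unfolding has_field_derivative_def .
    have "((\<lambda>z. 1 / (z - w)) has_field_derivative - 1 / (z - w)\<^sup>2) (at z)"
      using nz by (auto intro!: derivative_eq_intros simp: divide_simps eval_nat_numeral)
    then have "((\<lambda>z. 1 / (z - w)) has_derivative (\<lambda>h. - 1 / (z - w)\<^sup>2 * h)) (at z)"
      unfolding has_field_derivative_def .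
    then have 2: "((\<lambda>z. cnj (1 / (z - w))) has_derivative (\<lambda>h. cnj (- 1 / (z - w)\<^sup>2 * h))) (at z)"
      by (rule has_derivative_cnj_compose)
    have "g = (\<lambda>z. - (1 / (z - w)\<^sup>2 * cnj (1 / (z - w))))"
      by (simp add: g_def)
    then show ?thesis
      by (elim ssubst, intro has_derivative_eq_rhs[OF has_derivative_minus[OF has_derivative_mult[OF 1 2]]])
         (simp add: fun_eq_iff)
  qed
  have n4: "(z - w)\<^sup>2 * (cnj (z - w))\<^sup>2 = of_real (cmod (z - w) ^ 4)" for z
  proof -
    have "(z - w)\<^sup>2 * (cnj (z - w))\<^sup>2 = ((z - w) * cnj (z - w))\<^sup>2"
      by (simp only: power_mult_distrib)
    also have "\<dots> = (complex_of_real ((cmod (z - w))\<^sup>2))\<^sup>2"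
      by (simp only: complex_norm_square)
    also have "\<dots> = of_real (cmod (z - w) ^ 4)"
      by (simp flip: of_real_power power_mult)
    finally show ?thesis .
  qed
  show "z_derivative (\<lambda>z. 1 / (cmod (z - w))\<^sup>2) g S"
    unfolding z_derivative_def
  proof (intro ballI conjI)
    fix z assume "z \<in> S"
    then have z: "z \<noteq> w" using assms by auto
    then show "g differentiable (at z)" using g by (auto simp: differentiable_def)
    have sq: "((\<lambda>z. (cmod (z - w))\<^sup>2) has_derivative (\<lambda>h. 2 * Re (cnj (z - w) * h))) (at z)"
      unfolding cmod_power2
      by (rule derivative_eq_intros refl | simp add: algebra_simps)+
    have gz: "g z = - cnj (z - w) / of_real (cmod (z - w) ^ 4)"
    proof -
      have "- (1 / (x\<^sup>2 * y)) = - y / (x\<^sup>2 * y\<^sup>2)" if "x \<noteq> 0" "y \<noteq> 0" for x y :: complex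
        using that by (simp add: field_simps power2_eq_square)
      from this[of "z - w" "cnj (z - w)"] z show ?thesis
        unfolding n4[symmetric] g_def by simp
    qed
    have eq: "- (inverse ((cmod (z - w))\<^sup>2) * (2 * Re (cnj (z - w) * h)) * inverse ((cmod (z - w))\<^sup>2)) =
        2 * Re (g z * h)" for h
    proof -
      have "g z * h = - (cnj (z - w) * h) / of_real (cmod (z - w) ^ 4)"
        unfolding gz by (simp only: mult_minus_left minus_divide_left times_divide_eq_left)
      then have "Re (g z * h) = - Re (cnj (z - w) * h) / cmod (z - w) ^ 4"
        by (simp only: Re_divide_of_real uminus_complex.simps)
      moreover have "- (inverse (r\<^sup>2) * (2 * a) * inverse (r\<^sup>2)) = 2 * (- a / r ^ 4)" for r a :: real
        by (simp add: divide_inverse eval_nat_numeral)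
      ultimately show ?thesis
        by (simp only:)
    qed
    have "((\<lambda>z. inverse ((cmod (z - w))\<^sup>2)) has_derivative
        (\<lambda>h. - (inverse ((cmod (z - w))\<^sup>2) * (2 * Re (cnj (z - w) * h)) * inverse ((cmod (z - w))\<^sup>2)))) (at z)"
      by (rule Deriv.has_derivative_inverse[OF _ sq]) (use z in simp)
    then show "((\<lambda>z. 1 / (cmod (z - w))\<^sup>2) has_derivative (\<lambda>h. 2 * Re (g z * h))) (at z)"
      unfolding eq unfolding inverse_eq_divide .
  qed
  assume "z \<in> S"
  then have z: "z \<noteq> w" using assms by auto
  show "wirtinger \<i> g z = of_real (1 / cmod (z - w) ^ 4)"
    unfolding wirtinger_eq[OF g[OF z]] n4 by (simp add: field_simps)
qed

text \<open>Hopf's argument: a disc in the set where \<open>u\<close> is below its maximum, touching the complement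
  at a point \<open>y\<close>, carries the strictly subharmonic barrier \<open>|z - w|\<^sup>-\<^sup>2\<close>, and adding a small multiple
  of it to \<open>u\<close> yields an interior maximum near \<open>y\<close>.\<close>

lemma strong_maximum_disc:
  assumes R: "R > 0" and u: "subharmonic u (ball z0 R)"
    and max: "\<And>y. y \<in> ball z0 R \<Longrightarrow> u y \<le> u z0"
    and y: "x \<in> ball z0 (R / 2)"
  shows "u x = u z0"
proof (rule ccontr)
  assume neq: "u x \<noteq> u z0"
  define M where "M = u z0"
  obtain g where g: "z_derivative u g (ball z0 R)" "\<And>z. z \<in> ball z0 R \<Longrightarrow> Re (wirtinger \<i> g z) \<ge> 0"
    using u unfolding subharmonic_def by blast
  have cont: "continuous_on (ball z0 R) u"
    using g(1) by (auto simp: z_derivative_def intro!: continuous_at_imp_continuous_on has_derivative_continuous)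
  \<comment> \<open>The level set is cut down to a disc that still contains \<open>z0\<close>, so it
    has a point \<open>y\<close> nearest to \<open>x\<close>. As \<open>x\<close> is at distance
    less than \<open>R / 2\<close> from \<open>z0\<close>, the disc stays in
    \<open>ball z0 R\<close>.\<close>
  define F where "F = {z \<in> cball x (dist x z0). u z = M}"
  have sub: "cball x (dist x z0) \<subseteq> ball z0 R"
  proof
    fix z assume "z \<in> cball x (dist x z0)"
    then have "dist z0 z \<le> dist x z0 + dist x z0"
      using dist_triangle[of z0 z x] by (simp add: dist_commute)
    then show "z \<in> ball z0 R" using y by (simp add: dist_commute)
  qed
  have "closed F"
    unfolding F_def by (rule continuous_closed_preimage_constant[OF continuous_on_subset[OF cont sub]]) simp
  moreover have "z0 \<in> F" by (simp add: F_def M_def)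
  ultimately obtain y where y: "y \<in> F" "\<And>z. z \<in> F \<Longrightarrow> dist x y \<le> dist x z"
    using distance_attains_inf[of F x] by blast
  define r where "r = dist x y / 2"
  have uy: "u y = M" and yx: "dist x y \<le> dist x z0"
    using y(1) by (auto simp: F_def)
  have r: "r > 0" using neq uy by (auto simp: r_def M_def)
  have yR: "y \<in> ball z0 R" using y(1) sub by (auto simp: F_def)
  have less: "u z < M" if "dist x z < 2 * r" for z
  proof -
    have "z \<notin> F" using y(2)[of z] that by (auto simp: r_def)
    moreover have "z \<in> cball x (dist x z0)" using that yx by (simp add: r_def)
    ultimately show ?thesis using max[of z] sub by (force simp: F_def M_def)
  qed
  \<comment> \<open>The disc of radius \<open>2 * r\<close> about \<open>x\<close> lies below the
    maximum but may have further maximum points on its boundary. The disc of radius \<open>r\<close>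
    about the midpoint \<open>w\<close> is tangent to it from inside, so that \<open>y\<close> is
    its only maximum point.\<close>
  define w where "w = (x + y) / 2"
  have wxy: "w - y = (x - y) / 2" "w - x = - ((x - y) / 2)"
    by (simp_all add: w_def field_simps)
  have wy: "dist w y = r" and wx: "dist w x = r"
    unfolding dist_norm r_def wxy by (simp_all add: norm_divide)
  have touch: "u z < M" if "dist w z \<le> r" "z \<noteq> y" for z
  proof (rule less, rule ccontr)
    assume "\<not> dist x z < 2 * r"
    then have ge: "2 * r \<le> cmod ((z - w) + (w - x))" by (simp add: dist_norm norm_minus_commute)
    \<comment> \<open>The parallelogram law gives the equality case of the triangle inequality: if
      \<open>z\<close> is at distance \<open>2 * r\<close> or more from \<open>x\<close>, then
      \<open>z - w = w - x\<close>, which means \<open>z = y\<close>.\<close>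
    have "(cmod ((z - w) + (w - x)))\<^sup>2 + (cmod ((z - w) - (w - x)))\<^sup>2 = 2 * (cmod (z - w))\<^sup>2 + 2 * (cmod (w - x))\<^sup>2"
      by (simp only: cmod_power2) (simp add: power2_eq_square algebra_simps)
    moreover have "(2 * r)\<^sup>2 \<le> (cmod ((z - w) + (w - x)))\<^sup>2"
      by (rule power_mono[OF ge]) (use r in simp)
    moreover have "(cmod (z - w))\<^sup>2 \<le> r\<^sup>2" "(cmod (w - x))\<^sup>2 = r\<^sup>2"
      using that(1) wx by (auto intro!: power_mono simp: dist_norm norm_minus_commute)
    moreover have "(2 * r)\<^sup>2 = 4 * r\<^sup>2"
      by (simp add: power_mult_distrib)
    ultimately have "(cmod ((z - w) - (w - x)))\<^sup>2 \<le> 0" by linarith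
    then have "z = 2 * w - x" by (simp add: eq_diff_eq)
    moreover have "2 * w = x + y" by (simp add: w_def)
    ultimately show False using that(2) by simp
  qed
  \<comment> \<open>Small enough for the disc about \<open>y\<close> to stay in the domain of
    \<open>u\<close> and at distance at least \<open>r / 2\<close> from the pole \<open>w\<close> of
    the barrier.\<close>
  define \<rho> where "\<rho> = min r (R - dist z0 y) / 2"
  have \<rho>: "\<rho> > 0" "\<rho> \<le> r / 2" "cball y \<rho> \<subseteq> ball z0 R"
  proof -
    show "\<rho> > 0" "\<rho> \<le> r / 2" using r yR by (auto simp: \<rho>_def)
    have "\<rho> < R - dist z0 y" using yR r by (auto simp: \<rho>_def min_def)
    show "cball y \<rho> \<subseteq> ball z0 R"
    proof
      fix z assume "z \<in> cball y \<rho>"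
      then show "z \<in> ball z0 R"
        using \<open>\<rho> < R - dist z0 y\<close> dist_triangle[of z0 z y] by simp
    qed
  qed
  have far: "dist w z \<ge> r / 2" if "z \<in> cball y \<rho>" for z
    using dist_triangle[of w y z] that wy \<rho> by (simp add: dist_commute)
  obtain \<delta> where \<delta>: "\<delta> > 0" "\<And>z. z \<in> sphere y \<rho> \<inter> cball w r \<Longrightarrow> u z \<le> M - \<delta>"
  proof (cases "sphere y \<rho> \<inter> cball w r = {}")
    case True
    then show ?thesis using that[of 1] by auto
  next
    case False
    have "continuous_on (sphere y \<rho> \<inter> cball w r) u"
      by (rule continuous_on_subset[OF cont]) (use \<rho> in auto)
    then obtain m where m: "m \<in> sphere y \<rho> \<inter> cball w r" "\<And>z. z \<in> sphere y \<rho> \<inter> cball w r \<Longrightarrow> u z \<le> u m"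
      using continuous_attains_sup[OF compact_Int[OF compact_sphere compact_cball] False] by blast
    have "u m < M" by (rule touch) (use m \<rho> in auto)
    then show ?thesis using m that[of "M - u m"] by auto
  qed
  \<comment> \<open>On the disc about \<open>y\<close> the barrier is at most
    \<open>4 / r\<^sup>2\<close>, so with this constant it adds at most \<open>\<delta> / 2\<close>,
    less than the drop \<open>\<delta>\<close> of \<open>u\<close>.\<close>
  define \<epsilon> where "\<epsilon> = \<delta> * r\<^sup>2 / 8"
  have \<epsilon>: "\<epsilon> > 0" using \<delta> r by (simp add: \<epsilon>_def)
  define v where "v = (\<lambda>z. 1 / (cmod (z - w))\<^sup>2)"
  define gv where "gv = (\<lambda>z. - (1 / ((z - w)\<^sup>2 * cnj (z - w))))"
  have wnot: "w \<notin> cball y \<rho>" using far[of w] r by auto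
  note barrier = wirtinger_barrier[OF wnot, folded v_def gv_def]
  define f where "f = (\<lambda>z. u z + \<epsilon> * v z)"
  have vy: "v y = 1 / r\<^sup>2" using wy by (simp add: v_def dist_norm norm_minus_commute)
  \<comment> \<open>On the part of the circle inside \<open>cball w r\<close> the function
    \<open>u\<close> has dropped by \<open>\<delta>\<close>; on the part outside, \<open>u\<close>
    is at most its maximum and the barrier is below its value at \<open>y\<close>.\<close>
  have sphere: "f z < f y" if z: "z \<in> sphere y \<rho>" for z
  proof (cases "z \<in> cball w r")
    case True
    have "(r / 2)\<^sup>2 \<le> (cmod (z - w))\<^sup>2"
      using far[of z] z r by (intro power_mono) (auto simp: dist_norm norm_minus_commute)
    then have "v z \<le> 1 / (r / 2)\<^sup>2"
      unfolding v_def using r by (intro divide_left_mono) (auto intro!: mult_pos_pos simp: zero_less_power2)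
    then have "\<epsilon> * v z \<le> \<epsilon> * (1 / (r / 2)\<^sup>2)" using \<epsilon> by (intro mult_left_mono) auto
    also have "\<dots> = \<delta> / 2" using r by (simp add: \<epsilon>_def field_simps power2_eq_square)
    finally have "f z \<le> M - \<delta> / 2" using \<delta>(2)[of z] z True by (simp add: f_def)
    also have "\<dots> < M" using \<delta>(1) by simp
    also have "\<dots> < f y" using uy vy \<epsilon> r by (simp add: f_def)
    finally show ?thesis .
  next
    case False
    then have "r < cmod (z - w)" by (simp add: dist_norm norm_minus_commute)
    then have "r\<^sup>2 < (cmod (z - w))\<^sup>2" using r by (intro power_strict_mono) auto
    then have "v z < 1 / r\<^sup>2"
      unfolding v_def using r by (intro divide_strict_left_mono) (auto intro!: mult_pos_pos simp: zero_less_power2)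
    then have "v z < v y" by (simp add: vy)
    moreover have "u z \<le> u y" using max[of z] \<rho>(3) z uy by (auto simp: M_def)
    ultimately show ?thesis using \<epsilon> by (simp add: f_def add_le_less_mono)
  qed
  have gder: "z_derivative f (\<lambda>z. g z + of_real \<epsilon> * gv z) (cball y \<rho>)"
    unfolding z_derivative_def
  proof (intro ballI conjI)
    fix z assume z: "z \<in> cball y \<rho>"
    have u': "(u has_derivative (\<lambda>h. 2 * Re (g z * h))) (at z)" "g differentiable (at z)"
      using g(1) z \<rho> by (auto simp: z_derivative_def)
    have v': "(v has_derivative (\<lambda>h. 2 * Re (gv z * h))) (at z)" "gv differentiable (at z)"
      using barrier(1) z by (auto simp: z_derivative_def)
    show "(\<lambda>z. g z + of_real \<epsilon> * gv z) differentiable (at z)"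
      using u' v' by (intro differentiable_add differentiable_mult differentiable_const)
    show "(f has_derivative (\<lambda>h. 2 * Re ((g z + of_real \<epsilon> * gv z) * h))) (at z)"
      unfolding f_def
      by (rule has_derivative_eq_rhs[OF has_derivative_add[OF u'(1) has_derivative_mult_right[OF v'(1)]]])
         (auto simp: fun_eq_iff algebra_simps)
  qed
  then have "continuous_on (cball y \<rho>) f"
    by (auto simp: z_derivative_def intro!: continuous_at_imp_continuous_on has_derivative_continuous)
  then obtain m where m: "m \<in> cball y \<rho>" "\<And>z. z \<in> cball y \<rho> \<Longrightarrow> f z \<le> f m"
    using continuous_attains_sup[of "cball y \<rho>" f] \<rho> by auto
  have "m \<notin> sphere y \<rho>" using sphere[of m] m(2)[of y] \<rho> by force
  then have mb: "m \<in> ball y \<rho>" using m(1) by auto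
  have "Re (wirtinger \<i> (\<lambda>z. g z + of_real \<epsilon> * gv z) m) \<le> 0"
  proof (rule local_max_wirtinger[OF _ mb])
    show "z_derivative f (\<lambda>z. g z + of_real \<epsilon> * gv z) (ball y \<rho>)"
      using gder by (auto simp: z_derivative_def)
  qed (use m in auto)
  moreover have "wirtinger \<i> (\<lambda>z. g z + of_real \<epsilon> * gv z) m = wirtinger \<i> g m + of_real \<epsilon> * wirtinger \<i> gv m"
  proof -
    have "g differentiable (at m)" "gv differentiable (at m)"
      using g(1) barrier(1) m(1) \<rho> by (auto simp: z_derivative_def)
    then show ?thesis
      by (subst wirtinger_eq[OF has_derivative_add[OF differentiable_has_derivative
            has_derivative_mult_right[OF differentiable_has_derivative]]])
         (auto simp: wirtinger_def algebra_simps add_divide_distrib)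
  qed
  moreover have "Re (of_real \<epsilon> * wirtinger \<i> gv m) > 0"
    using \<epsilon> wnot m(1) by (subst barrier(2)[OF m(1)]) (auto intro!: mult_pos_pos divide_pos_pos zero_less_power)
  moreover have "Re (wirtinger \<i> g m) \<ge> 0"
    using g(2)[of m] m(1) \<rho> by auto
  ultimately show False by simp
qed

section \<open>Functions and sections on a closed Riemann surface\<close>

lemma closed_riemann_surfaceD:
  fixes A :: "('a::t2_space) chart set"
  assumes "closed_riemann_surface A"
  shows "compact (UNIV :: 'a set)" "connected (UNIV :: 'a set)"
    and "\<And>p. \<exists>c\<in>A. p \<in> fst c"
    and "\<And>c. c \<in> A \<Longrightarrow> open (fst c)" "\<And>c. c \<in> A \<Longrightarrow> open (snd c ` fst c)"
    and "\<And>c. c \<in> A \<Longrightarrow> continuous_on (fst c) (snd c)"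
    and "\<And>c p. c \<in> A \<Longrightarrow> p \<in> fst c \<Longrightarrow> chart_inv c (snd c p) = p"
    and "\<And>c z. c \<in> A \<Longrightarrow> z \<in> snd c ` fst c \<Longrightarrow> chart_inv c z \<in> fst c"
proof -
  note A = assms[unfolded closed_riemann_surface_def]
  show "compact (UNIV :: 'a set)" "connected (UNIV :: 'a set)"
    "\<And>c. c \<in> A \<Longrightarrow> open (fst c)" "\<And>c. c \<in> A \<Longrightarrow> open (snd c ` fst c)"
    using A by auto
  show "\<exists>c\<in>A. p \<in> fst c" for p
  proof -
    have "p \<in> (\<Union>c\<in>A. fst c)" using A by (metis UNIV_I)
    then show ?thesis by blast
  qed
  have h: "homeomorphism (fst c) (snd c ` fst c) (snd c) (chart_inv c)" if "c \<in> A" for c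
    using A that by blast
  then show "\<And>c. c \<in> A \<Longrightarrow> continuous_on (fst c) (snd c)"
    "\<And>c p. c \<in> A \<Longrightarrow> p \<in> fst c \<Longrightarrow> chart_inv c (snd c p) = p"
    by (auto dest: h simp: homeomorphism_def)
  show "\<And>c z. c \<in> A \<Longrightarrow> z \<in> snd c ` fst c \<Longrightarrow> chart_inv c z \<in> fst c"
    using h by (fastforce simp: homeomorphism_def)
qed

lemma chart_continuous:
  fixes A :: "('a::t2_space) chart set" and f :: "'a \<Rightarrow> 'b::topological_space"
  assumes A: "closed_riemann_surface A"
    and f: "\<And>c. c \<in> A \<Longrightarrow> continuous_on (snd c ` fst c) (f \<circ> chart_inv c)"
  shows "continuous_on UNIV f"
proof (rule continuous_at_imp_continuous_on, rule ballI)
  fix p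
  note S = closed_riemann_surfaceD[OF A]
  obtain c where c: "c \<in> A" "p \<in> fst c" using S(3) by blast
  have "continuous_on (fst c) ((f \<circ> chart_inv c) \<circ> snd c)"
    by (rule continuous_on_compose[OF S(6)[OF c(1)] f[OF c(1)]])
  then have "continuous_on (fst c) f"
    by (rule continuous_on_eq) (use S(7)[OF c(1)] in auto)
  then show "isCont f p"
    using S(4)[OF c(1)] c(2) by (simp add: continuous_on_eq_continuous_at)
qed

text \<open>The level set of \<open>k\<close> is closed by continuity and open by
  \<open>loc\<close>, so it fills the connected surface. Both maximum principles below reach their
  global form through this.\<close>

lemma chart_locally_constant:
  fixes A :: "('a::t2_space) chart set" and f :: "'a \<Rightarrow> 'b::t2_space"
  assumes A: "closed_riemann_surface A" and f: "continuous_on UNIV f" and k: "f p0 = k"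
    and loc: "\<And>c p. c \<in> A \<Longrightarrow> p \<in> fst c \<Longrightarrow> f p = k \<Longrightarrow>
      \<exists>r>0. \<forall>z \<in> ball (snd c p) r \<inter> snd c ` fst c. f (chart_inv c z) = k"
  shows "f p = k"
proof -
  note S = closed_riemann_surfaceD[OF A]
  define E where "E = {p. f p = k}"
  have "closed E"
    unfolding E_def using continuous_closed_preimage_constant[OF f closed_UNIV] by simp
  moreover have "open E"
  proof (subst open_subopen, intro ballI)
    fix p assume "p \<in> E"
    then have p: "f p = k" by (simp add: E_def)
    obtain c where c: "c \<in> A" "p \<in> fst c" using S(3) by blast
    obtain r where r: "r > 0" "\<And>z. z \<in> ball (snd c p) r \<inter> snd c ` fst c \<Longrightarrow> f (chart_inv c z) = k"
      using loc[OF c p] by blast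
    have "open (fst c \<inter> snd c -` ball (snd c p) r)"
      by (rule continuous_open_preimage[OF S(6)[OF c(1)] S(4)[OF c(1)] open_ball])
    moreover have "fst c \<inter> snd c -` ball (snd c p) r \<subseteq> E"
    proof
      fix x assume x: "x \<in> fst c \<inter> snd c -` ball (snd c p) r"
      then show "x \<in> E" using r(2)[of "snd c x"] S(7)[OF c(1), of x] by (auto simp: E_def)
    qed
    ultimately show "\<exists>T. open T \<and> p \<in> T \<and> T \<subseteq> E" using c(2) r(1) by (intro exI conjI) auto
  qed
  ultimately have "E \<inter> UNIV = {} \<or> - E \<inter> UNIV = {}"
    by (intro connectedD[OF S(2)]) auto
  moreover have "p0 \<in> E" using k by (simp add: E_def)
  ultimately show ?thesis by (auto simp: E_def)
qed

lemma subharmonic_continuous: "subharmonic u S \<Longrightarrow> continuous_on S u"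
  unfolding subharmonic_def z_derivative_def
  by (intro continuous_at_imp_continuous_on) (blast intro: has_derivative_continuous)

lemma subharmonic_subset: "subharmonic u S \<Longrightarrow> T \<subseteq> S \<Longrightarrow> subharmonic u T"
  unfolding subharmonic_def z_derivative_def by blast

text \<open>Compactness supplies a maximum point, and the strong maximum principle makes the set of
  maximum points open.\<close>

lemma subharmonic_constant:
  fixes A :: "('a::t2_space) chart set" and u :: "'a \<Rightarrow> real"
  assumes A: "closed_riemann_surface A"
    and u: "\<And>c. c \<in> A \<Longrightarrow> subharmonic (u \<circ> chart_inv c) (snd c ` fst c)"
  shows "\<exists>M. \<forall>p. u p = M"
proof -
  note S = closed_riemann_surfaceD[OF A]
  have cont: "continuous_on UNIV u"
    by (rule chart_continuous[OF A]) (rule subharmonic_continuous[OF u])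
  obtain p0 where p0: "\<And>p. u p \<le> u p0"
    using continuous_attains_sup[OF S(1) UNIV_not_empty cont] by auto
  have "u p = u p0" for p
  proof (rule chart_locally_constant[OF A cont refl])
    fix c p assume c: "c \<in> A" "p \<in> fst c" and p: "u p = u p0"
    obtain R where R: "R > 0" "ball (snd c p) R \<subseteq> snd c ` fst c"
      using S(5)[OF c(1)] c(2) by (meson imageI openE)
    \<comment> \<open>Half the radius of the coordinate disc, since
      \<open>strong_maximum_disc\<close> reaches only that far.\<close>
    have "(u \<circ> chart_inv c) z = (u \<circ> chart_inv c) (snd c p)" if "z \<in> ball (snd c p) (R / 2)" for z
      by (rule strong_maximum_disc[OF R(1) subharmonic_subset[OF u[OF c(1)] R(2)] _ that])
         (use p0 p S(7)[OF c] in simp)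
    then show "\<exists>r>0. \<forall>z\<in>ball (snd c p) r \<inter> snd c ` fst c. u (chart_inv c z) = u p0"
      using R(1) p S(7)[OF c] by (intro exI[of _ "R / 2"]) auto
  qed
  then show ?thesis by blast
qed

lemma holomorphic_constant:
  fixes A :: "('a::t2_space) chart set" and f :: "'a \<Rightarrow> complex"
  assumes A: "closed_riemann_surface A"
    and f: "\<And>c. c \<in> A \<Longrightarrow> holomorphic_in_chart c f (fst c)"
  shows "\<exists>k. \<forall>p. f p = k"
proof -
  note S = closed_riemann_surfaceD[OF A]
  have cont: "continuous_on UNIV f"
    by (rule chart_continuous[OF A], rule holomorphic_on_imp_continuous_on)
       (use f in \<open>auto simp: holomorphic_in_chart_def\<close>)
  obtain p0 where p0: "\<And>p. cmod (f p) \<le> cmod (f p0)"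
    using continuous_attains_sup[OF S(1) UNIV_not_empty continuous_on_norm[OF cont]] by auto
  have "f p = f p0" for p
  proof (rule chart_locally_constant[OF A cont refl])
    fix c p assume c: "c \<in> A" "p \<in> fst c" and p: "f p = f p0"
    obtain R where R: "R > 0" "ball (snd c p) R \<subseteq> snd c ` fst c"
      using S(5)[OF c(1)] c(2) by (meson imageI openE)
    have "(f \<circ> chart_inv c) constant_on ball (snd c p) R"
    proof (rule maximum_modulus_principle[where U = \<open>ball (snd c p) R\<close> and \<xi> = \<open>snd c p\<close>])
      show "(f \<circ> chart_inv c) holomorphic_on ball (snd c p) R"
        using f[OF c(1)] R(2) unfolding holomorphic_in_chart_def by (rule holomorphic_on_subset)
      show "cmod ((f \<circ> chart_inv c) z) \<le> cmod ((f \<circ> chart_inv c) (snd c p))" for z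
        using p0 p S(7)[OF c] by simp
    qed (use R in auto)
    then have "\<forall>z\<in>ball (snd c p) R. f (chart_inv c z) = f p"
      using R(1) S(7)[OF c] unfolding constant_on_def comp_def by (metis centre_in_ball)
    then show "\<exists>r>0. \<forall>z\<in>ball (snd c p) r \<inter> snd c ` fst c. f (chart_inv c z) = f p0"
      using R(1) p by auto
  qed
  then show ?thesis by blast
qed

section \<open>Zeros of sections of powers of the canonical bundle\<close>

lemma H0_K_proportional:
  fixes A :: "('a::t2_space) chart set"
  assumes A: "closed_riemann_surface A" and q: "q \<in> H0_K A k" "q' \<in> H0_K A k"
    and nz: "\<And>c p. c \<in> A \<Longrightarrow> p \<in> fst c \<Longrightarrow> q c p \<noteq> 0"
  shows "\<exists>a. \<forall>c p. q' c p = a * q c p"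
proof -
  note S = closed_riemann_surfaceD[OF A]
  obtain C where C: "\<And>p. C p \<in> A" "\<And>p. p \<in> fst (C p)"
    using S(3) by metis
  \<comment> \<open>The powers of the transition functions cancel in the quotient of two sections,
    so it is a holomorphic function on the whole surface, and such a function is constant.\<close>
  define f where "f = (\<lambda>p. q' (C p) p / q (C p) p)"
  have f: "f p = q' c p / q c p" if c: "c \<in> A" "p \<in> fst c" for c p
  proof -
    have "q c p = q (C p) p * K_trans c (C p) p ^ k" "q' c p = q' (C p) p * K_trans c (C p) p ^ k"
      using q c C[of p] unfolding H0_K_def by blast+
    then show ?thesis using nz[OF c] by (simp add: f_def)
  qed
  have "\<exists>a. \<forall>p. f p = a"
  proof (rule holomorphic_constant[OF A])
    fix c assume c: "c \<in> A"
    have "holomorphic_in_chart c (q c) (fst c)" "holomorphic_in_chart c (q' c) (fst c)"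
      using q c unfolding H0_K_def by blast+
    then have "(\<lambda>z. (q' c \<circ> chart_inv c) z / (q c \<circ> chart_inv c) z) holomorphic_on snd c ` fst c"
      unfolding holomorphic_in_chart_def
      by (intro holomorphic_on_divide) (use nz[OF c] S(8)[OF c] in \<open>auto simp del: o_apply\<close>, simp)
    then have "(f \<circ> chart_inv c) holomorphic_on snd c ` fst c"
      by (rule holomorphic_transform) (use f[OF c] S(8)[OF c] in auto)
    then show "holomorphic_in_chart c f (fst c)"
      by (simp add: holomorphic_in_chart_def)
  qed
  then obtain a where a: "\<And>p. f p = a" by blast
  have "q' c p = a * q c p" for c p
  proof (cases "c \<in> A \<and> p \<in> fst c")
    case True
    then show ?thesis using f[of c p] nz[of c p] a[of p] by (auto simp: field_simps)
  next
    \<comment> \<open>Off the chart domains both coefficients are \<open>0\<close> by the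
      normalisation in \<open>H0_K\<close>. The equation thus holds between functions, as the
      dimension count requires.\<close>
    case False
    then have "q c p = 0" "q' c p = 0" using q unfolding H0_K_def by blast+
    then show ?thesis by simp
  qed
  then show ?thesis by blast
qed

lemma H0_K_power:
  fixes A :: "('a::t2_space) chart set"
  assumes "\<omega> \<in> H0_K A 1" "k > 0"
  shows "(\<lambda>c p. \<omega> c p ^ k) \<in> H0_K A k"
proof -
  have "\<omega> c p ^ k = \<omega> d p ^ k * K_trans c d p ^ k" if "c \<in> A" "d \<in> A" "p \<in> fst c \<inter> fst d" for c d p
  proof -
    have "\<omega> c p = \<omega> d p * K_trans c d p ^ 1"
      using assms(1) that unfolding H0_K_def by blast
    then show ?thesis by (simp add: power_mult_distrib)
  qed
  moreover have "holomorphic_in_chart c (\<lambda>p. \<omega> c p ^ k) (fst c)" if "c \<in> A" for c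
  proof -
    have "(\<omega> c \<circ> chart_inv c) holomorphic_on (snd c ` fst c)"
      using assms(1) that unfolding H0_K_def holomorphic_in_chart_def by blast
    then have "(\<lambda>z. (\<omega> c \<circ> chart_inv c) z ^ k) holomorphic_on (snd c ` fst c)"
      by (rule holomorphic_on_power)
    then show ?thesis by (simp add: holomorphic_in_chart_def comp_def)
  qed
  moreover have "\<omega> c p ^ k = 0" if "c \<notin> A \<or> p \<notin> fst c" for c p
  proof -
    have "\<omega> c p = 0"
      using assms(1) that unfolding H0_K_def by blast
    then show ?thesis using assms(2) by simp
  qed
  ultimately show ?thesis
    unfolding H0_K_def by blast
qed

text \<open>If \<open>q\<close> had no zeros, then \<open>\<omega>\<^sup>k / q\<close> would be constant for every holomorphic differential
  \<open>\<omega>\<close>, so nonzero differentials would have no zeros either and would all be proportional.\<close>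

lemma H0_K_has_zero:
  fixes A :: "('a::t2_space) chart set"
  assumes A: "closed_riemann_surface A" and genus: "genus A \<ge> 2"
    and q: "q \<in> H0_K A k" and k: "k > 0"
  shows "\<exists>c\<in>A. \<exists>p\<in>fst c. q c p = 0"
proof (rule ccontr)
  assume "\<not> ?thesis"
  then have nz: "\<And>c p. c \<in> A \<Longrightarrow> p \<in> fst c \<Longrightarrow> q c p \<noteq> 0" by blast
  have nz1: "\<omega> c p \<noteq> 0" if \<omega>: "\<omega> \<in> H0_K A 1" "\<omega> \<noteq> (\<lambda>c p. 0)" and c: "c \<in> A" "p \<in> fst c" for \<omega> c p
  proof -
    obtain a where a: "\<And>c p. \<omega> c p ^ k = a * q c p"
      using H0_K_proportional[OF A q H0_K_power[OF \<omega>(1) k] nz] by blast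
    obtain d r where "\<omega> d r \<noteq> 0" using \<omega>(2) by (metis ext)
    then have "a \<noteq> 0" using a[of d r] by auto
    then show ?thesis using a[of c p] nz[OF c] k by (auto simp: zero_power)
  qed
  \<comment> \<open>A single spanning differential bounds the dimension by one, against the genus;
    if there is no nonzero differential, the zero one spans.\<close>
  have "\<exists>\<omega>1. \<forall>\<omega>\<in>H0_K A 1. \<exists>a. \<omega> = (\<lambda>c p. a * \<omega>1 c p)"
  proof (cases "\<exists>\<omega>\<in>H0_K A 1. \<omega> \<noteq> (\<lambda>c p. 0)")
    case True
    then obtain \<omega>1 where \<omega>1: "\<omega>1 \<in> H0_K A 1" "\<omega>1 \<noteq> (\<lambda>c p. 0)" by blast
    have "\<exists>a. \<omega> = (\<lambda>c p. a * \<omega>1 c p)" if "\<omega> \<in> H0_K A 1" for \<omega>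
      using H0_K_proportional[OF A \<omega>1(1) that nz1[OF \<omega>1]] by (auto simp: fun_eq_iff)
    then show ?thesis by blast
  next
    case False
    then show ?thesis by (intro exI[of _ "\<lambda>c p. 0"]) auto
  qed
  then obtain \<omega>1 where \<omega>1: "\<And>\<omega>. \<omega> \<in> H0_K A 1 \<Longrightarrow> \<exists>a. \<omega> = (\<lambda>c p. a * \<omega>1 c p)" by blast
  interpret V: vector_space "\<lambda>(a::complex) (q :: 'a chart \<Rightarrow> 'a \<Rightarrow> complex) c p. a * q c p"
    by unfold_locales (auto simp: fun_eq_iff algebra_simps)
  have "H0_K A 1 \<subseteq> V.span {\<omega>1}"
    using \<omega>1 unfolding V.span_singleton by blast
  then have "V.dim (H0_K A 1) \<le> card {\<omega>1}"
    by (rule V.dim_le_card) simp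
  then show False using genus by (simp add: genus_def)
qed

section \<open>Two solutions of Hitchin's equation\<close>

lemma mtrace_adjoint: "A \<in> carrier_mat n n \<Longrightarrow> mtrace (mat_adjoint A) = cnj (mtrace A)"
  by (auto simp: mtrace_def)

lemma uminus_add_mat:
  fixes A B :: "complex mat"
  assumes "A \<in> carrier_mat n n" "B \<in> carrier_mat n n"
  shows "- A + B = B - A"
  by (rule eq_matI) (use assms in auto)

lemma diff_zero_mat_eq:
  fixes A B :: "complex mat"
  assumes "A \<in> carrier_mat n n" "B \<in> carrier_mat n n" "A - B = 0\<^sub>m n n"
  shows "A = B"
proof (rule eq_matI)
  fix i j assume ij: "i < dim_row B" "j < dim_col B"
  then have "(A - B) $$ (i, j) = 0" using assms by auto
  then show "A $$ (i, j) = B $$ (i, j)" using ij assms(1,2) by auto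
qed (use assms in auto)

lemmas sq_simps = sq_carrier sq_assoc sq_distribs

section \<open>Pointwise algebra of a pair of metrics\<close>

context
  fixes n :: nat and H K G J :: "complex mat"
  assumes H: "pos_def_hermitian n H" and K: "pos_def_hermitian n K"
    and G: "G \<in> carrier_mat n n" "G * H = 1\<^sub>m n" "H * G = 1\<^sub>m n"
    and J: "J \<in> carrier_mat n n" "J * K = 1\<^sub>m n" "K * J = 1\<^sub>m n"
begin

lemma carriers: "H \<in> carrier_mat n n" "K \<in> carrier_mat n n"
  using H K by (auto dest: pos_def_hermitianD)

lemma adjoints: "mat_adjoint H = H" "mat_adjoint K = K" "mat_adjoint G = G" "mat_adjoint J = J"
  using pos_def_hermitianD[OF H] pos_def_hermitianD[OF K] mat_adjoint_inverse[of H n G] mat_adjoint_inverse[of K n J] G J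
  by auto

lemma cancels:
  "X \<in> carrier_mat n n \<Longrightarrow> G * (H * X) = X" "X \<in> carrier_mat n n \<Longrightarrow> H * (G * X) = X"
  "X \<in> carrier_mat n n \<Longrightarrow> J * (K * X) = X" "X \<in> carrier_mat n n \<Longrightarrow> K * (J * X) = X"
  using left_cancel_mat[of G H n X] left_cancel_mat[of H G n X] left_cancel_mat[of J K n X]
    left_cancel_mat[of K J n X] G J carriers by auto

text \<open>For \<open>P\<close> and \<open>R\<close> the z-derivatives of the two metrics,
  \<open>S\<close> is the zbar-derivative of \<open>s = G * K\<close>. The difference
  \<open>J * R - G * P\<close> of the connection forms is the adjoint of \<open>S\<close>, so the
  product has the squared norm of \<open>S\<close> as its trace.\<close>

lemma first_order_term:
  assumes P: "P \<in> carrier_mat n n" and R: "R \<in> carrier_mat n n"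
  defines "S \<equiv> G * mat_adjoint R - G * mat_adjoint P * G * K"
  shows "S * (J * R - G * P) = S * J * mat_adjoint S * H"
proof -
  note c = carriers G(1) J(1) P R
  have S: "S \<in> carrier_mat n n"
    unfolding S_def using c by (simp add: sq_carrier[of _ n])
  have "mat_adjoint S = R * G - K * G * P * G"
    unfolding S_def using c
    by (simp add: mat_adjoint_diff[of _ n n] mat_adjoint_mult[of _ n n _ n] adjoints sq_simps[of _ n])
  then have "J * mat_adjoint S * H = J * R - G * P"
    using c G(2) J(2) by (simp add: sq_simps[of _ n] cancels)
  then show ?thesis
    using c S by (simp add: sq_assoc[of _ n] sq_carrier[of _ n])
qed

text \<open>Cyclicity turns the trace of \<open>s\<close> times a commutator with \<open>F\<close>
  into the trace of \<open>[s, F]\<close> times the other factor. Here that factor is the difference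
  of the two adjoints of \<open>F\<close>, which is the adjoint of
  \<open>C = [s, F]\<close>.\<close>

lemma zeroth_order_term:
  assumes F: "F \<in> carrier_mat n n"
  defines "C \<equiv> G * K * F - F * (G * K)"
  shows "mtrace (G * K * ((F * (J * mat_adjoint F * K) - J * mat_adjoint F * K * F) -
      (F * (G * mat_adjoint F * H) - G * mat_adjoint F * H * F))) =
    mtrace (C * J * mat_adjoint C * H)"
proof -
  note c = carriers G(1) J(1) F
  have C: "C \<in> carrier_mat n n"
    unfolding C_def using c by (simp add: sq_carrier[of _ n])
  have "mat_adjoint C = mat_adjoint F * K * G - K * G * mat_adjoint F"
    unfolding C_def using c
    by (simp add: mat_adjoint_diff[of _ n n] mat_adjoint_mult[of _ n n _ n] adjoints sq_simps[of _ n])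
  then have "J * mat_adjoint C * H = J * mat_adjoint F * K - G * mat_adjoint F * H"
    using c G(2) by (simp add: sq_simps[of _ n] cancels)
  then have "C * J * mat_adjoint C * H = C * (J * mat_adjoint F * K - G * mat_adjoint F * H)"
    using c C by (simp add: sq_assoc[of _ n] sq_carrier[of _ n])
  then have "mtrace (C * J * mat_adjoint C * H) =
      mtrace (G * (K * (F * (J * (mat_adjoint F * K))))) - mtrace (F * (G * (mat_adjoint F * K)))
      - (mtrace (G * (K * (F * (G * (mat_adjoint F * H))))) - mtrace (F * (G * (K * (G * (mat_adjoint F * H))))))"
    unfolding C_def using c by (simp add: sq_simps[of _ n] cancels mtrace_diff[of _ n])
  moreover have "mtrace (F * (G * (mat_adjoint F * K))) = mtrace (G * (mat_adjoint F * (K * F)))"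
    using mtrace_comm[of F n n "G * (mat_adjoint F * K)"] c by (simp add: sq_simps[of _ n])
  moreover have "mtrace (F * (G * (K * (G * (mat_adjoint F * H))))) =
      mtrace (G * (K * (G * (mat_adjoint F * (H * F)))))"
    using mtrace_comm[of F n n "G * (K * (G * (mat_adjoint F * H)))"] c by (simp add: sq_simps[of _ n])
  ultimately show ?thesis
    using c by (simp add: sq_simps[of _ n] cancels mtrace_diff[of _ n])
qed

text \<open>With \<open>s = G * K\<close> and inverse \<open>J * H\<close>, the squared norm of
  \<open>s - 1\<close> is the trace of \<open>(s - 1) * (1 - J * H)\<close>, that is, the sum of the
  two traces minus \<open>2 * n\<close>.\<close>

lemma eq_if_traces:
  assumes "Re (mtrace (G * K)) = real n" "Re (mtrace (J * H)) = real n"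
  shows "H = K"
proof -
  note c = carriers G(1) J(1)
  define Z where "Z = G * K - 1\<^sub>m n"
  have Z: "Z \<in> carrier_mat n n" unfolding Z_def using c by (simp add: sq_carrier[of _ n])
  have "mat_adjoint Z = K * G - 1\<^sub>m n"
    unfolding Z_def using c
    by (simp add: mat_adjoint_diff[of _ n n] mat_adjoint_mult[of _ n n _ n] adjoints mat_adjoint_one sq_carrier[of _ n])
  then have "J * mat_adjoint Z * H = 1\<^sub>m n - J * H"
    using c G(2) J(2) by (simp add: sq_simps[of _ n] cancels)
  then have "Z * J * mat_adjoint Z * H = Z * (1\<^sub>m n - J * H)"
    using c Z by (simp add: sq_assoc[of _ n] sq_carrier[of _ n])
  moreover have "Re (mtrace (Z * (1\<^sub>m n - J * H))) = 0"
    unfolding Z_def using c assms G(2)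
    by (simp add: sq_simps[of _ n] cancels mtrace_diff[of _ n] mtrace_one)
  ultimately have "Z = 0\<^sub>m n n"
    using mtrace_norm_eq_0[OF H K J G(1,3) Z] by simp
  then have "G * K = 1\<^sub>m n"
    by (intro diff_zero_mat_eq[of "G * K" n "1\<^sub>m n"]) (use c in \<open>simp_all add: Z_def sq_carrier[of _ n]\<close>)
  then have "H * (G * K) = H" using c by simp
  then show ?thesis using cancels c by simp
qed

end

text \<open>Commuting with one nilpotent Jordan block makes \<open>s\<close> lower triangular and
  constant along its diagonals. Its only eigenvalue \<open>t\<close> is a root of unity by the
  determinant and positive by comparison of the two metrics, hence equal to one.\<close>

lemma mtrace_commute_e1_tilde:
  assumes n: "n > 0" and H: "pos_def_hermitian n H" and K: "pos_def_hermitian n K"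
    and s: "s \<in> carrier_mat n n" "K = H * s" "Determinant.det s = 1"
    and comm: "s * e1_tilde n = e1_tilde n * s"
  shows "mtrace s = of_nat n"
proof -
  have e: "e1_tilde n \<in> carrier_mat n n" by (simp add: e1_tilde_def)
  have l: "(s * e1_tilde n) $$ (a, b) = (if Suc b < n then s $$ (a, Suc b) else 0)" if "a < n" "b < n" for a b
  proof -
    have "(s * e1_tilde n) $$ (a, b) = (\<Sum>k<n. if k = Suc b then s $$ (a, k) else 0)"
      using that by (subst mult_mat_index[OF s(1) e]) (simp, simp, intro sum.cong refl, use s(1) in \<open>auto simp: e1_tilde_def\<close>)
    then show ?thesis by simp
  qed
  have r: "(e1_tilde n * s) $$ (a, b) = (if a = 0 then 0 else s $$ (a - 1, b))" if "a < n" "b < n" for a b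
  proof (cases a)
    case 0
    then show ?thesis
      using that by (subst mult_mat_index[OF e s(1)]) (auto simp: e1_tilde_def intro!: sum.neutral)
  next
    case (Suc a')
    have "(e1_tilde n * s) $$ (a, b) = (\<Sum>k<n. if k = a' then s $$ (k, b) else 0)"
      using that Suc by (subst mult_mat_index[OF e s(1)]) (simp, simp, intro sum.cong refl, use s(1) in \<open>auto simp: e1_tilde_def\<close>)
    then show ?thesis using that Suc by simp
  qed
  have shift: "s $$ (Suc a, Suc b) = s $$ (a, b)" if "Suc a < n" "Suc b < n" for a b
    using l[of "Suc a" b] r[of "Suc a" b] that comm by simp
  have top: "s $$ (0, Suc b) = 0" if "Suc b < n" for b
    using l[of 0 b] r[of 0 b] that comm by simp
  have upper: "s $$ (a, b) = 0" if "a < b" "b < n" for a b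
    using that
  proof (induction a arbitrary: b)
    case 0
    then show ?case using top[of "b - 1"] by simp
  next
    case (Suc a)
    then show ?case using Suc.IH[of "b - 1"] shift[of a "b - 1"] by simp
  qed
  define t where "t = s $$ (0, 0)"
  have diag: "s $$ (a, a) = t" if "a < n" for a
    using that by (induction a) (auto simp: t_def shift)
  have "Determinant.det s = prod_list (diag_mat s)"
    by (rule det_lower_triangular[OF upper s(1)])
  also have "\<dots> = (\<Prod>i = 0..<n. s $$ (i, i))"
    using s(1) by (simp add: prod_list_diag_prod)
  also have "\<dots> = t ^ n"
    by (simp add: diag)
  finally have tn: "t ^ n = 1" using s(3) by simp
  \<comment> \<open>The last column of the triangular \<open>s\<close> has \<open>t\<close> as its
    only possibly nonzero entry, so in this place \<open>K = H * s\<close> relates two positive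
    diagonal entries by the factor \<open>t\<close>.\<close>
  have "K $$ (n - 1, n - 1) = (\<Sum>k<n. H $$ (n - 1, k) * s $$ (k, n - 1))"
    unfolding s(2) by (rule mult_mat_index) (use pos_def_hermitianD[OF H] s n in auto)
  also have "\<dots> = (\<Sum>k<n. if k = n - 1 then H $$ (n - 1, k) * t else 0)"
    by (rule sum.cong) (auto simp: upper diag)
  also have "\<dots> = H $$ (n - 1, n - 1) * t"
    using n by simp
  finally have Kt: "K $$ (n - 1, n - 1) = H $$ (n - 1, n - 1) * t" .
  define h k where "h = Re (H $$ (n - 1, n - 1))" and "k = Re (K $$ (n - 1, n - 1))"
  have hk: "h > 0" "k > 0" "H $$ (n - 1, n - 1) = of_real h" "K $$ (n - 1, n - 1) = of_real k"
    using pos_def_hermitian_diag[OF H, of "n - 1"] pos_def_hermitian_diag[OF K, of "n - 1"] n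
    by (simp_all add: h_def k_def)
  then have "t = of_real (k / h)"
    using Kt by (simp add: field_simps)
  moreover have "(k / h) ^ n = 1"
    using tn unfolding calculation by (metis of_real_1 of_real_eq_iff of_real_power)
  then have "k / h = 1"
    using hk n by (intro power_eq_imp_eq_base[of "k / h" n 1]) auto
  ultimately show ?thesis
    using s(1) diag by (simp add: mtrace_def)
qed

text \<open>Hitchin's equation in one coordinate, with the sign of \<open>chern_curvature\<close>
  moved to the other side. Regularity is recorded as two successive derivatives, which makes it easy
  to pass on to twisted and dual metrics.\<close>

definition local_solution ::
  "nat \<Rightarrow> complex set \<Rightarrow> (complex \<Rightarrow> complex mat) \<Rightarrow> (complex \<Rightarrow> complex mat) \<Rightarrow> bool" where
  "local_solution n S F H \<longleftrightarrow> (\<forall>w\<in>S. F w \<in> carrier_mat n n \<and>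
     pos_def_hermitian n (H w) \<and> Determinant.det (H w) = 1 \<and>
     mat_differentiable n H w \<and> mat_differentiable n (mat_wirtinger (- \<i>) n H) w \<and>
     mat_wirtinger \<i> n (\<lambda>u. mat_inv (H u) * mat_wirtinger (- \<i>) n H u) w =
       F w * metric_adjoint (H w) (F w) - metric_adjoint (H w) (F w) * F w)"

lemma local_solutionD:
  assumes "local_solution n S F H" "w \<in> S"
  shows "F w \<in> carrier_mat n n" "pos_def_hermitian n (H w)" "Determinant.det (H w) = 1"
    "mat_differentiable n H w" "mat_differentiable n (mat_wirtinger (- \<i>) n H) w"
    "mat_wirtinger \<i> n (\<lambda>u. mat_inv (H u) * mat_wirtinger (- \<i>) n H u) w =
       F w * metric_adjoint (H w) (F w) - metric_adjoint (H w) (F w) * F w"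
    and "H w \<in> carrier_mat n n" "mat_inv (H w) \<in> carrier_mat n n"
    "mat_inv (H w) * H w = 1\<^sub>m n" "H w * mat_inv (H w) = 1\<^sub>m n"
proof -
  show *: "F w \<in> carrier_mat n n" "pos_def_hermitian n (H w)" "Determinant.det (H w) = 1"
    "mat_differentiable n H w" "mat_differentiable n (mat_wirtinger (- \<i>) n H) w"
    "mat_wirtinger \<i> n (\<lambda>u. mat_inv (H u) * mat_wirtinger (- \<i>) n H u) w =
       F w * metric_adjoint (H w) (F w) - metric_adjoint (H w) (F w) * F w"
    using assms unfolding local_solution_def by blast+
  show H: "H w \<in> carrier_mat n n" using pos_def_hermitianD[OF *(2)] by simp
  show "mat_inv (H w) \<in> carrier_mat n n"
    "mat_inv (H w) * H w = 1\<^sub>m n" "H w * mat_inv (H w) = 1\<^sub>m n"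
    using mat_inv_carrier[OF H *(3)] mat_inv_left[OF H *(3)] mat_inv_right[OF H *(3)] by auto
qed

section \<open>The Laplacian of the trace over one chart\<close>

lemma z_derivative_real_part:
  assumes S: "open S"
    and f: "\<And>z. z \<in> S \<Longrightarrow> f differentiable (at z)" "\<And>z. z \<in> S \<Longrightarrow> cnj (f z) = f z"
    and g: "\<And>z. z \<in> S \<Longrightarrow> wirtinger (- \<i>) f z = g z" "\<And>z. z \<in> S \<Longrightarrow> g differentiable (at z)"
  shows "z_derivative (\<lambda>z. Re (f z)) g S"
  unfolding z_derivative_def
proof (intro ballI conjI g(2))
  fix z assume z: "z \<in> S"
  define D where "D = frechet_derivative f (at z)"
  have D: "(f has_derivative D) (at z)"
    unfolding D_def by (rule differentiable_has_derivative[OF f(1)[OF z]])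
  \<comment> \<open>A function equal to its conjugate has a real differential, and a real
    differential is determined by the z-derivative alone.\<close>
  have "((\<lambda>u. cnj (f u)) has_derivative D) (at z)"
    by (rule has_derivative_transform_within_open[OF D S z]) (use f(2) in auto)
  then have "(\<lambda>h. cnj (D h)) = D"
    using has_derivative_unique has_derivative_cnj_compose[OF D] by blast
  then have real: "Im (D h) = 0" for h
    by (metis Reals_cnj_iff complex_is_Real_iff)
  interpret linear D using D by (rule has_derivative_linear)
  have "Re (D h) = 2 * Re (g z * h)" for h
  proof -
    have "h = Re h *\<^sub>R 1 + Im h *\<^sub>R \<i>"
      by (simp add: complex_eq_iff)
    then have "D h = Re h *\<^sub>R D 1 + Im h *\<^sub>R D \<i>"
      by (metis add scale)
    then have "Re (D h) = Re h * Re (D 1) + Im h * Re (D \<i>)"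
      by simp
    moreover have gz: "g z = (D 1 - \<i> * D \<i>) / 2"
      using g(1)[OF z] wirtinger_eq[OF D, of "- \<i>"] by simp
    have "Re (g z) = Re (D 1) / 2" "Im (g z) = - Re (D \<i>) / 2"
      unfolding gz using real by simp_all
    ultimately show ?thesis by (simp add: algebra_simps)
  qed
  then show "((\<lambda>z. Re (f z)) has_derivative (\<lambda>h. 2 * Re (g z * h))) (at z)"
    using bounded_linear.has_derivative[OF bounded_linear_Re D] by simp
qed

context
  fixes n :: nat and S :: "complex set" and F H K :: "complex \<Rightarrow> complex mat"
  assumes S: "open S" and H: "local_solution n S F H" and K: "local_solution n S F K"
begin

text \<open>The z-derivative of the trace of \<open>s\<close>, rearranged by cyclicity so that the
  metrics are differentiated only inside their connection forms. Hitchin's equation gives the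
  zbar-derivatives of exactly these.\<close>

definition trace_gradient :: "complex \<Rightarrow> complex" where
  "trace_gradient w = mtrace (mat_inv (H w) * K w *
     (mat_inv (K w) * mat_wirtinger (- \<i>) n K w - mat_inv (H w) * mat_wirtinger (- \<i>) n H w))"

lemma diff_rules:
  assumes "w \<in> S"
  shows "mat_differentiable n (\<lambda>u. mat_inv (H u)) w" "mat_differentiable n (\<lambda>u. mat_inv (K u)) w"
    "mat_differentiable n (\<lambda>u. mat_inv (H u) * K u) w"
    "mat_differentiable n (\<lambda>u. mat_inv (H u) * mat_wirtinger (- \<i>) n H u) w"
    "mat_differentiable n (\<lambda>u. mat_inv (K u) * mat_wirtinger (- \<i>) n K u) w"
    "mat_differentiable n (\<lambda>u. mat_inv (K u) * mat_wirtinger (- \<i>) n K u - mat_inv (H u) * mat_wirtinger (- \<i>) n H u) w"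
proof -
  note HD = local_solutionD[OF H] and KD = local_solutionD[OF K]
  show 1: "mat_differentiable n (\<lambda>u. mat_inv (H u)) w" "mat_differentiable n (\<lambda>u. mat_inv (K u)) w"
    using mat_differentiable_inv[OF S assms HD(7,3,4)] mat_differentiable_inv[OF S assms KD(7,3,4)] assms by auto
  show "mat_differentiable n (\<lambda>u. mat_inv (H u) * K u) w"
    by (rule mat_differentiable_mult[OF S assms HD(8) KD(7) 1(1) KD(4)[OF assms]])
  show 2: "mat_differentiable n (\<lambda>u. mat_inv (H u) * mat_wirtinger (- \<i>) n H u) w"
    by (rule mat_differentiable_mult[OF S assms HD(8) _ 1(1) HD(5)[OF assms]]) simp_all
  show 3: "mat_differentiable n (\<lambda>u. mat_inv (K u) * mat_wirtinger (- \<i>) n K u) w"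
    by (rule mat_differentiable_mult[OF S assms KD(8) _ 1(2) KD(5)[OF assms]]) simp_all
  show "mat_differentiable n (\<lambda>u. mat_inv (K u) * mat_wirtinger (- \<i>) n K u - mat_inv (H u) * mat_wirtinger (- \<i>) n H u) w"
    by (rule mat_differentiable_diff[OF S assms _ _ 3 2])
       (use HD(8) KD(8) in \<open>simp_all add: sq_carrier[of _ n]\<close>)
qed

lemma wirtinger_ratio:
  assumes "w \<in> S"
  shows "mat_wirtinger e n (\<lambda>u. mat_inv (H u) * K u) w =
    mat_inv (H w) * mat_wirtinger e n K w - mat_inv (H w) * mat_wirtinger e n H w * mat_inv (H w) * K w"
proof -
  note HD = local_solutionD[OF H] and KD = local_solutionD[OF K]
  have "mat_wirtinger e n (\<lambda>u. mat_inv (H u) * K u) w =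
      - (mat_inv (H w) * mat_wirtinger e n H w * mat_inv (H w)) * K w + mat_inv (H w) * mat_wirtinger e n K w"
    using mat_wirtinger_mult[OF S assms HD(8) KD(7) diff_rules(1)[OF assms] KD(4)[OF assms]]
      mat_wirtinger_inv[OF S assms HD(7,3,4)] assms by simp
  also have "\<dots> = - (mat_inv (H w) * mat_wirtinger e n H w * mat_inv (H w) * K w) + mat_inv (H w) * mat_wirtinger e n K w"
    using HD(8)[OF assms] KD(7)[OF assms] by (subst uminus_mult_left_mat) auto
  also have "\<dots> = mat_inv (H w) * mat_wirtinger e n K w - mat_inv (H w) * mat_wirtinger e n H w * mat_inv (H w) * K w"
    by (rule uminus_add_mat[of _ n]) (use HD(8)[OF assms] KD(7)[OF assms] in \<open>simp_all add: sq_carrier[of _ n]\<close>)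
  finally show ?thesis .
qed

lemma z_derivative_trace:
  "z_derivative (\<lambda>w. Re (mtrace (mat_inv (H w) * K w))) trace_gradient S"
proof (rule z_derivative_real_part[OF S])
  note HD = local_solutionD[OF H] and KD = local_solutionD[OF K]
  fix w assume w: "w \<in> S"
  have carr: "mat_inv (H u) * K u \<in> carrier_mat n n"
    "mat_inv (K u) * mat_wirtinger (- \<i>) n K u - mat_inv (H u) * mat_wirtinger (- \<i>) n H u \<in> carrier_mat n n"
    if "u \<in> S" for u
    using HD(8)[OF that] KD(7,8)[OF that] by (simp_all add: sq_carrier[of _ n])
  note c = HD(7,8)[OF w] KD(7,8)[OF w]
  show "(\<lambda>w. mtrace (mat_inv (H w) * K w)) differentiable (at w)"
    by (rule differentiable_mtrace[OF S w carr(1) diff_rules(3)[OF w]])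
  \<comment> \<open>Although \<open>s\<close> need not be a Hermitian matrix, its adjoint has the
    same two factors in the opposite order, so its trace is real.\<close>
  have "mat_adjoint (mat_inv (H w) * K w) = K w * mat_inv (H w)"
    using mat_adjoint_mult[OF c(2,3)] pos_def_hermitianD(2)[OF KD(2)[OF w]]
      adjoints(3)[OF HD(2)[OF w] KD(2)[OF w] HD(8-10)[OF w] KD(8-10)[OF w]] by simp
  then show "cnj (mtrace (mat_inv (H w) * K w)) = mtrace (mat_inv (H w) * K w)"
    using mtrace_adjoint[OF carr(1)[OF w]] mtrace_comm[OF c(2,3)] by simp
  have "wirtinger (- \<i>) (\<lambda>w. mtrace (mat_inv (H w) * K w)) w =
      mtrace (mat_wirtinger (- \<i>) n (\<lambda>u. mat_inv (H u) * K u) w)"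
    by (rule wirtinger_mtrace[OF S w carr(1) diff_rules(3)[OF w]])
  also have "\<dots> = trace_gradient w"
    using mtrace_comm[of "mat_inv (H w) * mat_wirtinger (- \<i>) n H w" n n "mat_inv (H w) * K w"]
      cancels(4)[OF HD(2)[OF w] KD(2)[OF w] HD(8-10)[OF w] KD(8-10)[OF w]] c
    by (simp add: wirtinger_ratio[OF w] trace_gradient_def sq_simps[of _ n] mtrace_diff[of _ n])
  finally show "wirtinger (- \<i>) (\<lambda>w. mtrace (mat_inv (H w) * K w)) w = trace_gradient w" .
  show "trace_gradient differentiable (at w)"
    unfolding trace_gradient_def[abs_def]
  proof (rule differentiable_mtrace[OF S w])
    show "mat_inv (H u) * K u * (mat_inv (K u) * mat_wirtinger (- \<i>) n K u
        - mat_inv (H u) * mat_wirtinger (- \<i>) n H u) \<in> carrier_mat n n" if "u \<in> S" for u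
      by (rule mult_carrier_mat[OF carr[OF that]])
    show "mat_differentiable n (\<lambda>u. mat_inv (H u) * K u * (mat_inv (K u) * mat_wirtinger (- \<i>) n K u
        - mat_inv (H u) * mat_wirtinger (- \<i>) n H u)) w"
      by (rule mat_differentiable_mult[OF S w carr diff_rules(3,6)[OF w]])
  qed
qed

text \<open>The product rule gives two terms: the zbar-derivative of \<open>s\<close> times the
  difference of the connection forms, and \<open>s\<close> times the difference of the commutators
  in the two Hitchin equations. Both have squared norms as traces; the second is that of
  \<open>[s, F]\<close>, so a vanishing Laplacian forces \<open>s\<close> and \<open>F\<close> to
  commute.\<close>

lemma laplacian_trace:
  assumes w: "w \<in> S"
  shows "Re (wirtinger \<i> trace_gradient w) \<ge> 0"
    and "Re (wirtinger \<i> trace_gradient w) = 0 \<Longrightarrow> mat_inv (H w) * K w * F w = F w * (mat_inv (H w) * K w)"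
proof -
  note HD = local_solutionD[OF H] and KD = local_solutionD[OF K]
  define G J P R T C where "G = mat_inv (H w)" and "J = mat_inv (K w)"
    and "P = mat_wirtinger (- \<i>) n H w" and "R = mat_wirtinger (- \<i>) n K w"
    and "T = G * mat_adjoint R - G * mat_adjoint P * G * K w"
    and "C = G * K w * F w - F w * (G * K w)"
  note prem = HD(2)[OF w] KD(2)[OF w] HD(8-10)[OF w, folded G_def] KD(8-10)[OF w, folded J_def]
  have PR: "P \<in> carrier_mat n n" "R \<in> carrier_mat n n" by (simp_all add: P_def R_def)
  note c = HD(7)[OF w] KD(7)[OF w] prem(3,6) PR HD(1)[OF w]
  have T: "T \<in> carrier_mat n n" and C: "C \<in> carrier_mat n n"
    unfolding T_def C_def using c by (simp_all add: sq_carrier[of _ n])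
  have carr: "mat_inv (H u) * K u \<in> carrier_mat n n"
    "mat_inv (K u) * mat_wirtinger (- \<i>) n K u - mat_inv (H u) * mat_wirtinger (- \<i>) n H u \<in> carrier_mat n n"
    "mat_inv (K u) * mat_wirtinger (- \<i>) n K u \<in> carrier_mat n n"
    "mat_inv (H u) * mat_wirtinger (- \<i>) n H u \<in> carrier_mat n n"
    if "u \<in> S" for u
    using HD(8)[OF that] KD(7,8)[OF that] by (simp_all add: sq_carrier[of _ n])
  have "mat_adjoint (H u) = H u" "mat_adjoint (K u) = K u" if "u \<in> S" for u
    using pos_def_hermitianD(2)[OF HD(2)[OF that]] pos_def_hermitianD(2)[OF KD(2)[OF that]] by auto
  then have bar: "mat_wirtinger \<i> n H w = mat_adjoint P" "mat_wirtinger \<i> n K w = mat_adjoint R"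
    using mat_wirtinger_adjoint[OF S w HD(7) _ HD(4)[OF w], of "- \<i>"]
      mat_wirtinger_adjoint[OF S w KD(7) _ KD(4)[OF w], of "- \<i>"] by (simp_all add: P_def R_def)
  define d where "d = (\<lambda>u. mat_inv (K u) * mat_wirtinger (- \<i>) n K u - mat_inv (H u) * mat_wirtinger (- \<i>) n H u)"
  have "wirtinger \<i> trace_gradient w = mtrace (mat_wirtinger \<i> n (\<lambda>u. mat_inv (H u) * K u * d u) w)"
    unfolding trace_gradient_def[abs_def] d_def
  proof (rule wirtinger_mtrace[OF S w])
    show "mat_inv (H u) * K u * (mat_inv (K u) * mat_wirtinger (- \<i>) n K u
        - mat_inv (H u) * mat_wirtinger (- \<i>) n H u) \<in> carrier_mat n n" if "u \<in> S" for u
      by (rule mult_carrier_mat[OF carr(1,2)[OF that]])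
    show "mat_differentiable n (\<lambda>u. mat_inv (H u) * K u * (mat_inv (K u) * mat_wirtinger (- \<i>) n K u
        - mat_inv (H u) * mat_wirtinger (- \<i>) n H u)) w"
      by (rule mat_differentiable_mult[OF S w carr(1,2) diff_rules(3,6)[OF w]])
  qed
  also have "mat_wirtinger \<i> n (\<lambda>u. mat_inv (H u) * K u * d u) w =
      mat_wirtinger \<i> n (\<lambda>u. mat_inv (H u) * K u) w * d w + mat_inv (H w) * K w * mat_wirtinger \<i> n d w"
    unfolding d_def by (rule mat_wirtinger_mult[OF S w carr(1,2) diff_rules(3,6)[OF w]])
  also have "mat_wirtinger \<i> n d w =
      mat_wirtinger \<i> n (\<lambda>u. mat_inv (K u) * mat_wirtinger (- \<i>) n K u) w
      - mat_wirtinger \<i> n (\<lambda>u. mat_inv (H u) * mat_wirtinger (- \<i>) n H u) w"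
    unfolding d_def by (rule mat_wirtinger_diff[OF S w carr(3,4) diff_rules(5,4)[OF w]])
  also have "mat_wirtinger \<i> n (\<lambda>u. mat_inv (H u) * K u) w = T"
    unfolding wirtinger_ratio[OF w] bar by (simp only: T_def G_def)
  also have "T * d w + mat_inv (H w) * K w *
      (mat_wirtinger \<i> n (\<lambda>u. mat_inv (K u) * mat_wirtinger (- \<i>) n K u) w
      - mat_wirtinger \<i> n (\<lambda>u. mat_inv (H u) * mat_wirtinger (- \<i>) n H u) w) =
     T * (J * R - G * P) + G * K w *
     ((F w * (J * mat_adjoint (F w) * K w) - J * mat_adjoint (F w) * K w * F w) -
      (F w * (G * mat_adjoint (F w) * H w) - G * mat_adjoint (F w) * H w * F w))"
    unfolding HD(6)[OF w] KD(6)[OF w] by (simp only: metric_adjoint_def d_def G_def J_def P_def R_def)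
  also have "mtrace (T * (J * R - G * P) + G * K w *
     ((F w * (J * mat_adjoint (F w) * K w) - J * mat_adjoint (F w) * K w * F w) -
      (F w * (G * mat_adjoint (F w) * H w) - G * mat_adjoint (F w) * H w * F w))) =
      mtrace (T * J * mat_adjoint T * H w) + mtrace (C * J * mat_adjoint C * H w)"
    unfolding C_def zeroth_order_term[OF prem c(7), symmetric]
    unfolding T_def first_order_term[OF prem PR, symmetric]
    using c by (intro mtrace_add[of _ n]) (simp_all add: sq_carrier[of _ n])
  finally have eq: "Re (wirtinger \<i> trace_gradient w) =
      Re (mtrace (T * J * mat_adjoint T * H w)) + Re (mtrace (C * J * mat_adjoint C * H w))"
    by simp
  note nonneg = mtrace_norm_nonneg[OF prem(1,2,6-8,3,5)]
  show "Re (wirtinger \<i> trace_gradient w) \<ge> 0"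
    unfolding eq using nonneg[OF T] nonneg[OF C] by simp
  assume "Re (wirtinger \<i> trace_gradient w) = 0"
  then have "Re (mtrace (C * J * mat_adjoint C * H w)) = 0"
    unfolding eq using nonneg[OF T] nonneg[OF C] by simp
  then have "C = 0\<^sub>m n n"
    by (rule mtrace_norm_eq_0[OF prem(1,2,6-8,3,5) C])
  then show "mat_inv (H w) * K w * F w = F w * (mat_inv (H w) * K w)"
    unfolding C_def G_def[symmetric]
    by (rule diff_zero_mat_eq[rotated 2]) (intro mult_carrier_mat[of _ n n] c)+
qed

lemma subharmonic_trace: "subharmonic (\<lambda>w. Re (mtrace (mat_inv (H w) * K w))) S"
  unfolding subharmonic_def using z_derivative_trace laplacian_trace(1) by blast

lemma constant_trace_commute:
  assumes "\<And>w. w \<in> S \<Longrightarrow> Re (mtrace (mat_inv (H w) * K w)) = M" "w \<in> S"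
  shows "mat_inv (H w) * K w * F w = F w * (mat_inv (H w) * K w)"
proof (rule laplacian_trace(2)[OF assms(2)])
  have "trace_gradient z = 0" if z: "z \<in> S" for z
  proof -
    have "((\<lambda>w. Re (mtrace (mat_inv (H w) * K w))) has_derivative (\<lambda>h. 2 * Re (trace_gradient z * h))) (at z)"
      using z_derivative_trace z by (simp add: z_derivative_def)
    moreover have "((\<lambda>w. Re (mtrace (mat_inv (H w) * K w))) has_derivative (\<lambda>h. 0)) (at z)"
      by (rule has_derivative_transform_within_open[OF has_derivative_const S z]) (use assms(1) in simp)
    ultimately have "(\<lambda>h. 2 * Re (trace_gradient z * h)) = (\<lambda>h. 0)"
      by (rule has_derivative_unique)
    \<comment> \<open>At this argument the vanishing differential is twice the squared modulus of
      the gradient.\<close>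
    from fun_cong[OF this, of "cnj (trace_gradient z)"]
    show ?thesis unfolding complex_norm_square[symmetric] by simp
  qed
  then have "wirtinger \<i> trace_gradient w = wirtinger \<i> (\<lambda>w. 0) w"
    by (intro wirtinger_cong_open[OF S assms(2)]) simp
  then show "Re (wirtinger \<i> trace_gradient w) = 0"
    by (simp add: wirtinger_const)
qed

end

section \<open>Diagonal gauge transformations\<close>

lemma cscalar_prod_adjoint:
  fixes X :: "complex mat"
  assumes X: "X \<in> carrier_mat n n" and v: "u \<in> carrier_vec n" "v \<in> carrier_vec n"
  shows "(mat_adjoint X *\<^sub>v u) \<bullet>c v = u \<bullet>c (X *\<^sub>v v)"
proof -
  have "(mat_adjoint X *\<^sub>v u) \<bullet>c v = (\<Sum>i<n. \<Sum>j<n. cnj (X $$ (j, i)) * vec_index u j * cnj (vec_index v i))"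
    using X v by (auto simp: scalar_prod_def conjugate_complex_def atLeast0LessThan sum_distrib_right intro!: sum.cong)
  also have "\<dots> = (\<Sum>j<n. \<Sum>i<n. cnj (X $$ (j, i)) * vec_index u j * cnj (vec_index v i))"
    by (rule sum.swap)
  also have "\<dots> = u \<bullet>c (X *\<^sub>v v)"
    using X v by (auto simp: scalar_prod_def conjugate_complex_def atLeast0LessThan sum_distrib_left mult_ac intro!: sum.cong)
  finally show ?thesis .
qed

lemma pos_def_hermitian_congruence:
  assumes M: "pos_def_hermitian n M" and X: "X \<in> carrier_mat n n" "Y \<in> carrier_mat n n" "Y * X = 1\<^sub>m n"
  shows "pos_def_hermitian n (mat_adjoint X * M * X)"
  unfolding pos_def_hermitian_def
proof (intro conjI ballI impI)
  note MD = pos_def_hermitianD[OF M]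
  show "mat_adjoint X * M * X \<in> carrier_mat n n"
    using MD X by (simp add: sq_carrier[of _ n])
  show "mat_adjoint (mat_adjoint X * M * X) = mat_adjoint X * M * X"
    using MD X by (simp add: mat_adjoint_mult[of _ n n _ n] sq_carrier[of _ n] sq_assoc[of _ n])
  fix v :: "complex vec" assume v: "v \<in> carrier_vec n" "v \<noteq> 0\<^sub>v n"
  have Xv: "X *\<^sub>v v \<in> carrier_vec n" using X v by simp
  have "Y *\<^sub>v (X *\<^sub>v v) = v"
    using assoc_mult_mat_vec[OF X(2,1) v(1)] X(3) v(1) by simp
  moreover have "Y *\<^sub>v 0\<^sub>v n = 0\<^sub>v n"
    by (rule eq_vecI) (use X in auto)
  ultimately have "X *\<^sub>v v \<noteq> 0\<^sub>v n"
    using v(2) by auto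
  then have "Re ((M *\<^sub>v (X *\<^sub>v v)) \<bullet>c (X *\<^sub>v v)) > 0"
    by (rule MD(3)[OF Xv])
  moreover have "(mat_adjoint X * M * X) *\<^sub>v v = mat_adjoint X *\<^sub>v (M *\<^sub>v (X *\<^sub>v v))"
  proof -
    have "(mat_adjoint X * M * X) *\<^sub>v v = (mat_adjoint X * M) *\<^sub>v (X *\<^sub>v v)"
      by (rule assoc_mult_mat_vec[of _ n n _ n]) (use X MD(1) v in \<open>simp_all add: sq_carrier[of _ n]\<close>)
    also have "\<dots> = mat_adjoint X *\<^sub>v (M *\<^sub>v (X *\<^sub>v v))"
      by (rule assoc_mult_mat_vec[of _ n n _ n]) (use X MD(1) Xv in simp_all)
    finally show ?thesis .
  qed
  moreover have "(mat_adjoint X *\<^sub>v (M *\<^sub>v (X *\<^sub>v v))) \<bullet>c v = (M *\<^sub>v (X *\<^sub>v v)) \<bullet>c (X *\<^sub>v v)"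
    by (rule cscalar_prod_adjoint) (use X MD(1) v Xv in auto)
  ultimately show "Re (((mat_adjoint X * M * X) *\<^sub>v v) \<bullet>c v) > 0"
    by simp
qed

lemma pos_def_hermitian_inverse:
  assumes H: "pos_def_hermitian n H" and G: "G \<in> carrier_mat n n" "G * H = 1\<^sub>m n" "H * G = 1\<^sub>m n"
  shows "pos_def_hermitian n G"
proof -
  note HD = pos_def_hermitianD[OF H]
  have "mat_adjoint G = G"
    by (rule mat_adjoint_inverse[OF HD(1) G HD(2)])
  then have "mat_adjoint G * H * G = G"
    using G by simp
  then show ?thesis
    using pos_def_hermitian_congruence[OF H G(1) HD(1) G(3)] by simp
qed

lemma pos_def_hermitian_transpose:
  assumes M: "pos_def_hermitian n M"
  shows "pos_def_hermitian n (transpose_mat M)"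
  unfolding pos_def_hermitian_def
proof (intro conjI ballI impI)
  note MD = pos_def_hermitianD[OF M]
  show T: "transpose_mat M \<in> carrier_mat n n" using MD by simp
  show "mat_adjoint (transpose_mat M) = transpose_mat M"
    by (rule eq_matI) (use MD(1) pos_def_hermitian_cnj[OF M, symmetric] in auto)
  fix v :: "complex vec" assume v: "v \<in> carrier_vec n" "v \<noteq> 0\<^sub>v n"
  \<comment> \<open>The transpose of a Hermitian matrix is its conjugate, so its form at
    \<open>v\<close> is that of \<open>M\<close> at the conjugate vector.\<close>
  have w: "conjugate v \<in> carrier_vec n" "conjugate v \<noteq> 0\<^sub>v n"
    using v by (auto simp: conjugate_zero_iff_vec)
  have "(transpose_mat M *\<^sub>v v) \<bullet>c v = (\<Sum>i<n. \<Sum>j<n. cnj (vec_index v i) * M $$ (j, i) * vec_index v j)"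
    by (subst quadratic_form_index[OF T v(1)]) (use MD(1) in auto)
  also have "\<dots> = (\<Sum>j<n. \<Sum>i<n. cnj (vec_index v i) * M $$ (j, i) * vec_index v j)"
    by (rule sum.swap)
  also have "\<dots> = (M *\<^sub>v conjugate v) \<bullet>c conjugate v"
    by (subst quadratic_form_index[OF MD(1) w(1)])
       (use v(1) in \<open>auto simp: conjugate_complex_def mult_ac intro!: sum.cong\<close>)
  finally show "Re ((transpose_mat M *\<^sub>v v) \<bullet>c v) > 0"
    using MD(3)[OF w] by simp
qed

definition diag_of :: "nat \<Rightarrow> (nat \<Rightarrow> complex) \<Rightarrow> complex mat" where
  "diag_of n t = Matrix.mat n n (\<lambda>(a, b). if a = b then t a else 0)"

text \<open>The effect on the matrix of a Hermitian form of multiplying the frame vectors by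
  \<open>t\<close>. It serves as the transition rule for metrics on \<open>E\<close>, and for
  \<open>t\<close> of modulus one, where \<open>cnj (t a)\<close> is the inverse of
  \<open>t a\<close>, also as conjugation of endomorphisms by a diagonal gauge
  transformation.\<close>

definition twist :: "nat \<Rightarrow> (nat \<Rightarrow> complex) \<Rightarrow> complex mat \<Rightarrow> complex mat" where
  "twist n t X = Matrix.mat n n (\<lambda>(a, b). cnj (t a) * t b * X $$ (a, b))"

lemma diag_of_dim [simp]: "dim_row (diag_of n t) = n" "dim_col (diag_of n t) = n"
  by (simp_all add: diag_of_def)

lemma diag_of_carrier [simp]: "diag_of n t \<in> carrier_mat n n"
  by (simp add: diag_of_def)

lemma twist_dim [simp]: "dim_row (twist n t X) = n" "dim_col (twist n t X) = n"
  by (simp_all add: twist_def)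

lemma twist_carrier [simp]: "twist n t X \<in> carrier_mat n n"
  by (simp add: twist_def)

lemma twist_index [simp]: "a < n \<Longrightarrow> b < n \<Longrightarrow> twist n t X $$ (a, b) = cnj (t a) * t b * X $$ (a, b)"
  by (simp add: twist_def)

lemma diag_of_mult_index:
  assumes "X \<in> carrier_mat n n" "a < n" "b < n"
  shows "(diag_of n t * X) $$ (a, b) = t a * X $$ (a, b)" "(X * diag_of n t) $$ (a, b) = X $$ (a, b) * t b"
proof -
  have "(diag_of n t * X) $$ (a, b) = (\<Sum>k<n. if k = a then t a * X $$ (a, b) else 0)"
    by (subst mult_mat_index[of _ n n _ n])
       (simp, rule assms, rule assms, rule assms, intro sum.cong refl, use assms in \<open>auto simp: diag_of_def\<close>)
  then show "(diag_of n t * X) $$ (a, b) = t a * X $$ (a, b)" using assms by simp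
  have "(X * diag_of n t) $$ (a, b) = (\<Sum>k<n. if k = b then X $$ (a, b) * t b else 0)"
    by (subst mult_mat_index[of _ n n _ n])
       (rule assms, simp, rule assms, rule assms, intro sum.cong refl, use assms in \<open>auto simp: diag_of_def\<close>)
  then show "(X * diag_of n t) $$ (a, b) = X $$ (a, b) * t b" using assms by simp
qed

lemma twist_eq:
  assumes "X \<in> carrier_mat n n"
  shows "twist n t X = mat_adjoint (diag_of n t) * X * diag_of n t"
proof -
  have adj: "mat_adjoint (diag_of n t) = diag_of n (\<lambda>a. cnj (t a))"
    by (rule eq_matI) (auto simp: diag_of_def)
  have c: "diag_of n (\<lambda>a. cnj (t a)) * X \<in> carrier_mat n n"
    using assms by (simp add: sq_carrier[of _ n])
  show ?thesis unfolding adj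
    by (rule eq_matI)
       (use assms c in \<open>auto simp: diag_of_mult_index[OF c] diag_of_mult_index[OF assms] simp del: index_mult_mat(1)\<close>)
qed

lemma mat_wirtinger_twist:
  assumes "mat_differentiable n M w"
  shows "mat_wirtinger e n (\<lambda>u. twist n t (M u)) w = twist n t (mat_wirtinger e n M w)"
    and "mat_differentiable n (\<lambda>u. twist n t (M u)) w"
proof -
  show "mat_differentiable n (\<lambda>u. twist n t (M u)) w"
    using assms by (auto simp: mat_differentiable_def intro!: differentiable_mult)
  show "mat_wirtinger e n (\<lambda>u. twist n t (M u)) w = twist n t (mat_wirtinger e n M w)"
  proof (rule eq_matI)
    fix a b assume "a < dim_row (twist n t (mat_wirtinger e n M w))" "b < dim_col (twist n t (mat_wirtinger e n M w))"
    then have ab: "a < n" "b < n" by (auto simp: twist_def)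
    then show "mat_wirtinger e n (\<lambda>u. twist n t (M u)) w $$ (a, b) = twist n t (mat_wirtinger e n M w) $$ (a, b)"
      by (simp add: wirtinger_mult[OF differentiable_const mat_differentiableD[OF assms ab]] wirtinger_const)
  qed (simp_all add: twist_def)
qed

context
  fixes n :: nat and t :: "nat \<Rightarrow> complex"
  assumes t: "\<And>a. a < n \<Longrightarrow> cmod (t a) = 1"
begin

lemma unit_cnj: "a < n \<Longrightarrow> t a * cnj (t a) = 1" "a < n \<Longrightarrow> cnj (t a) * t a = 1"
  using t by (simp_all add: complex_norm_square[symmetric] mult.commute)

lemma diag_of_unitary: "mat_adjoint (diag_of n t) * diag_of n t = 1\<^sub>m n"
proof -
  have "mat_adjoint (diag_of n t) * diag_of n t = twist n t (1\<^sub>m n)"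
    by (simp add: twist_eq right_mult_one_mat[of _ n n])
  also have "\<dots> = 1\<^sub>m n"
    by (rule eq_matI) (auto simp: unit_cnj twist_def)
  finally show ?thesis .
qed

lemma twist_mult:
  assumes "X \<in> carrier_mat n n" "Y \<in> carrier_mat n n"
  shows "twist n t (X * Y) = twist n t X * twist n t Y"
proof (rule eq_matI)
  fix a b assume "a < dim_row (twist n t X * twist n t Y)" "b < dim_col (twist n t X * twist n t Y)"
  then have ab: "a < n" "b < n" by (auto simp: twist_def)
  have "(twist n t X * twist n t Y) $$ (a, b) = (\<Sum>k<n. twist n t X $$ (a, k) * twist n t Y $$ (k, b))"
    by (rule mult_mat_index[OF twist_carrier twist_carrier ab])
  also have "\<dots> = (\<Sum>k<n. cnj (t a) * t b * (X $$ (a, k) * Y $$ (k, b)))"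
  proof (rule sum.cong)
    fix k assume "k \<in> {..<n}"
    then have k: "k < n" by simp
    have "twist n t X $$ (a, k) * twist n t Y $$ (k, b) =
        (t k * cnj (t k)) * (cnj (t a) * t b * (X $$ (a, k) * Y $$ (k, b)))"
      using ab k by simp
    then show "twist n t X $$ (a, k) * twist n t Y $$ (k, b) = cnj (t a) * t b * (X $$ (a, k) * Y $$ (k, b))"
      unfolding unit_cnj[OF k] by simp
  qed simp
  also have "\<dots> = twist n t (X * Y) $$ (a, b)"
    using ab by (simp add: mult_mat_index[OF assms ab] sum_distrib_left del: index_mult_mat(1))
  finally show "twist n t (X * Y) $$ (a, b) = (twist n t X * twist n t Y) $$ (a, b)" by simp
qed (auto simp: twist_def)

lemma twist_one: "twist n t (1\<^sub>m n) = 1\<^sub>m n"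
  using diag_of_unitary by (simp add: twist_eq right_mult_one_mat[of _ n n])

lemma twist_diff:
  assumes "X \<in> carrier_mat n n" "Y \<in> carrier_mat n n"
  shows "twist n t (X - Y) = twist n t X - twist n t Y"
  by (rule eq_matI) (use assms in \<open>auto simp: twist_def algebra_simps\<close>)

lemma twist_adjoint:
  assumes "X \<in> carrier_mat n n"
  shows "twist n t (mat_adjoint X) = mat_adjoint (twist n t X)"
  by (rule eq_matI) (use assms in \<open>auto simp: twist_def\<close>)

lemma det_twist:
  assumes "X \<in> carrier_mat n n"
  shows "Determinant.det (twist n t X) = Determinant.det X"
proof -
  have "Determinant.det (mat_adjoint (diag_of n t)) * Determinant.det (diag_of n t) = 1"
    using arg_cong[OF diag_of_unitary, of Determinant.det] by (subst (asm) det_mult[of _ n]) auto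
  then show ?thesis
    unfolding twist_eq[OF assms] using assms
    by (subst det_mult[of _ n], simp add: sq_carrier[of _ n], simp, subst det_mult[of _ n]) (auto simp: mult_ac)
qed

text \<open>A constant unitary gauge transformation carries solutions for \<open>F\<close> to
  solutions for its conjugate \<open>\<mu> \<cdot>\<^sub>m F\<close>. The equation contains
  \<open>F\<close> together with its adjoint, so the unit scalar cancels.\<close>

lemma local_solution_twist:
  assumes H: "local_solution n S F H" and S: "open S"
    and F: "\<And>w. w \<in> S \<Longrightarrow> twist n t (F w) = \<mu> \<cdot>\<^sub>m F w" and \<mu>: "\<mu> * cnj \<mu> = 1"
  shows "local_solution n S F (\<lambda>w. twist n t (H w))"
  unfolding local_solution_def
proof (intro ballI conjI)
  note HD = local_solutionD[OF H]
  have inv: "mat_inv (twist n t (H w)) = twist n t (mat_inv (H w))" if "w \<in> S" for w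
    by (rule mat_inv_eqI[of _ n])
       (simp_all add: det_twist[OF HD(7)[OF that]] HD(3)[OF that]
          twist_mult[OF HD(8)[OF that] HD(7)[OF that], symmetric] HD(9)[OF that] twist_one)
  have dz: "mat_wirtinger e n (\<lambda>w. twist n t (H w)) w = twist n t (mat_wirtinger e n H w)" if "w \<in> S" for w e
    by (rule mat_wirtinger_twist(1)[OF HD(4)[OF that]])
  fix w assume w: "w \<in> S"
  show "F w \<in> carrier_mat n n" by (rule HD(1)[OF w])
  show "pos_def_hermitian n (twist n t (H w))"
    unfolding twist_eq[OF HD(7)[OF w]]
    by (rule pos_def_hermitian_congruence[OF HD(2)[OF w] _ _ diag_of_unitary]) simp_all
  show "Determinant.det (twist n t (H w)) = 1"
    by (simp add: det_twist[OF HD(7)[OF w]] HD(3)[OF w])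
  show "mat_differentiable n (\<lambda>w. twist n t (H w)) w"
    by (rule mat_wirtinger_twist(2)[OF HD(4)[OF w]])
  show "mat_differentiable n (mat_wirtinger (- \<i>) n (\<lambda>w. twist n t (H w))) w"
    by (subst mat_wirtinger_cong_open(2)[OF S w dz]) (simp, rule mat_wirtinger_twist(2)[OF HD(5)[OF w]])
  have "mat_differentiable n (\<lambda>u. mat_inv (H u) * mat_wirtinger (- \<i>) n H u) w"
    by (rule mat_differentiable_mult[OF S w HD(8) _ mat_differentiable_inv[OF S w HD(7,3,4)] HD(5)[OF w]])
       (use w in simp_all)
  then have "mat_wirtinger \<i> n (\<lambda>u. twist n t (mat_inv (H u) * mat_wirtinger (- \<i>) n H u)) w =
      twist n t (mat_wirtinger \<i> n (\<lambda>u. mat_inv (H u) * mat_wirtinger (- \<i>) n H u) w)"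
    by (rule mat_wirtinger_twist(1))
  moreover have "mat_wirtinger \<i> n (\<lambda>u. mat_inv (twist n t (H u)) * mat_wirtinger (- \<i>) n (\<lambda>w. twist n t (H w)) u) w =
      mat_wirtinger \<i> n (\<lambda>u. twist n t (mat_inv (H u) * mat_wirtinger (- \<i>) n H u)) w"
    by (rule mat_wirtinger_cong_open(1)[OF S w]) (simp add: inv dz twist_mult[OF HD(8)])
  moreover have "twist n t (F w * metric_adjoint (H w) (F w) - metric_adjoint (H w) (F w) * F w) =
      F w * metric_adjoint (twist n t (H w)) (F w) - metric_adjoint (twist n t (H w)) (F w) * F w"
  proof -
    note c = HD(1,7,8)[OF w]
    define X where "X = metric_adjoint (H w) (F w)"
    have X: "X \<in> carrier_mat n n"
      unfolding X_def metric_adjoint_def using c by (simp add: sq_carrier[of _ n])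
    have "twist n t (mat_adjoint (F w)) = cnj \<mu> \<cdot>\<^sub>m mat_adjoint (F w)"
      unfolding twist_adjoint[OF c(1)] F[OF w] by (rule eq_matI) auto
    \<comment> \<open>This shifts the scalar from the Higgs field to its adjoint, so that
      \<open>F\<close> itself is kept in the new equation.\<close>
    then have "\<mu> \<cdot>\<^sub>m twist n t (mat_adjoint (F w)) = mat_adjoint (F w)"
      using \<mu> by (intro eq_matI) (auto simp flip: mult.assoc)
    then have "metric_adjoint (twist n t (H w)) (F w) =
        twist n t (mat_inv (H w)) * (\<mu> \<cdot>\<^sub>m twist n t (mat_adjoint (F w))) * twist n t (H w)"
      by (simp add: metric_adjoint_def inv[OF w])
    also have "\<dots> = \<mu> \<cdot>\<^sub>m (twist n t (mat_inv (H w)) * twist n t (mat_adjoint (F w)) * twist n t (H w))"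
      by (simp add: mult_smult_distrib[of _ n n _ n] mult_smult_assoc_mat[of _ n n _ n] sq_carrier[of _ n])
    also have "\<dots> = \<mu> \<cdot>\<^sub>m twist n t X"
      unfolding X_def metric_adjoint_def using c by (simp add: twist_mult sq_carrier[of _ n] sq_assoc[of _ n])
    finally have eq: "metric_adjoint (twist n t (H w)) (F w) = \<mu> \<cdot>\<^sub>m twist n t X" .
    have "twist n t (F w * X - X * F w) = twist n t (F w) * twist n t X - twist n t X * twist n t (F w)"
      using c(1) X by (simp add: twist_diff twist_mult sq_carrier[of _ n])
    also have "\<dots> = F w * (\<mu> \<cdot>\<^sub>m twist n t X) - (\<mu> \<cdot>\<^sub>m twist n t X) * F w"
      unfolding F[OF w] using c(1)
      by (simp add: mult_smult_distrib[of _ n n _ n] mult_smult_assoc_mat[of _ n n _ n])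
    finally show ?thesis by (simp add: eq X_def)
  qed
  ultimately show "mat_wirtinger \<i> n (\<lambda>u. mat_inv (twist n t (H u)) * mat_wirtinger (- \<i>) n (\<lambda>w. twist n t (H w)) u) w =
      F w * metric_adjoint (twist n t (H w)) (F w) - metric_adjoint (twist n t (H w)) (F w) * F w"
    by (simp add: HD(6)[OF w])
qed

end

section \<open>Reflection in the antidiagonal\<close>

text \<open>The summands numbered \<open>a\<close> and \<open>n - 1 - a\<close> are dual to each
  other, so \<open>E\<close> is its own dual with the order of the summands reversed. Under this
  identification the map is the transpose.\<close>

definition anti_transpose :: "nat \<Rightarrow> complex mat \<Rightarrow> complex mat" where
  "anti_transpose n X = Matrix.mat n n (\<lambda>(a, b). X $$ (n - 1 - b, n - 1 - a))"

definition anti_diag :: "nat \<Rightarrow> complex mat" where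
  "anti_diag n = Matrix.mat n n (\<lambda>(a, b). if b = n - 1 - a then 1 else 0)"

lemma anti_transpose_dim [simp]: "dim_row (anti_transpose n X) = n" "dim_col (anti_transpose n X) = n"
  by (simp_all add: anti_transpose_def)

lemma anti_transpose_carrier [simp]: "anti_transpose n X \<in> carrier_mat n n"
  by (simp add: anti_transpose_def)

lemma anti_transpose_index [simp]:
  "a < n \<Longrightarrow> b < n \<Longrightarrow> anti_transpose n X $$ (a, b) = X $$ (n - 1 - b, n - 1 - a)"
  by (simp add: anti_transpose_def)

lemma anti_transpose_mult:
  assumes "X \<in> carrier_mat n n" "Y \<in> carrier_mat n n"
  shows "anti_transpose n (X * Y) = anti_transpose n Y * anti_transpose n X"
proof (rule eq_matI)
  fix a b assume "a < dim_row (anti_transpose n Y * anti_transpose n X)" "b < dim_col (anti_transpose n Y * anti_transpose n X)"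
  then have ab: "a < n" "b < n" by (auto simp: anti_transpose_def)
  have "(X * Y) $$ (n - 1 - b, n - 1 - a) = (\<Sum>k<n. X $$ (n - 1 - b, k) * Y $$ (k, n - 1 - a))"
    by (rule mult_mat_index[OF assms]) (use ab in auto)
  also have "\<dots> = (\<Sum>k<n. X $$ (n - 1 - b, n - Suc k) * Y $$ (n - Suc k, n - 1 - a))"
    by (rule sum.nat_diff_reindex[symmetric])
  also have "\<dots> = (\<Sum>k<n. anti_transpose n Y $$ (a, k) * anti_transpose n X $$ (k, b))"
    by (rule sum.cong) (use ab in auto)
  also have "\<dots> = (anti_transpose n Y * anti_transpose n X) $$ (a, b)"
    by (rule mult_mat_index[OF anti_transpose_carrier anti_transpose_carrier ab, symmetric])
  finally show "anti_transpose n (X * Y) $$ (a, b) = (anti_transpose n Y * anti_transpose n X) $$ (a, b)"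
    using ab by simp
qed (auto simp: anti_transpose_def)

lemma anti_transpose_one: "anti_transpose n (1\<^sub>m n) = 1\<^sub>m n"
  by (rule eq_matI) (auto simp: anti_transpose_def)

lemma anti_transpose_diff:
  assumes "X \<in> carrier_mat n n" "Y \<in> carrier_mat n n"
  shows "anti_transpose n (X - Y) = anti_transpose n X - anti_transpose n Y"
  by (rule eq_matI) (use assms in \<open>auto simp: anti_transpose_def\<close>)

lemma anti_transpose_uminus:
  assumes "X \<in> carrier_mat n n"
  shows "anti_transpose n (- X) = - anti_transpose n X"
  by (rule eq_matI) (use assms in \<open>auto simp: anti_transpose_def\<close>)

lemma anti_transpose_adjoint:
  assumes "X \<in> carrier_mat n n"
  shows "anti_transpose n (mat_adjoint X) = mat_adjoint (anti_transpose n X)"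
  by (rule eq_matI) (use assms in \<open>auto simp: anti_transpose_def\<close>)

lemma anti_diag_dim [simp]: "dim_row (anti_diag n) = n" "dim_col (anti_diag n) = n"
  by (simp_all add: anti_diag_def)

lemma anti_diag_carrier [simp]: "anti_diag n \<in> carrier_mat n n"
  by (simp add: anti_diag_def)

lemma anti_diag_adjoint: "mat_adjoint (anti_diag n) = anti_diag n"
  by (rule eq_matI) (auto simp: anti_diag_def)

lemma anti_diag_mult_index:
  assumes "X \<in> carrier_mat n n" "a < n" "b < n"
  shows "(anti_diag n * X) $$ (a, b) = X $$ (n - 1 - a, b)" "(X * anti_diag n) $$ (a, b) = X $$ (a, n - 1 - b)"
proof -
  have "(anti_diag n * X) $$ (a, b) = (\<Sum>k<n. if k = n - 1 - a then X $$ (n - 1 - a, b) else 0)"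
    by (subst mult_mat_index[of _ n n _ n])
       (simp, rule assms, rule assms, rule assms, intro sum.cong refl, use assms in \<open>auto simp: anti_diag_def\<close>)
  then show "(anti_diag n * X) $$ (a, b) = X $$ (n - 1 - a, b)" using assms by simp
  have "(X * anti_diag n) $$ (a, b) = (\<Sum>k<n. if k = n - 1 - b then X $$ (a, n - 1 - b) else 0)"
    by (subst mult_mat_index[of _ n n _ n])
       (rule assms, simp, rule assms, rule assms, intro sum.cong refl, use assms in \<open>auto simp: anti_diag_def\<close>)
  then show "(X * anti_diag n) $$ (a, b) = X $$ (a, n - 1 - b)" using assms by simp
qed

text \<open>Written as a congruence of the transpose, the reflection visibly preserves positivity
  and determinants.\<close>

lemma anti_transpose_eq:
  assumes "X \<in> carrier_mat n n"
  shows "anti_transpose n X = mat_adjoint (anti_diag n) * transpose_mat X * anti_diag n"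
proof -
  have t: "transpose_mat X \<in> carrier_mat n n" using assms by simp
  have c: "anti_diag n * transpose_mat X \<in> carrier_mat n n"
    using assms by (simp add: sq_carrier[of _ n])
  show ?thesis unfolding anti_diag_adjoint
  proof (rule eq_matI)
    fix a b assume "a < dim_row (anti_diag n * transpose_mat X * anti_diag n)" "b < dim_col (anti_diag n * transpose_mat X * anti_diag n)"
    then have ab: "a < n" "b < n" by (auto simp: anti_diag_def)
    then have b: "n - 1 - b < n" by simp
    show "anti_transpose n X $$ (a, b) = (anti_diag n * transpose_mat X * anti_diag n) $$ (a, b)"
      unfolding anti_diag_mult_index(2)[OF c ab] anti_diag_mult_index(1)[OF t ab(1) b]
      using ab assms by simp
  qed (auto simp: anti_transpose_def anti_diag_def)
qed

lemma anti_diag_square: "anti_diag n * anti_diag n = 1\<^sub>m n"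
proof (rule eq_matI)
  fix a b assume "a < dim_row (1\<^sub>m n :: complex mat)" "b < dim_col (1\<^sub>m n :: complex mat)"
  then have ab: "a < n" "b < n" by auto
  show "(anti_diag n * anti_diag n) $$ (a, b) = 1\<^sub>m n $$ (a, b)"
    unfolding anti_diag_mult_index(1)[OF anti_diag_carrier ab] using ab by (auto simp: anti_diag_def)
qed (auto simp: anti_diag_def)

lemma det_anti_transpose:
  assumes "X \<in> carrier_mat n n"
  shows "Determinant.det (anti_transpose n X) = Determinant.det X"
proof -
  have "Determinant.det (anti_diag n) * Determinant.det (anti_diag n) = 1"
    using arg_cong[OF anti_diag_square[of n], of Determinant.det] by (subst (asm) det_mult[of _ n]) auto
  then show ?thesis
    unfolding anti_transpose_eq[OF assms] anti_diag_adjoint using assms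
    by (subst det_mult[of _ n], simp add: sq_carrier[of _ n], simp, subst det_mult[of _ n]) (auto simp: mult_ac det_transpose[OF assms])
qed

lemma mat_wirtinger_anti_transpose:
  "mat_wirtinger e n (\<lambda>u. anti_transpose n (M u)) w = anti_transpose n (mat_wirtinger e n M w)"
  "mat_differentiable n M w \<Longrightarrow> mat_differentiable n (\<lambda>u. anti_transpose n (M u)) w"
  by (rule eq_matI) (auto simp: anti_transpose_def mat_wirtinger_def mat_differentiable_def)

text \<open>The anti-transpose is an anti-automorphism fixing the Higgs field, so it turns the metric
  induced by \<open>H\<close> on the dual bundle into another solution.\<close>

lemma local_solution_dual:
  assumes H: "local_solution n S F H" and S: "open S"
    and F: "\<And>w. w \<in> S \<Longrightarrow> anti_transpose n (F w) = F w"
  shows "local_solution n S F (\<lambda>w. anti_transpose n (mat_inv (H w)))"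
  unfolding local_solution_def
proof (intro ballI conjI)
  note HD = local_solutionD[OF H]
  define \<theta> where "\<theta> = (\<lambda>u. mat_inv (H u) * mat_wirtinger (- \<i>) n H u)"
  have det: "Determinant.det (anti_transpose n (mat_inv (H w))) = 1" if w: "w \<in> S" for w
  proof -
    have "Determinant.det (mat_inv (H w)) * Determinant.det (H w) = 1"
      unfolding det_mult[OF HD(8,7)[OF w], symmetric] HD(9)[OF w] by simp
    then show ?thesis by (simp add: det_anti_transpose[OF HD(8)[OF w]] HD(3)[OF w])
  qed
  have inv: "mat_inv (anti_transpose n (mat_inv (H w))) = anti_transpose n (H w)" if w: "w \<in> S" for w
    by (rule mat_inv_eqI[of _ n])
       (simp_all add: det[OF w] anti_transpose_mult[OF HD(8)[OF w] HD(7)[OF w], symmetric] HD(9)[OF w] anti_transpose_one)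
  have diff_inv: "mat_differentiable n (\<lambda>u. mat_inv (H u)) w" if w: "w \<in> S" for w
    by (rule mat_differentiable_inv[OF S w HD(7,3,4)]) (use w in simp_all)
  have diff_\<theta>: "mat_differentiable n \<theta> w" if w: "w \<in> S" for w
    unfolding \<theta>_def by (rule mat_differentiable_mult[OF S w HD(8) _ diff_inv[OF w] HD(5)[OF w]]) simp_all
  have \<theta>: "\<theta> w \<in> carrier_mat n n" if w: "w \<in> S" for w
    unfolding \<theta>_def using HD(8)[OF w] by (simp add: sq_carrier[of _ n])
  have dz: "mat_wirtinger (- \<i>) n (\<lambda>w. anti_transpose n (mat_inv (H w))) w =
      - (anti_transpose n (\<theta> w * mat_inv (H w)))" if w: "w \<in> S" for w
    unfolding mat_wirtinger_anti_transpose \<theta>_def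
    by (subst mat_wirtinger_inv[OF S w HD(7,3,4)[of _]])
       (use w HD(8)[OF w] in \<open>simp_all add: anti_transpose_uminus sq_carrier[of _ n]\<close>)
  fix w assume w: "w \<in> S"
  note c = HD(1,7,8)[OF w]
  show "F w \<in> carrier_mat n n" by (rule c(1))
  show "pos_def_hermitian n (anti_transpose n (mat_inv (H w)))"
    unfolding anti_transpose_eq[OF c(3)]
    by (rule pos_def_hermitian_congruence[OF pos_def_hermitian_transpose[OF pos_def_hermitian_inverse[OF HD(2,8-10)[OF w]]]
          _ _ anti_diag_square]) simp_all
  show "Determinant.det (anti_transpose n (mat_inv (H w))) = 1" by (rule det[OF w])
  show "mat_differentiable n (\<lambda>w. anti_transpose n (mat_inv (H w))) w"
    by (rule mat_wirtinger_anti_transpose(2)[OF diff_inv[OF w]])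
  have "mat_differentiable n (\<lambda>u. \<theta> u * mat_inv (H u)) w"
    by (rule mat_differentiable_mult[OF S w \<theta> HD(8) diff_\<theta>[OF w] diff_inv[OF w]])
  then have "mat_differentiable n (\<lambda>u. anti_transpose n (\<theta> u * mat_inv (H u))) w"
    by (rule mat_wirtinger_anti_transpose(2))
  then have "mat_differentiable n (\<lambda>u. - (anti_transpose n (\<theta> u * mat_inv (H u)))) w"
    by (auto simp: mat_differentiable_def anti_transpose_def intro!: differentiable_minus)
  then show "mat_differentiable n (mat_wirtinger (- \<i>) n (\<lambda>w. anti_transpose n (mat_inv (H w)))) w"
    by (subst mat_wirtinger_cong_open(2)[OF S w dz])
  \<comment> \<open>The connection form of the dual metric is minus the transpose of the original
    one, as for any dual connection.\<close>
  have "mat_inv (anti_transpose n (mat_inv (H u))) * mat_wirtinger (- \<i>) n (\<lambda>w. anti_transpose n (mat_inv (H w))) u =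
      anti_transpose n (- \<theta> u)" if u: "u \<in> S" for u
  proof -
    have "mat_inv (anti_transpose n (mat_inv (H u))) * mat_wirtinger (- \<i>) n (\<lambda>w. anti_transpose n (mat_inv (H w))) u =
        - (anti_transpose n (H u) * anti_transpose n (\<theta> u * mat_inv (H u)))"
      unfolding dz[OF u] inv[OF u] by (subst uminus_mult_right_mat) (simp_all add: anti_transpose_def)
    also have "anti_transpose n (H u) * anti_transpose n (\<theta> u * mat_inv (H u)) = anti_transpose n (\<theta> u * mat_inv (H u) * H u)"
      by (rule anti_transpose_mult[symmetric]) (use \<theta>[OF u] HD(7,8)[OF u] in \<open>simp_all add: sq_carrier[of _ n]\<close>)
    also have "\<theta> u * mat_inv (H u) * H u = \<theta> u"
      using \<theta>[OF u] HD(7-9)[OF u] by simp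
    finally show ?thesis using \<theta>[OF u] by (simp add: anti_transpose_uminus)
  qed
  then have "mat_wirtinger \<i> n (\<lambda>u. mat_inv (anti_transpose n (mat_inv (H u))) * mat_wirtinger (- \<i>) n (\<lambda>w. anti_transpose n (mat_inv (H w))) u) w
    = mat_wirtinger \<i> n (\<lambda>u. anti_transpose n (- \<theta> u)) w"
    by (rule mat_wirtinger_cong_open(1)[OF S w])
  also have "\<dots> = anti_transpose n (mat_wirtinger \<i> n (\<lambda>u. - \<theta> u) w)"
    by (rule mat_wirtinger_anti_transpose)
  also have "mat_wirtinger \<i> n (\<lambda>u. - \<theta> u) w = - mat_wirtinger \<i> n \<theta> w"
  proof (rule eq_matI)
    fix a b assume "a < dim_row (- mat_wirtinger \<i> n \<theta> w)" "b < dim_col (- mat_wirtinger \<i> n \<theta> w)"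
    then have ab: "a < n" "b < n" by auto
    have "wirtinger \<i> (\<lambda>u. (- \<theta> u) $$ (a, b)) w = wirtinger \<i> (\<lambda>u. (-1) * \<theta> u $$ (a, b)) w"
      by (rule wirtinger_cong_open[OF S w]) (use ab \<theta> in \<open>auto dest!: \<theta>\<close>)
    also have "\<dots> = - wirtinger \<i> (\<lambda>u. \<theta> u $$ (a, b)) w"
      by (subst wirtinger_mult[OF differentiable_const mat_differentiableD[OF diff_\<theta>[OF w] ab]]) (simp add: wirtinger_const)
    finally show "mat_wirtinger \<i> n (\<lambda>u. - \<theta> u) w $$ (a, b) = (- mat_wirtinger \<i> n \<theta> w) $$ (a, b)"
      using ab by simp
  qed simp_all
  also have "mat_wirtinger \<i> n \<theta> w = F w * metric_adjoint (H w) (F w) - metric_adjoint (H w) (F w) * F w"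
    unfolding \<theta>_def by (rule HD(6)[OF w])
  also have "anti_transpose n (- (F w * metric_adjoint (H w) (F w) - metric_adjoint (H w) (F w) * F w)) =
     F w * metric_adjoint (anti_transpose n (mat_inv (H w))) (F w) - metric_adjoint (anti_transpose n (mat_inv (H w))) (F w) * F w"
  proof -
    define X where "X = metric_adjoint (H w) (F w)"
    have X: "X \<in> carrier_mat n n"
      unfolding X_def metric_adjoint_def using c by (simp add: sq_carrier[of _ n])
    have "metric_adjoint (anti_transpose n (mat_inv (H w))) (F w) =
        anti_transpose n (H w) * mat_adjoint (anti_transpose n (F w)) * anti_transpose n (mat_inv (H w))"
      by (simp add: metric_adjoint_def inv[OF w] F[OF w])
    also have "\<dots> = anti_transpose n X"
      unfolding X_def metric_adjoint_def using c
      by (simp add: anti_transpose_adjoint[symmetric] anti_transpose_mult sq_carrier[of _ n] sq_assoc[of _ n])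
    finally have eq: "metric_adjoint (anti_transpose n (mat_inv (H w))) (F w) = anti_transpose n X" .
    \<comment> \<open>An anti-automorphism reverses commutators, which cancels the minus sign of the
      dual connection.\<close>
    have "- (F w * X - X * F w) = X * F w - F w * X"
      by (rule eq_matI) (use c X in auto)
    moreover have "anti_transpose n (X * F w - F w * X) = F w * anti_transpose n X - anti_transpose n X * F w"
      using c X F[OF w] by (simp add: anti_transpose_diff anti_transpose_mult sq_carrier[of _ n])
    ultimately show ?thesis by (simp add: eq X_def)
  qed
  finally show "mat_wirtinger \<i> n (\<lambda>u. mat_inv (anti_transpose n (mat_inv (H u))) * mat_wirtinger (- \<i>) n (\<lambda>w. anti_transpose n (mat_inv (H w))) u) w
    = F w * metric_adjoint (anti_transpose n (mat_inv (H w))) (F w) - metric_adjoint (anti_transpose n (mat_inv (H w))) (F w) * F w" .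
qed

section \<open>Uniqueness of harmonic metrics\<close>

text \<open>A class of metrics in which uniqueness can be applied to the twisted and the dual metric
  without discussing their smoothness.\<close>

definition global_solution ::
  "'a chart set \<Rightarrow> ('a chart \<Rightarrow> 'a chart \<Rightarrow> 'a \<Rightarrow> complex) \<Rightarrow> nat \<Rightarrow>
   ('a chart \<Rightarrow> 'a \<Rightarrow> complex mat) \<Rightarrow> ('a chart \<Rightarrow> 'a \<Rightarrow> complex mat) \<Rightarrow> bool" where
  "global_solution A \<xi> n \<Phi> H \<longleftrightarrow>
     (\<forall>c\<in>A. local_solution n (snd c ` fst c) (\<Phi> c \<circ> chart_inv c) (H c \<circ> chart_inv c)) \<and>
     (\<forall>c\<in>A. \<forall>d\<in>A. \<forall>p \<in> fst c \<inter> fst d.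
        H d p = twist n (\<lambda>a. \<xi> c d p powi weight n a) (H c p))"

lemma harmonic_global_solution:
  fixes A :: "('a::t2_space) chart set"
  assumes A: "closed_riemann_surface A" and H: "harmonic_metric A \<xi> n \<Phi> H"
    and \<Phi>: "\<And>c p. \<Phi> c p \<in> carrier_mat n n"
  shows "global_solution A \<xi> n \<Phi> H"
  unfolding global_solution_def
proof (intro conjI ballI)
  note S = closed_riemann_surfaceD[OF A]
  have met: "hermitian_metric A \<xi> n H" and det: "induces_trivial_det_metric A H"
    and eqn: "hitchin_equation A n \<Phi> H"
    using H by (auto simp: harmonic_metric_def)
  have pos: "pos_def_hermitian n (H c p)" if "c \<in> A" "p \<in> fst c" for c p
    using met that unfolding hermitian_metric_def by blast
  show "H d p = twist n (\<lambda>a. \<xi> c d p powi weight n a) (H c p)"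
    if "c \<in> A" "d \<in> A" "p \<in> fst c \<inter> fst d" for c d p
  proof (rule eq_matI)
    show "dim_row (H d p) = dim_row (twist n (\<lambda>a. \<xi> c d p powi weight n a) (H c p))"
      "dim_col (H d p) = dim_col (twist n (\<lambda>a. \<xi> c d p powi weight n a) (H c p))"
      using pos_def_hermitianD(1)[OF pos, of d p] that by auto
    fix a b assume "a < dim_row (twist n (\<lambda>a. \<xi> c d p powi weight n a) (H c p))"
      "b < dim_col (twist n (\<lambda>a. \<xi> c d p powi weight n a) (H c p))"
    then have ab: "a < n" "b < n" by auto
    then have "H d p $$ (a, b) =
        cnj (\<xi> c d p powi weight n a) * (\<xi> c d p powi weight n b) * H c p $$ (a, b)"
      using met that unfolding hermitian_metric_def by blast
    then show "H d p $$ (a, b) = twist n (\<lambda>a. \<xi> c d p powi weight n a) (H c p) $$ (a, b)"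
      by (simp only: twist_index[OF ab])
  qed
  fix c assume c: "c \<in> A"
  let ?S = "snd c ` fst c" and ?H = "H c \<circ> chart_inv c" and ?F = "\<Phi> c \<circ> chart_inv c"
  show "local_solution n ?S ?F ?H"
    unfolding local_solution_def
  proof (intro ballI conjI)
    fix w assume w: "w \<in> ?S"
    then obtain p where p: "p \<in> fst c" "w = snd c p" by blast
    have pw: "chart_inv c w = p" using S(7)[OF c p(1)] p(2) by simp
    show "?F w \<in> carrier_mat n n" using \<Phi> by simp
    show "pos_def_hermitian n (?H w)" using pos[OF c p(1)] pw by simp
    show "Determinant.det (?H w) = 1"
      using det c p(1) pw by (simp add: induces_trivial_det_metric_def)
    have smooth: "C_k k (\<lambda>u. ?H u $$ (a, b)) ?S" if "a < n" "b < n" for a b k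
    proof -
      have "smooth_in_chart c (\<lambda>p. H c p $$ (a, b))"
        using met c that unfolding hermitian_metric_def by blast
      then show ?thesis by (simp add: smooth_in_chart_def comp_def)
    qed
    show "mat_differentiable n ?H w"
      unfolding mat_differentiable_def
    proof (intro allI impI)
      fix a b assume "a < n" "b < n"
      then show "(\<lambda>u. ?H u $$ (a, b)) differentiable (at w)"
        using smooth[of a b "Suc 0"] w unfolding C_k.simps by blast
    qed
    show "mat_differentiable n (mat_wirtinger (- \<i>) n ?H) w"
      unfolding mat_differentiable_def
    proof (intro allI impI)
      fix a b assume ab: "a < n" "b < n"
      let ?f = "\<lambda>u. ?H u $$ (a, b)"
      have "(\<lambda>u. frechet_derivative ?f (at u) 1) differentiable (at w)"
        "(\<lambda>u. frechet_derivative ?f (at u) \<i>) differentiable (at w)"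
        using smooth[OF ab, of "Suc (Suc 0)"] w unfolding C_k.simps by blast+
      then have "(\<lambda>u. (1 / 2) * (frechet_derivative ?f (at u) 1 + (- \<i>) * frechet_derivative ?f (at u) \<i>)) differentiable (at w)"
        by (intro differentiable_mult differentiable_add differentiable_const)
      then show "(\<lambda>u. mat_wirtinger (- \<i>) n ?H u $$ (a, b)) differentiable (at w)"
        using ab by (simp add: wirtinger_def)
    qed
    let ?M = "mat_wirtinger \<i> n (\<lambda>u. mat_inv (?H u) * mat_wirtinger (- \<i>) n ?H u) w"
    let ?X = "?F w * metric_adjoint (?H w) (?F w) - metric_adjoint (?H w) (?F w) * ?F w"
    have curvature: "chern_curvature n ?H w = - ?M"
      by (simp add: chern_curvature_def chern_form_def[abs_def] mat_wirtinger_def d_z_wirtinger d_zbar_wirtinger)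
    have "chern_curvature n ?H (snd c p) + (\<Phi> c p * metric_adjoint (H c p) (\<Phi> c p)
        - metric_adjoint (H c p) (\<Phi> c p) * \<Phi> c p) = 0\<^sub>m n n"
      using eqn c p(1) unfolding hitchin_equation_def by blast
    then have sum: "- ?M + ?X = 0\<^sub>m n n"
      unfolding p(2)[symmetric] curvature using pw by (simp only: o_apply)
    \<comment> \<open>The dimensions of a sum are those of its second summand, so they can be read
      off from the zero matrix.\<close>
    have X: "?X \<in> carrier_mat n n"
    proof -
      have "dim_row ?X = n" "dim_col ?X = n"
        using arg_cong[OF sum, of dim_row] arg_cong[OF sum, of dim_col] by (simp_all only: index_add_mat index_zero_mat)
      then show ?thesis by auto
    qed
    then have "?X - ?M = 0\<^sub>m n n"
      using sum by (subst uminus_add_mat[symmetric]) simp_all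
    from diff_zero_mat_eq[OF X _ this] show "?M = ?X" by simp
  qed
qed

section \<open>Change of frame, and traces as global functions\<close>

lemma twist_inverse:
  assumes X: "X \<in> carrier_mat n n" "Determinant.det X = 1" "Determinant.det (twist n t X) = 1"
  shows "mat_inv X = diag_of n t * mat_inv (twist n t X) * mat_adjoint (diag_of n t)"
proof -
  define D G where "D = diag_of n t" and "G = mat_inv (twist n t X)"
  have c: "D \<in> carrier_mat n n" "G \<in> carrier_mat n n" "mat_adjoint D \<in> carrier_mat n n"
    using mat_inv_carrier[OF twist_carrier X(3)] by (simp_all add: D_def G_def)
  have "G * (mat_adjoint D * X * D) = 1\<^sub>m n"
    unfolding D_def G_def twist_eq[OF X(1), symmetric] by (rule mat_inv_left[OF twist_carrier X(3)])
  then have "(G * (mat_adjoint D * X)) * D = 1\<^sub>m n"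
    using c X(1) by (simp add: sq_carrier[of _ n] sq_assoc[of _ n])
  \<comment> \<open>A one-sided inverse of a square matrix is two-sided. This makes the diagonal
    factor invertible for every \<open>t\<close> at hand, of modulus one or not, as transition
    functions require.\<close>
  then have "D * (G * (mat_adjoint D * X)) = 1\<^sub>m n"
    by (rule mat_mult_left_right_inverse[rotated 2]) (use c X(1) in \<open>simp_all add: sq_carrier[of _ n]\<close>)
  then have "D * G * mat_adjoint D * X = 1\<^sub>m n"
    using c X(1) by (simp add: sq_carrier[of _ n] sq_assoc[of _ n])
  then show ?thesis
    unfolding D_def[symmetric] G_def[symmetric]
    by (intro mat_inv_eqI[OF X(1,2)]) (use c in \<open>simp_all add: sq_carrier[of _ n]\<close>)
qed

text \<open>A change of frame conjugates the endomorphism \<open>mat_inv X * Y\<close>, so its trace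
  does not depend on the chart.\<close>

lemma mtrace_twist:
  assumes X: "X \<in> carrier_mat n n" "Determinant.det X = 1" "Determinant.det (twist n t X) = 1"
    and Y: "Y \<in> carrier_mat n n"
  shows "mtrace (mat_inv (twist n t X) * twist n t Y) = mtrace (mat_inv X * Y)"
proof -
  define D G where "D = diag_of n t" and "G = mat_inv (twist n t X)"
  have c: "D \<in> carrier_mat n n" "G \<in> carrier_mat n n" "mat_adjoint D \<in> carrier_mat n n"
    using mat_inv_carrier[OF twist_carrier X(3)] by (simp_all add: D_def G_def)
  have "mtrace (G * twist n t Y) = mtrace ((G * (mat_adjoint D * Y)) * D)"
    unfolding twist_eq[OF Y] D_def[symmetric] using c Y by (simp add: sq_carrier[of _ n] sq_assoc[of _ n])
  also have "\<dots> = mtrace (D * (G * (mat_adjoint D * Y)))"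
    by (rule mtrace_comm[of _ n n]) (use c Y in \<open>simp_all add: sq_carrier[of _ n]\<close>)
  also have "\<dots> = mtrace (mat_inv X * Y)"
    unfolding twist_inverse[OF X] D_def[symmetric] G_def[symmetric]
    using c Y by (simp add: sq_carrier[of _ n] sq_assoc[of _ n])
  finally show ?thesis by (simp add: G_def)
qed

context
  fixes A :: "('a::t2_space) chart set" and \<xi> n \<Phi> H
  assumes A: "closed_riemann_surface A" and H: "global_solution A \<xi> n \<Phi> H"
begin

lemma global_solutionD:
  assumes "c \<in> A" "p \<in> fst c"
  shows "\<Phi> c p \<in> carrier_mat n n" "pos_def_hermitian n (H c p)" "Determinant.det (H c p) = 1"
    and "H c p \<in> carrier_mat n n" "mat_inv (H c p) \<in> carrier_mat n n"
    "mat_inv (H c p) * H c p = 1\<^sub>m n" "H c p * mat_inv (H c p) = 1\<^sub>m n"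
proof -
  have "local_solution n (snd c ` fst c) (\<Phi> c \<circ> chart_inv c) (H c \<circ> chart_inv c)"
    using H assms unfolding global_solution_def by blast
  note D = local_solutionD[OF this imageI[OF assms(2)]]
  show "\<Phi> c p \<in> carrier_mat n n" "pos_def_hermitian n (H c p)" "Determinant.det (H c p) = 1"
    "H c p \<in> carrier_mat n n" "mat_inv (H c p) \<in> carrier_mat n n"
    "mat_inv (H c p) * H c p = 1\<^sub>m n" "H c p * mat_inv (H c p) = 1\<^sub>m n"
    using D(1-3,7-10) closed_riemann_surfaceD(7)[OF A assms] by simp_all
qed

lemma global_solution_local:
  "c \<in> A \<Longrightarrow> local_solution n (snd c ` fst c) (\<Phi> c \<circ> chart_inv c) (H c \<circ> chart_inv c)"
  using H unfolding global_solution_def by blast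

lemma global_solution_transition:
  "c \<in> A \<Longrightarrow> d \<in> A \<Longrightarrow> p \<in> fst c \<Longrightarrow> p \<in> fst d \<Longrightarrow>
    H d p = twist n (\<lambda>a. \<xi> c d p powi weight n a) (H c p)"
  using H unfolding global_solution_def by blast

end

lemma subharmonic_cong_open:
  assumes S: "open S" and eq: "\<And>z. z \<in> S \<Longrightarrow> u z = v z" and u: "subharmonic u S"
  shows "subharmonic v S"
proof -
  have "(v has_derivative D) (at z)" if "(u has_derivative D) (at z)" "z \<in> S" for z D
    using has_derivative_transform_within_open[OF that(1) S that(2)] eq by simp
  then show ?thesis
    using u unfolding subharmonic_def z_derivative_def by blast
qed

text \<open>The trace is evaluated at the single point \<open>p0\<close>, where commuting with the
  Higgs field means commuting with \<open>e1_tilde n\<close>; constancy carries the value to every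
  other point.\<close>

lemma global_solution_trace:
  fixes A :: "('a::t2_space) chart set"
  assumes A: "closed_riemann_surface A"
    and H: "global_solution A \<xi> n \<Phi> H" and K: "global_solution A \<xi> n \<Phi> K"
    and n: "n > 0" and zero: "c0 \<in> A" "p0 \<in> fst c0" "\<Phi> c0 p0 = e1_tilde n"
    and c: "c \<in> A" "p \<in> fst c"
  shows "Re (mtrace (mat_inv (H c p) * K c p)) = real n"
proof -
  note S = closed_riemann_surfaceD[OF A]
  note HD = global_solutionD[OF A H] and KD = global_solutionD[OF A K]
  define f where "f = (\<lambda>c p. Re (mtrace (mat_inv (H c p) * K c p)))"
  have f: "f d p = f c p" if "c \<in> A" "d \<in> A" "p \<in> fst c" "p \<in> fst d" for c d p
    using mtrace_twist[OF HD(4)[OF that(1,3)] HD(3)[OF that(1,3)] _ KD(4)[OF that(1,3)],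
        of "\<lambda>a. \<xi> c d p powi weight n a"] HD(3)[OF that(2,4)]
    unfolding f_def global_solution_transition[OF A H that] global_solution_transition[OF A K that] by simp
  \<comment> \<open>A chart is chosen around each point to read the trace as one function on the
    surface; by \<open>f\<close> the choice is immaterial.\<close>
  obtain C where C: "\<And>p. C p \<in> A" "\<And>p. p \<in> fst (C p)"
    using S(3) by metis
  have loc: "Re (mtrace (mat_inv ((H d \<circ> chart_inv d) w) * (K d \<circ> chart_inv d) w)) =
      ((\<lambda>p. f (C p) p) \<circ> chart_inv d) w" if "d \<in> A" "w \<in> snd d ` fst d" for d w
    using f[OF that(1) C(1) S(8)[OF that] C(2)] by (simp add: f_def)
  have "\<exists>M. \<forall>p. f (C p) p = M"
  proof (rule subharmonic_constant[OF A])
    fix d assume d: "d \<in> A"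
    show "subharmonic ((\<lambda>p. f (C p) p) \<circ> chart_inv d) (snd d ` fst d)"
      by (rule subharmonic_cong_open[OF S(5)[OF d] loc[OF d]
            subharmonic_trace[OF S(5)[OF d] global_solution_local[OF A H d] global_solution_local[OF A K d]]])
  qed
  then obtain M where M: "\<And>p. f (C p) p = M" by blast
  have fM: "f d p = M" if "d \<in> A" "p \<in> fst d" for d p
    using f[OF C(1) that(1) C(2) that(2)] M by simp
  let ?w = "snd c0 p0"
  have w: "?w \<in> snd c0 ` fst c0" "chart_inv c0 ?w = p0"
    using zero S(7)[OF zero(1,2)] by auto
  have "mat_inv ((H c0 \<circ> chart_inv c0) ?w) * (K c0 \<circ> chart_inv c0) ?w * (\<Phi> c0 \<circ> chart_inv c0) ?w =
      (\<Phi> c0 \<circ> chart_inv c0) ?w * (mat_inv ((H c0 \<circ> chart_inv c0) ?w) * (K c0 \<circ> chart_inv c0) ?w)"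
    by (rule constant_trace_commute[OF S(5)[OF zero(1)] global_solution_local[OF A H zero(1)]
          global_solution_local[OF A K zero(1)] _ w(1), of M])
       (rule trans[OF loc[OF zero(1)]], assumption, simp add: M)
  then have comm: "mat_inv (H c0 p0) * K c0 p0 * e1_tilde n = e1_tilde n * (mat_inv (H c0 p0) * K c0 p0)"
    using w(2) zero(3) by simp
  note H0 = HD[OF zero(1,2)] and K0 = KD[OF zero(1,2)]
  have "mtrace (mat_inv (H c0 p0) * K c0 p0) = of_nat n"
  proof (rule mtrace_commute_e1_tilde[OF n H0(2) K0(2) _ _ _ comm])
    show "mat_inv (H c0 p0) * K c0 p0 \<in> carrier_mat n n"
      using H0 K0 by (simp add: sq_carrier[of _ n])
    show "K c0 p0 = H c0 p0 * (mat_inv (H c0 p0) * K c0 p0)"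
      by (rule left_cancel_mat[OF H0(7,4,5) K0(4), symmetric])
    have "Determinant.det (mat_inv (H c0 p0)) * Determinant.det (H c0 p0) = 1"
      unfolding det_mult[OF H0(5,4), symmetric] H0(6) by simp
    then show "Determinant.det (mat_inv (H c0 p0) * K c0 p0) = 1"
      unfolding det_mult[OF H0(5) K0(4)] using H0(3) K0(3) by simp
  qed
  then have "f c0 p0 = real n" by (simp add: f_def)
  then show ?thesis using fM[OF zero(1,2)] fM[OF c] by (simp add: f_def)
qed

text \<open>The trace lemma is used with the metrics in both orders, which supplies the traces of
  \<open>s\<close> and of its inverse.\<close>

lemma global_solution_unique:
  fixes A :: "('a::t2_space) chart set"
  assumes A: "closed_riemann_surface A"
    and H: "global_solution A \<xi> n \<Phi> H" and K: "global_solution A \<xi> n \<Phi> K"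
    and n: "n > 0" and zero: "c0 \<in> A" "p0 \<in> fst c0" "\<Phi> c0 p0 = e1_tilde n"
    and c: "c \<in> A" "p \<in> fst c"
  shows "H c p = K c p"
  using eq_if_traces[OF global_solutionD(2)[OF A H c] global_solutionD(2)[OF A K c]
      global_solutionD(5-7)[OF A H c] global_solutionD(5-7)[OF A K c]
      global_solution_trace[OF A H K n zero c] global_solution_trace[OF A K H n zero c]] .

lemma global_solution_twist:
  fixes A :: "('a::t2_space) chart set"
  assumes A: "closed_riemann_surface A" and H: "global_solution A \<xi> n \<Phi> H"
    and g: "\<And>a. a < n \<Longrightarrow> cmod (g a) = 1"
    and \<Phi>: "\<And>c p. twist n g (\<Phi> c p) = \<mu> \<cdot>\<^sub>m \<Phi> c p" and \<mu>: "\<mu> * cnj \<mu> = 1"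
  shows "global_solution A \<xi> n \<Phi> (\<lambda>c p. twist n g (H c p))"
  unfolding global_solution_def
proof (intro conjI ballI)
  fix c assume c: "c \<in> A"
  have "local_solution n (snd c ` fst c) (\<Phi> c \<circ> chart_inv c) (\<lambda>w. twist n g ((H c \<circ> chart_inv c) w))"
    by (rule local_solution_twist[OF g global_solution_local[OF A H c]
          closed_riemann_surfaceD(5)[OF A c] _ \<mu>]) (simp_all add: \<Phi>)
  then show "local_solution n (snd c ` fst c) (\<Phi> c \<circ> chart_inv c) ((\<lambda>p. twist n g (H c p)) \<circ> chart_inv c)"
    by (simp add: comp_def)
next
  fix c d p assume cdp: "c \<in> A" "d \<in> A" "p \<in> fst c \<inter> fst d"
  \<comment> \<open>The transition functions of \<open>E\<close> are diagonal as well, so they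
    commute with the gauge transformation, and the twisted metric is again a metric on
    \<open>E\<close>.\<close>
  show "twist n g (H d p) = twist n (\<lambda>a. \<xi> c d p powi weight n a) (twist n g (H c p))"
    by (subst global_solution_transition[OF A H cdp(1,2)])
       (use cdp in \<open>auto intro!: eq_matI simp: twist_def\<close>)
qed

lemma global_solution_dual:
  fixes A :: "('a::t2_space) chart set"
  assumes A: "closed_riemann_surface A" and H: "global_solution A \<xi> n \<Phi> H"
    and \<Phi>: "\<And>c p. anti_transpose n (\<Phi> c p) = \<Phi> c p"
  shows "global_solution A \<xi> n \<Phi> (\<lambda>c p. anti_transpose n (mat_inv (H c p)))"
  unfolding global_solution_def
proof (intro conjI ballI)
  fix c assume c: "c \<in> A"
  have "local_solution n (snd c ` fst c) (\<Phi> c \<circ> chart_inv c) (\<lambda>w. anti_transpose n (mat_inv ((H c \<circ> chart_inv c) w)))"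
    by (rule local_solution_dual[OF global_solution_local[OF A H c] closed_riemann_surfaceD(5)[OF A c]])
       (simp add: \<Phi>)
  then show "local_solution n (snd c ` fst c) (\<Phi> c \<circ> chart_inv c) ((\<lambda>p. anti_transpose n (mat_inv (H c p))) \<circ> chart_inv c)"
    by (simp add: comp_def)
next
  fix c d p assume cdp: "c \<in> A" "d \<in> A" "p \<in> fst c \<inter> fst d"
  define t where "t = (\<lambda>a. \<xi> c d p powi weight n a)"
  have cp: "c \<in> A" "p \<in> fst c" and dp: "d \<in> A" "p \<in> fst d" using cdp by auto
  note Hc = global_solutionD[OF A H cp] and Hd = global_solutionD[OF A H dp]
  have Hd_eq: "H d p = twist n t (H c p)"
    unfolding t_def by (rule global_solution_transition[OF A H cp(1) dp(1) cp(2) dp(2)])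
  \<comment> \<open>A vanishing factor would annihilate a diagonal entry of the positive definite
    \<open>H d p\<close>.\<close>
  have nz: "t a \<noteq> 0" if "a < n" for a
    using pos_def_hermitian_diag(1)[OF Hd(2) that] that unfolding Hd_eq by auto
  \<comment> \<open>The reflection changes the sign of the weight, which compensates for the
    inversion of the metric.\<close>
  have t_refl: "t (n - 1 - a) = inverse (t a)" if "a < n" for a
  proof -
    have "weight n (n - 1 - a) = - weight n a" using that by (simp add: weight_def of_nat_diff)
    then show ?thesis by (simp add: t_def power_int_minus)
  qed
  define Gd where "Gd = mat_inv (H d p)"
  have Gd: "Gd \<in> carrier_mat n n" using Hd by (simp add: Gd_def)
  have Gc: "mat_inv (H c p) = diag_of n t * Gd * mat_adjoint (diag_of n t)"
    unfolding Gd_def Hd_eq by (rule twist_inverse[OF Hc(4,3)]) (use Hd(3) Hd_eq in simp)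
  have adj: "mat_adjoint (diag_of n t) = diag_of n (\<lambda>a. cnj (t a))"
    by (rule eq_matI) (auto simp: diag_of_def)
  have DG: "diag_of n t * Gd \<in> carrier_mat n n" using Gd by (simp add: sq_carrier[of _ n])
  have entry: "mat_inv (H c p) $$ (i, j) = t i * Gd $$ (i, j) * cnj (t j)" if "i < n" "j < n" for i j
    unfolding Gc adj diag_of_mult_index(2)[OF DG that] diag_of_mult_index(1)[OF Gd that] ..
  show "anti_transpose n (mat_inv (H d p)) =
      twist n (\<lambda>a. \<xi> c d p powi weight n a) (anti_transpose n (mat_inv (H c p)))"
    unfolding t_def[symmetric] Gd_def[symmetric]
  proof (rule eq_matI)
    fix a b assume "a < dim_row (twist n t (anti_transpose n (mat_inv (H c p))))"
      "b < dim_col (twist n t (anti_transpose n (mat_inv (H c p))))"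
    then have ab: "a < n" "b < n" by auto
    then have "mat_inv (H c p) $$ (n - 1 - b, n - 1 - a) =
        inverse (t b) * Gd $$ (n - 1 - b, n - 1 - a) * cnj (inverse (t a))"
      using entry[of "n - 1 - b" "n - 1 - a"] t_refl[of a] t_refl[of b] by simp
    then show "anti_transpose n Gd $$ (a, b) = twist n t (anti_transpose n (mat_inv (H c p))) $$ (a, b)"
      using ab nz[of a] nz[of b] by (simp add: field_simps)
  qed simp_all
qed

section \<open>The Higgs fields\<close>

text \<open>The indices below \<open>n\<close> have distinct residues modulo \<open>n\<close>;
  modulo \<open>n - 1\<close> only the first and the last one coincide.\<close>

lemma off_diagonal_cases:
  fixes a b m n :: nat
  assumes n: "n \<ge> 2" and "m = n \<or> m = n - 1" and ab: "a < n" "b < n" "a \<noteq> b"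
    and "a mod m = b mod m"
  shows "m = n - 1 \<and> (a = 0 \<and> b = n - 1 \<or> a = n - 1 \<and> b = 0)"
proof -
  have "m \<noteq> n" using assms by auto
  then have m: "m = n - 1" using assms by auto
  have "k mod m = (if k = n - 1 then 0 else k)" if "k < n" for k
    using that n m by auto
  then have "(if a = n - 1 then 0 else a) = (if b = n - 1 then 0 else b)"
    using assms by metis
  then show ?thesis using m ab by (auto split: if_splits)
qed

text \<open>In the second case the twist by the \<open>(n-1)\<close>-th root of unity leaves the corner entries
  undetermined; there the duality forces \<open>2 H\<^sub>0\<^sub>,\<^sub>n\<^sub>-\<^sub>1 H\<^sub>n\<^sub>-\<^sub>1\<^sub>,\<^sub>n\<^sub>-\<^sub>1 = 0\<close>.\<close>

lemma symmetric_metric_diagonal: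
  fixes X G :: "complex mat"
  assumes n: "n \<ge> 2" and m: "m = n \<or> m = n - 1" "m \<ge> 1"
    and X: "pos_def_hermitian n X" and G: "G \<in> carrier_mat n n" "G * X = 1\<^sub>m n"
    and \<omega>: "\<omega> = exp (2 * of_real pi * \<i> / of_nat m)"
    and twist: "X = twist n (\<lambda>a. \<omega> ^ a) X" and dual: "X = anti_transpose n G"
  shows "\<And>a b. a < n \<Longrightarrow> b < n \<Longrightarrow> a \<noteq> b \<Longrightarrow> X $$ (a, b) = 0"
    and "\<And>a. a < n \<Longrightarrow> X $$ (n - 1 - a, n - 1 - a) * X $$ (a, a) = 1"
proof -
  note XD = pos_def_hermitianD[OF X]
  have \<omega>_pow: "\<omega> ^ a = exp (2 * of_real pi * \<i> * of_nat a / of_nat m)" for a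
    unfolding \<omega> by (simp add: exp_of_nat_mult[symmetric] algebra_simps)
  have zero: "X $$ (a, b) = 0" if ab: "a < n" "b < n" "\<omega> ^ a \<noteq> \<omega> ^ b" for a b
  proof (rule ccontr)
    assume nz: "X $$ (a, b) \<noteq> 0"
    have "X $$ (a, b) = cnj (\<omega> ^ a) * \<omega> ^ b * X $$ (a, b)"
      using arg_cong[OF twist, of "\<lambda>M. M $$ (a, b)"] ab by simp
    then have "cnj (\<omega> ^ a) * \<omega> ^ b = 1" using nz by simp
    moreover have "\<omega> ^ a * cnj (\<omega> ^ a) = 1"
      by (simp add: complex_norm_square[symmetric] norm_power \<omega> norm_exp_eq_Re del: complex_cnj_power)
    ultimately have "\<omega> ^ b = \<omega> ^ a" by (metis mult.commute mult.left_commute mult_1)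
    then show False using ab by simp
  qed
  have off: "X $$ (a, b) = 0" if ab: "a < n" "b < n" "a \<noteq> b" "\<not> (m = n - 1 \<and> (a = 0 \<and> b = n - 1 \<or> a = n - 1 \<and> b = 0))" for a b
  proof (rule zero[OF ab(1,2)])
    have "a mod m \<noteq> b mod m"
      using off_diagonal_cases[OF n m(1) ab(1-3)] ab(4) by blast
    then show "\<omega> ^ a \<noteq> \<omega> ^ b"
      unfolding \<omega>_pow complex_root_unity_eq[OF m(2)] .
  qed
  have Gent: "G $$ (a, b) = X $$ (n - 1 - b, n - 1 - a)" if "a < n" "b < n" for a b
    using arg_cong[OF dual, of "\<lambda>M. M $$ (n - 1 - b, n - 1 - a)"] that by simp
  have GX: "(\<Sum>k<n. G $$ (a, k) * X $$ (k, b)) = (if a = b then 1 else 0)" if "a < n" "b < n" for a b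
    using mult_mat_index[OF G(1) XD(1) that] that unfolding G(2) by simp
  have corner: "X $$ (0, n - 1) = 0"
  proof -
    have "0 = (\<Sum>k<n. G $$ (0, k) * X $$ (k, n - 1))"
      using GX[of 0 "n - 1"] n by simp
    also have "\<dots> = (\<Sum>k\<in>{0, n - 1}. G $$ (0, k) * X $$ (k, n - 1))"
      by (rule sum.mono_neutral_right) (use n off in auto)
    \<comment> \<open>The entry \<open>(0,0)\<close> of \<open>G\<close> reflects to the last
      diagonal entry of \<open>X\<close>, while the corner lies on the antidiagonal and reflects to
      itself. Hence the two surviving summands are equal.\<close>
    also have "\<dots> = 2 * (X $$ (n - 1, n - 1) * X $$ (0, n - 1))"
      using n Gent[of 0 0] Gent[of 0 "n - 1"] by simp
    finally show ?thesis
      using pos_def_hermitian_diag(1)[OF X, of "n - 1"] n by auto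
  qed
  have "X $$ (n - 1, 0) = 0"
    using pos_def_hermitian_cnj[OF X, of 0 "n - 1"] corner n by simp
  with corner off show *: "X $$ (a, b) = 0" if "a < n" "b < n" "a \<noteq> b" for a b
    using that by metis
  show "X $$ (n - 1 - a, n - 1 - a) * X $$ (a, a) = 1" if a: "a < n" for a
  proof -
    have "1 = (\<Sum>k<n. G $$ (a, k) * X $$ (k, a))"
      using GX[of a a] a by simp
    also have "\<dots> = (\<Sum>k\<in>{a}. G $$ (a, k) * X $$ (k, a))"
      by (rule sum.mono_neutral_right) (use a * in auto)
    finally show ?thesis using a Gent[of a a] by simp
  qed
qed

lemma twist_higgs:
  assumes "X \<in> carrier_mat n n"
    and "\<And>a b. a < n \<Longrightarrow> b < n \<Longrightarrow> X $$ (a, b) \<noteq> 0 \<Longrightarrow> cnj (\<omega> ^ a) * \<omega> ^ b = cnj \<omega>"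
  shows "twist n (\<lambda>a. \<omega> ^ a) X = cnj \<omega> \<cdot>\<^sub>m X"
proof (rule eq_matI)
  fix a b assume "a < dim_row (cnj \<omega> \<cdot>\<^sub>m X)" "b < dim_col (cnj \<omega> \<cdot>\<^sub>m X)"
  then have ab: "a < n" "b < n" using assms(1) by auto
  have "(cnj (\<omega> ^ a) * \<omega> ^ b) * X $$ (a, b) = cnj \<omega> * X $$ (a, b)"
    using assms(2)[OF ab] by (cases "X $$ (a, b) = 0") (simp_all del: complex_cnj_power)
  then show "twist n (\<lambda>a. \<omega> ^ a) X $$ (a, b) = (cnj \<omega> \<cdot>\<^sub>m X) $$ (a, b)"
    using ab assms(1) by simp
qed (use assms(1) in auto)

lemma cnj_power_mult:
  assumes "\<omega> * cnj \<omega> = 1" "\<omega> ^ Suc k = 1"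
  shows "cnj (\<omega> ^ Suc b) * \<omega> ^ b = cnj \<omega>" "\<omega> ^ k = cnj \<omega>"
proof -
  have "(cnj \<omega> * \<omega>) ^ b = 1" using assms(1) by (simp add: mult.commute)
  then show "cnj (\<omega> ^ Suc b) * \<omega> ^ b = cnj \<omega>" by (simp add: power_mult_distrib mult.assoc)
  have "\<omega> ^ k = \<omega> * cnj \<omega> * \<omega> ^ k" using assms(1) by simp
  also have "\<dots> = cnj \<omega>" using assms(2) by (simp add: mult_ac)
  finally show "\<omega> ^ k = cnj \<omega>" .
qed

text \<open>The twist multiplies the entry \<open>(a,b)\<close> by \<open>\<omega>\<close> to the
  power \<open>b - a\<close>. This exponent is \<open>-1\<close> on the subdiagonal and
  \<open>m - 1\<close> at the entries of \<open>q\<close>, so \<open>\<omega> ^ m = 1\<close> makes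
  the factors agree. The reflection preserves \<open>b - a\<close> and permutes the positions of
  \<open>q\<close>.\<close>

lemma higgs_symmetries:
  assumes "(n \<ge> 2 \<and> m = n \<and> X = e1_tilde n + q \<cdot>\<^sub>m e_top n) \<or>
    (n \<ge> 3 \<and> m = n - 1 \<and> X = e1_tilde n + q \<cdot>\<^sub>m e_subtop n)"
    and \<omega>: "\<omega> * cnj \<omega> = 1" "\<omega> ^ m = 1"
  shows "X \<in> carrier_mat n n" "anti_transpose n X = X" "twist n (\<lambda>a. \<omega> ^ a) X = cnj \<omega> \<cdot>\<^sub>m X"
proof -
  have m: "m > 0" using assms by auto
  note pow = cnj_power_mult[OF \<omega>(1), of "m - 1"]
  show X: "X \<in> carrier_mat n n"
    using assms(1) by (auto simp: e1_tilde_def e_top_def e_subtop_def)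
  define P :: "nat \<Rightarrow> nat \<Rightarrow> bool" where "P = (\<lambda>a b. if m = n then a = 0 \<and> b = n - 1
    else (a = 0 \<and> b = n - 2) \<or> (a = 1 \<and> b = n - 1))"
  have index: "X $$ (a, b) = (if a = b + 1 then 1 else 0) + q * (if P a b then 1 else 0)"
    if "a < n" "b < n" for a b
    using assms(1) that
    by (elim disjE conjE) (simp_all add: P_def e1_tilde_def e_top_def e_subtop_def)
  show "anti_transpose n X = X"
  proof (rule eq_matI)
    fix a b assume "a < dim_row X" "b < dim_col X"
    then have ab: "a < n" "b < n" using X by auto
    have "(n - 1 - b = n - 1 - a + 1) = (a = b + 1)" using ab by arith
    moreover have "P (n - 1 - b) (n - 1 - a) = P a b"
    proof (cases "m = n")
      case True
      then show ?thesis using ab unfolding P_def if_P[OF True] by arith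
    next
      case False
      then have "n \<ge> 3" using assms(1) by blast
      then show ?thesis using ab unfolding P_def if_not_P[OF False] by arith
    qed
    moreover have "n - 1 - b < n" "n - 1 - a < n" using ab by auto
    ultimately show "anti_transpose n X $$ (a, b) = X $$ (a, b)"
      by (simp only: anti_transpose_index[OF ab] index[OF ab] index)
  qed (use X in auto)
  show "twist n (\<lambda>a. \<omega> ^ a) X = cnj \<omega> \<cdot>\<^sub>m X"
  proof (rule twist_higgs[OF X])
    fix a b assume ab: "a < n" "b < n" and nz: "X $$ (a, b) \<noteq> 0"
    have pm: "\<omega> ^ (m - 1) = cnj \<omega>" using pow(2) \<omega>(2) m by simp
    have "a = Suc b \<or> P a b"
      using nz unfolding index[OF ab] by (auto split: if_splits)
    moreover have "m = n \<or> n = Suc m"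
      using assms(1) by arith
    \<comment> \<open>The positions of \<open>q\<close> are rewritten in terms of \<open>m\<close>;
      the last alternative is the second entry of \<open>e_subtop n\<close>.\<close>
    ultimately have "a = Suc b \<or> (a = 0 \<and> b = m - 1) \<or> (a = 1 \<and> b = m \<and> n = Suc m)"
    proof (cases "m = n")
      case False
      moreover assume "m = n \<or> n = Suc m"
      ultimately have "n = Suc m" "n - 1 = m" "n - 2 = m - 1" by auto
      then show ?thesis using \<open>a = Suc b \<or> P a b\<close> unfolding P_def if_not_P[OF False] by metis
    qed (simp add: P_def)
    then consider "a = Suc b" | "a = 0" "b = m - 1" | "a = 1" "b = m" "n = Suc m"
      by blast
    then show "cnj (\<omega> ^ a) * \<omega> ^ b = cnj \<omega>"
    proof cases
      case 1
      then show ?thesis using pow(1)[of b] \<omega>(2) m by simp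
    qed (use pm \<omega>(2) in simp_all)
  qed
qed

theorem corollary2p11:
  fixes A :: "('a::t2_space) chart set"
    and \<xi> :: "'a chart \<Rightarrow> 'a chart \<Rightarrow> 'a \<Rightarrow> complex"
    and n :: nat
    and \<Phi> H :: "'a chart \<Rightarrow> 'a \<Rightarrow> complex mat"
  assumes "closed_riemann_surface A"
    and "genus A \<ge> 2"
    and "square_root_K A \<xi>"
    and "(n \<ge> 2 \<and> (\<exists>q \<in> H0_K A n. \<Phi> = higgs_top n q)) \<or>
         (n \<ge> 3 \<and> (\<exists>q \<in> H0_K A (n - 1). \<Phi> = higgs_subtop n q))"
    and "harmonic_metric A \<xi> n \<Phi> H"
  shows "\<exists>\<eta> :: nat \<Rightarrow> 'a chart \<Rightarrow> 'a \<Rightarrow> real.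
           (\<forall>a<n. line_metric A \<xi> (weight n a) (\<eta> a)) \<and>
           (\<forall>a<n. \<forall>c\<in>A. \<forall>p\<in>fst c. \<eta> (n - 1 - a) c p = dual_metric (\<eta> a) c p) \<and>
           (\<forall>c\<in>A. \<forall>p\<in>fst c. H c p = diagonal_metric n \<eta> c p)"
proof -
  note S = closed_riemann_surfaceD[OF assms(1)]
  obtain m q where q: "q \<in> H0_K A m"
    and cases: "(n \<ge> 2 \<and> m = n \<and> \<Phi> = higgs_top n q) \<or> (n \<ge> 3 \<and> m = n - 1 \<and> \<Phi> = higgs_subtop n q)"
    using assms(4) by blast
  have n: "n \<ge> 2" and m: "m = n \<or> m = n - 1" "m \<ge> 1" using cases by auto
  define \<omega> where "\<omega> = exp (2 * of_real pi * \<i> / of_nat m)"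
  have norm: "cmod \<omega> = 1" by (simp add: \<omega>_def norm_exp_eq_Re)
  have \<omega>: "\<omega> * cnj \<omega> = 1" "\<omega> ^ m = 1"
    using norm complex_root_unity[of m 1] m(2) by (simp_all add: complex_norm_square[symmetric] \<omega>_def)
  have \<Phi>: "(n \<ge> 2 \<and> m = n \<and> \<Phi> c p = e1_tilde n + q c p \<cdot>\<^sub>m e_top n) \<or>
    (n \<ge> 3 \<and> m = n - 1 \<and> \<Phi> c p = e1_tilde n + q c p \<cdot>\<^sub>m e_subtop n)" for c p
    using cases by (auto simp: higgs_top_def higgs_subtop_def)
  note sym = higgs_symmetries[OF \<Phi> \<omega>]
  obtain c0 p0 where zero: "c0 \<in> A" "p0 \<in> fst c0" "q c0 p0 = 0"
    using H0_K_has_zero[OF assms(1,2) q] m(2) by auto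
  have \<Phi>0: "\<Phi> c0 p0 = e1_tilde n"
    using \<Phi>[of c0 p0] zero(3) by (auto simp: e1_tilde_def e_top_def e_subtop_def intro!: eq_matI)
  note H = harmonic_global_solution[OF assms(1,5) sym(1)]
  note unique = global_solution_unique[OF assms(1) H _ _ zero(1,2) \<Phi>0]
  have twist: "H c p = twist n (\<lambda>a. \<omega> ^ a) (H c p)" if "c \<in> A" "p \<in> fst c" for c p
    by (rule unique[OF global_solution_twist[OF assms(1) H _ sym(3)] _ that])
       (use n norm \<omega>(1) in \<open>simp_all add: norm_power mult.commute\<close>)
  have dual: "H c p = anti_transpose n (mat_inv (H c p))" if "c \<in> A" "p \<in> fst c" for c p
    by (rule unique[OF global_solution_dual[OF assms(1) H sym(2)] _ that]) (use n in simp)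
  note HD = global_solutionD[OF assms(1) H]
  \<comment> \<open>Each of the five composed facts about \<open>H c p\<close> brings its own
    premises on the chart and the point, which are therefore supplied five times below.\<close>
  note diagonal = symmetric_metric_diagonal[OF n m HD(2,5,6) \<omega>_def twist dual]
  \<comment> \<open>The diagonal entries of a positive definite matrix are positive reals, so taking
    the real part loses nothing.\<close>
  define \<eta> where "\<eta> = (\<lambda>a c p. Re (H c p $$ (a, a)))"
  have \<eta>: "\<eta> a c p > 0" "H c p $$ (a, a) = of_real (\<eta> a c p)" if "a < n" "c \<in> A" "p \<in> fst c" for a c p
    using pos_def_hermitian_diag[OF HD(2)[OF that(2,3)] that(1)] by (simp_all add: \<eta>_def)
  have "line_metric A \<xi> (weight n a) (\<eta> a)" if a: "a < n" for a
    unfolding line_metric_def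
  proof (intro conjI ballI)
    show "\<eta> a c p > 0" if "c \<in> A" "p \<in> fst c" for c p using \<eta>(1)[OF a that] .
  next
    fix c assume c: "c \<in> A"
    have "smooth_in_chart c (\<lambda>p. H c p $$ (a, a))"
      using assms(5) c a unfolding harmonic_metric_def hermitian_metric_def by blast
    then show "smooth_in_chart c (\<lambda>p. complex_of_real (\<eta> a c p))"
      unfolding smooth_in_chart_def
      by (subst C_k_cong_open[OF S(5)[OF c]]) (use \<eta>(2)[OF a c] S(8)[OF c] in auto)
  next
    fix c d p assume cd: "c \<in> A" "d \<in> A" "p \<in> fst c \<inter> fst d"
    let ?t = "\<xi> c d p powi weight n a"
    have "H d p $$ (a, a) = cnj ?t * ?t * H c p $$ (a, a)"
      using assms(5) cd a unfolding harmonic_metric_def hermitian_metric_def by blast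
    also have "cnj ?t * ?t = of_real ((cmod ?t)\<^sup>2)"
      by (simp only: complex_norm_square mult.commute)
    finally have "complex_of_real (\<eta> a d p) = of_real ((cmod ?t)\<^sup>2 * \<eta> a c p)"
      using \<eta>(2)[OF a] cd by simp
    then show "\<eta> a d p = (cmod ?t)\<^sup>2 * \<eta> a c p"
      by (simp only: of_real_eq_iff)
  qed
  moreover have "\<eta> (n - 1 - a) c p = dual_metric (\<eta> a) c p" if a: "a < n" "c \<in> A" "p \<in> fst c" for a c p
  proof -
    have "complex_of_real (\<eta> (n - 1 - a) c p * \<eta> a c p) = of_real 1"
      using diagonal(2)[OF a(2,3,2,3,2,3,2,3,2,3) a(1)] \<eta>(2)[OF _ a(2,3), of "n - 1 - a"] \<eta>(2)[OF a] a by simp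
    then have "\<eta> (n - 1 - a) c p * \<eta> a c p = 1"
      by (simp only: of_real_eq_iff)
    then show ?thesis
      using \<eta>(1)[OF a] by (simp add: dual_metric_def field_simps)
  qed
  moreover have "H c p = diagonal_metric n \<eta> c p" if c: "c \<in> A" "p \<in> fst c" for c p
    by (rule eq_matI)
       (use HD(4)[OF c] \<eta>(2)[OF _ c] diagonal(1)[OF c c c c c] in \<open>auto simp: diagonal_metric_def\<close>)
  ultimately show ?thesis by blast
qed

end
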